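(* Suppose $\psi\in C^4(\mathbb R)$ is strictly convex, has uniformly bounded third and fourth derivatives, and is independent of both $d$ and $n$. Let $\phi(x)=\mathbb E[\psi(Z^\top x)]$ for $x\in\mathbb R^d$, with $Z\sim\mathcal N(0,I_d)$, let $x^*=e_1=(1,0,\dots,0)\in\mathbb R^d$, let $$v(x)=\phi(x)-\nabla\phi(x^* )^\top x=\mathbb E[\psi(Z^\top x)]-\mathbb E[\psi'(Z^\top x^* )Z^\top x],\qquad x\in\mathbb R^d,$$ and let $V=nv$ and $\pi\propto e^{-nv}=e^{-V}$ on $\mathbb R^d$. Let $\hat x=x^*$, which is the unique global minimizer of $v$, and $H_V=\nabla^2V(\hat x)$, $\hat\gamma=\mathcal N(\hat x,H_V^{-1})$, $\bar x=\int x\,d\pi(x)$, $$L_{\mathrm{TV}}=\frac1{12}\mathbb E\big|\langle\nabla^3V(\hat x),(H_V^{-1/2}Z)^{\otimes3}\rangle\big|,\qquad\delta\hat x=-\frac12H_V^{-1}\langle\nabla^3V(\hat x),H_V^{-1}\rangle .$$ Then $$|\mathrm{TV}(\pi,\hat\gamma)-L_{\mathrm{TV}}|\lesssim\epsilon^2+\tau,\qquad\|\bar x-\hat x-\delta\hat x\|_{H_V}\lesssim\epsilon^2+\tau,$$ where $\epsilon=d/\sqrt n$ and $\tau=d\exp(-Cn^{1/4}\sqrt d)$.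
   Context: $\mathrm{TV}$ is total variation distance, $\mathrm{TV}(\mu,\nu)=\sup_A|\mu(A)-\nu(A)|$ over Borel sets. $\|x\|_H=\sqrt{x^\top Hx}$. $\langle\cdot,\cdot\rangle$ is the entrywise inner product of tensors, and for a symmetric order-3 tensor $T$ and a symmetric matrix $A$, $\langle T,A\rangle\in\mathbb R^d$ has coordinates $\sum_{j,k}T_{ijk}A_{jk}$. $a\lesssim b$ means $a\le C'b$ for an absolute constant $C'>0$; here the constants ($C'$ and the $C>0$ in $\tau$) do not depend on $d$ or $n$, but may depend on the fixed function $\psi$. *)

theory Defs
  imports
    "HOL-Probability.Probability"
    "Jordan_Normal_Form.Gauss_Jordan_Elimination"
    "Jordan_Normal_Form.Determinant"
begin

text \<open>
  The constants of the theorem are uniform in the dimension \<open>d\<close>, so \<open>d\<close> is a natural number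
  rather than a type: points of \<open>d\<close>-dimensional space are the extensional functions
  \<open>nat \<Rightarrow> real\<close> on \<open>{..<d}\<close> (the space of \<^term>\<open>PiM {..<d} (\<lambda>_. lborel)\<close>), so that
  the first coordinate has index 0, and matrices are those of \<open>Jordan_Normal_Form\<close>.
\<close>

definition Rd :: "nat \<Rightarrow> (nat \<Rightarrow> real) set" where
  "Rd d = {..<d} \<rightarrow>\<^sub>E UNIV"

definition leb :: "nat \<Rightarrow> (nat \<Rightarrow> real) measure" where
  "leb d = PiM {..<d} (\<lambda>_. lborel)"

definition dot :: "nat \<Rightarrow> (nat \<Rightarrow> real) \<Rightarrow> (nat \<Rightarrow> real) \<Rightarrow> real" where
  "dot d x y = (\<Sum>i<d. x i * y i)"

definition origin :: "nat \<Rightarrow> nat \<Rightarrow> real" where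
  "origin d = (\<lambda>i\<in>{..<d}. 0)"

definition first_unit :: "nat \<Rightarrow> nat \<Rightarrow> real" where
  "first_unit d = (\<lambda>i\<in>{..<d}. if i = 0 then 1 else 0)"


definition mat_app :: "real mat \<Rightarrow> (nat \<Rightarrow> real) \<Rightarrow> nat \<Rightarrow> real" where
  "mat_app A x = (\<lambda>i\<in>{..<dim_row A}. \<Sum>j<dim_col A. A $$ (i, j) * x j)"

definition quad_form :: "real mat \<Rightarrow> (nat \<Rightarrow> real) \<Rightarrow> real" where
  "quad_form A x = (\<Sum>i<dim_row A. \<Sum>j<dim_col A. x i * A $$ (i, j) * x j)"

definition norm_mat :: "real mat \<Rightarrow> (nat \<Rightarrow> real) \<Rightarrow> real" where
  "norm_mat A x = sqrt (quad_form A x)"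

definition inv_mat :: "real mat \<Rightarrow> real mat" where
  "inv_mat A = the (mat_inverse A)"

definition pos_semidef :: "real mat \<Rightarrow> bool" where
  "pos_semidef A \<longleftrightarrow> square_mat A \<and> transpose_mat A = A \<and> (\<forall>x. 0 \<le> quad_form A x)"

text \<open>The unique positive semidefinite square root of a positive semidefinite matrix.\<close>

definition sqrt_mat :: "real mat \<Rightarrow> real mat" where
  "sqrt_mat A = (THE S. pos_semidef S \<and> dim_row S = dim_row A \<and> S * S = A)"

definition inv_sqrt_mat :: "real mat \<Rightarrow> real mat" where
  "inv_sqrt_mat A = sqrt_mat (inv_mat A)"


definition partial :: "nat \<Rightarrow> ((nat \<Rightarrow> real) \<Rightarrow> real) \<Rightarrow> (nat \<Rightarrow> real) \<Rightarrow> real" where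
  "partial i f x = deriv (\<lambda>t. f (x(i := t))) (x i)"

definition gradient :: "nat \<Rightarrow> ((nat \<Rightarrow> real) \<Rightarrow> real) \<Rightarrow> (nat \<Rightarrow> real) \<Rightarrow> nat \<Rightarrow> real" where
  "gradient d f x = (\<lambda>i\<in>{..<d}. partial i f x)"

definition hessian :: "nat \<Rightarrow> ((nat \<Rightarrow> real) \<Rightarrow> real) \<Rightarrow> (nat \<Rightarrow> real) \<Rightarrow> real mat" where
  "hessian d f x = mat d d (\<lambda>(i, j). partial i (partial j f) x)"

definition third_deriv ::
  "((nat \<Rightarrow> real) \<Rightarrow> real) \<Rightarrow> (nat \<Rightarrow> real) \<Rightarrow> nat \<Rightarrow> nat \<Rightarrow> nat \<Rightarrow> real" where
  "third_deriv f x i j k = partial i (partial j (partial k f)) x"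

text \<open>\<open>\<langle>T, w\<otimes>w\<otimes>w\<rangle>\<close> and \<open>\<langle>T, A\<rangle>\<close>, respectively.\<close>

definition tensor_cube :: "nat \<Rightarrow> (nat \<Rightarrow> nat \<Rightarrow> nat \<Rightarrow> real) \<Rightarrow> (nat \<Rightarrow> real) \<Rightarrow> real" where
  "tensor_cube d T w = (\<Sum>i<d. \<Sum>j<d. \<Sum>k<d. T i j k * (w i * w j * w k))"

definition tensor_mat :: "nat \<Rightarrow> (nat \<Rightarrow> nat \<Rightarrow> nat \<Rightarrow> real) \<Rightarrow> real mat \<Rightarrow> nat \<Rightarrow> real" where
  "tensor_mat d T A = (\<lambda>i\<in>{..<d}. \<Sum>j<d. \<Sum>k<d. T i j k * A $$ (j, k))"


text \<open>The Gaussian measure with mean \<open>m\<close> and nonsingular covariance matrix \<open>S\<close>.\<close>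

definition gaussian :: "nat \<Rightarrow> (nat \<Rightarrow> real) \<Rightarrow> real mat \<Rightarrow> (nat \<Rightarrow> real) measure" where
  "gaussian d m S = density (leb d) (\<lambda>x. ennreal
     (exp (- quad_form (inv_mat S) (\<lambda>i. x i - m i) / 2) / sqrt ((2 * pi) ^ d * det S)))"

definition std_gaussian :: "nat \<Rightarrow> (nat \<Rightarrow> real) measure" where
  "std_gaussian d = gaussian d (origin d) (1\<^sub>m d)"

text \<open>The probability measure proportional to \<open>exp (- V)\<close>.\<close>

definition gibbs :: "nat \<Rightarrow> ((nat \<Rightarrow> real) \<Rightarrow> real) \<Rightarrow> (nat \<Rightarrow> real) measure" where
  "gibbs d V = density (leb d) (\<lambda>x. ennreal (exp (- V x) / (\<integral>y. exp (- V y) \<partial>leb d)))"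

definition mean :: "nat \<Rightarrow> (nat \<Rightarrow> real) measure \<Rightarrow> nat \<Rightarrow> real" where
  "mean d M = (\<lambda>i\<in>{..<d}. \<integral>x. x i \<partial>M)"

definition TV :: "'a measure \<Rightarrow> 'a measure \<Rightarrow> real" where
  "TV M N = (SUP A\<in>sets M. \<bar>measure M A - measure N A\<bar>)"

definition L_TV :: "nat \<Rightarrow> ((nat \<Rightarrow> real) \<Rightarrow> real) \<Rightarrow> (nat \<Rightarrow> real) \<Rightarrow> real" where
  "L_TV d V xh = 1 / 12 *
     (\<integral>z. \<bar>tensor_cube d (third_deriv V xh) (mat_app (inv_sqrt_mat (hessian d V xh)) z)\<bar>
        \<partial>std_gaussian d)"

definition delta_x :: "nat \<Rightarrow> ((nat \<Rightarrow> real) \<Rightarrow> real) \<Rightarrow> (nat \<Rightarrow> real) \<Rightarrow> nat \<Rightarrow> real" where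
  "delta_x d V xh = (let Hi = inv_mat (hessian d V xh) in
     (\<lambda>i\<in>{..<d}. - 1 / 2 * mat_app Hi (tensor_mat d (third_deriv V xh) Hi) i))"


definition C4 :: "(real \<Rightarrow> real) \<Rightarrow> bool" where
  "C4 f \<longleftrightarrow> (\<forall>k<4. \<forall>x. (deriv ^^ k) f differentiable at x) \<and> continuous_on UNIV ((deriv ^^ 4) f)"

definition strictly_convex :: "(real \<Rightarrow> real) \<Rightarrow> bool" where
  "strictly_convex f \<longleftrightarrow> (\<forall>x y t. x \<noteq> y \<longrightarrow> 0 < t \<longrightarrow> t < 1 \<longrightarrow>
     f ((1 - t) * x + t * y) < (1 - t) * f x + t * f y)"

definition phi :: "(real \<Rightarrow> real) \<Rightarrow> nat \<Rightarrow> (nat \<Rightarrow> real) \<Rightarrow> real" where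
  "phi \<psi> d x = (\<integral>z. \<psi> (dot d z x) \<partial>std_gaussian d)"

definition v_fun :: "(real \<Rightarrow> real) \<Rightarrow> nat \<Rightarrow> (nat \<Rightarrow> real) \<Rightarrow> real" where
  "v_fun \<psi> d x = phi \<psi> d x - dot d (gradient d (phi \<psi> d) (first_unit d)) x"

end

theory Submission
  imports Defs
begin

text \<open>
  Write \<open>y = x - e\<^sub>1\<close>, let \<open>\<rho>\<close> be the norm of the coordinates of \<open>y\<close> other than the first, and let
  \<open>a = E \<psi>''(G) G\<^sup>2\<close>, \<open>b = E \<psi>''(G)\<close>, \<open>\<alpha> = E \<psi>'''(G) G\<^sup>3\<close>, \<open>\<beta> = E \<psi>'''(G) G\<close> for a standard normal
  \<open>G\<close>. Taylor expansion of \<open>\<psi>\<close> under the expectation, where \<open>E (Z \<bullet> y)\<^sup>4 = 3 |y|\<^sup>4\<close>, gives with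
  dimension-free constants
  \<open>v(x) = v(e\<^sub>1) + (a y\<^sub>0\<^sup>2 + b \<rho>\<^sup>2)/2 + (\<alpha> y\<^sub>0\<^sup>3 + 3 \<beta> y\<^sub>0 \<rho>\<^sup>2)/6 + O(|y|\<^sup>4)\<close>
  and similar expansions of the partial derivatives; convexity of \<open>\<psi>\<close> gives
  \<open>\<nabla>v(x) \<bullet> y \<ge> c min(|y|\<^sup>2, |y|)\<close>.

  Integration by parts against \<open>\<pi>\<close> and against the Gaussian then yields all moments that are needed,
  \<open>E |y|\<^bsup>2k\<^esup> \<lesssim> (d/n)\<^sup>k\<close> and \<open>E y\<^sub>0\<^sup>2 |y|\<^sup>4 \<lesssim> d\<^sup>2/n\<^sup>3\<close>: the cubic term is of size \<open>\<epsilon>\<close> and the remainder of size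
  \<open>\<epsilon>\<^sup>2\<close> under both measures. The total variation distance is half the Gaussian mean of \<open>|e\<^bsup>-R\<^esup>/Z - 1|\<close>, whose
  leading part is the cubic term, and the expansion of the mean follows from integration by parts with
  the test functions \<open>1\<close>, \<open>y\<^sub>0\<close> and \<open>y\<^sub>i\<close>. For \<open>\<epsilon>\<close> bounded below crude bounds suffice.
\<close>

section \<open>Integration against coercive potentials\<close>

text \<open>The obstacle is the size of the cubic term: bounding it by n |y|^3 with |y|^2 of order
  d/n gives d^(3/2)/sqrt n, too large by sqrt d. Rotational symmetry about the first axis removes
  the excess: every monomial of the cubic form contains y_0, and y_0^2 is of order 1/n, so the term
  is of order n * n^(-1/2) * d/n = \<epsilon>. This is why the weighted moment of y_0^2 |y|^4 is
  treated separately, by an integration by parts in the first coordinate only. Moments are preferred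
  to concentration estimates because the potential may grow only linearly far from e_1, while the
  integration by parts identities hold globally. Linear growth puts the moment being bounded on the
  right-hand side as well, with a factor of order d/n, and it is absorbed when d/n is small.
  Symmetry also makes the Hessian diagonal with two distinct values, so that matrix inverses and
  square roots are computed for diagonal matrices, and it reduces the mean to its first
  coordinate.\<close>

interpretation lebP: product_sigma_finite "\<lambda>_::nat. lborel :: real measure"
  by standard

lemma sets_leb [measurable_cong]: "sets (leb d) = sets (PiM {..<d} (\<lambda>_. borel))"
  unfolding leb_def by (intro sets_PiM_cong) auto

lemma space_leb: "space (leb d) = Rd d"
  by (simp add: leb_def Rd_def space_PiM)

lemma sigma_finite_leb: "sigma_finite_measure (leb d)"
  unfolding leb_def by (rule lebP.sigma_finite) simp

lemma measurable_coord [measurable]: "i < d \<Longrightarrow> (\<lambda>x. x i) \<in> borel_measurable (leb d)"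
  by (subst measurable_cong_sets[OF sets_leb refl]) (rule measurable_component_singleton, simp)

text \<open>The l1 norm is used because exp (- \<kappa> * l1_norm d x) factors over the coordinates,
  so integrability on the product space reduces to one variable.\<close>

definition l1_norm :: "nat \<Rightarrow> (nat \<Rightarrow> real) \<Rightarrow> real" where
  "l1_norm d x = (\<Sum>i<d. \<bar>x i\<bar>)"

lemma l1_nonneg [simp]: "0 \<le> l1_norm d x"
  by (simp add: l1_norm_def sum_nonneg)

lemma coord_le_l1: "i < d \<Longrightarrow> \<bar>x i\<bar> \<le> l1_norm d x"
  unfolding l1_norm_def by (rule member_le_sum) auto

lemma measurable_l1 [measurable]: "l1_norm d \<in> borel_measurable (leb d)"
  unfolding l1_norm_def by measurable

lemma l1_fun_upd: "i < d \<Longrightarrow> l1_norm d (x(i := t)) = (\<Sum>j\<in>{..<d}-{i}. \<bar>x j\<bar>) + \<bar>t\<bar>"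
  by (simp add: l1_norm_def sum.remove[of "{..<d}" i])

text \<open>Comparison with 1/(1 + t^2): the inequality e^u \<ge> 1 + u + u^2/2 at u = \<kappa> |t|
  dominates a multiple of 1 + t^2.\<close>

lemma integrable_exp_abs:
  assumes "\<kappa> > (0::real)"
  shows "integrable lborel (\<lambda>t::real. exp (- \<kappa> * \<bar>t\<bar>))"
proof (rule Bochner_Integration.integrable_bound)
  show "integrable lborel (\<lambda>t::real. (1 / min 1 (\<kappa>\<^sup>2 / 2)) * inverse (1 + t\<^sup>2))"
    using integrable_inverse_1_plus_square by (simp add: set_integrable_def)
  show "AE t in lborel. norm (exp (- \<kappa> * \<bar>t\<bar>)) \<le> norm ((1 / min 1 (\<kappa>\<^sup>2 / 2)) * inverse (1 + t\<^sup>2))"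
  proof (rule AE_I2)
    fix t :: real
    let ?c = "min 1 (\<kappa>\<^sup>2 / 2)"
    have c: "?c > 0" using assms by simp
    have "?c * (1 + t\<^sup>2) = ?c * 1 + ?c * t\<^sup>2" by (simp add: algebra_simps)
    also have "\<dots> \<le> 1 + (\<kappa>\<^sup>2 / 2) * t\<^sup>2" by (intro add_mono mult_right_mono) auto
    also have "\<dots> \<le> 1 + \<kappa> * \<bar>t\<bar> + (\<kappa> * \<bar>t\<bar>)\<^sup>2 / 2" using assms by (simp add: power_mult_distrib)
    also have "\<dots> \<le> exp (\<kappa> * \<bar>t\<bar>)" using assms by (intro exp_lower_Taylor_quadratic) auto
    finally have *: "?c * (1 + t\<^sup>2) \<le> exp (\<kappa> * \<bar>t\<bar>)" .
    have p: "1 + t\<^sup>2 > 0" by (simp add: add_pos_nonneg)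
    have "exp (- \<kappa> * \<bar>t\<bar>) \<le> inverse (?c * (1 + t\<^sup>2))"
      using le_imp_inverse_le[OF *] c p by (simp add: exp_minus)
    then show "norm (exp (- \<kappa> * \<bar>t\<bar>)) \<le> norm ((1 / ?c) * inverse (1 + t\<^sup>2))"
      using c p by (simp add: divide_simps abs_mult)
  qed
qed simp

lemma poly_exp_le_exp:
  fixes \<kappa> :: real
  assumes "\<kappa> > 0"
  obtains C where "C \<ge> 0" "\<And>u. u \<ge> 0 \<Longrightarrow> (1 + u) ^ m * exp (- \<kappa> * u) \<le> C * exp (- (\<kappa> / 2) * u)"
proof -
  \<comment> \<open>With x = \<kappa> (1 + u)/c, the bound x \<le> e^x costs the exponent m x \<le>
    \<kappa> (1 + u)/2, half of the available decay; the extra 2 keeps c positive for m = 0.\<close>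
  define c where "c = real (2 * m + 2)"
  have c: "c > 0" by (simp add: c_def)
  have "(1 + u) ^ m * exp (- \<kappa> * u) \<le> (c / \<kappa>) ^ m * exp (\<kappa> / 2) * exp (- (\<kappa> / 2) * u)"
    if "u \<ge> 0" for u
  proof -
    define x where "x = \<kappa> * (1 + u) / c"
    have x: "0 \<le> x" "x \<le> exp x"
      using assms that c exp_ge_add_one_self[of x] by (auto simp: x_def intro: order_trans[of _ "1 + x"])
    have "1 + u = (c / \<kappa>) * x" using assms c by (simp add: x_def)
    then have "(1 + u) ^ m = (c / \<kappa>) ^ m * x ^ m" by (metis power_mult_distrib)
    also have "x ^ m \<le> exp x ^ m" using x by (intro power_mono) auto
    also have "exp x ^ m = exp (m * x)" by (simp add: exp_of_nat_mult)
    also have "real m * x \<le> c / 2 * x" using x by (intro mult_right_mono) (auto simp: c_def)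
    also have "c / 2 * x = \<kappa> * (1 + u) / 2" using c by (simp add: x_def)
    finally have "(1 + u) ^ m \<le> (c / \<kappa>) ^ m * exp (\<kappa> * (1 + u) / 2)"
      using assms c by (simp add: mult_left_mono)
    then have "(1 + u) ^ m * exp (- \<kappa> * u) \<le> (c / \<kappa>) ^ m * exp (\<kappa> * (1 + u) / 2) * exp (- \<kappa> * u)"
      by (rule mult_right_mono) simp
    also have "\<dots> = (c / \<kappa>) ^ m * exp (\<kappa> / 2) * exp (- (\<kappa> / 2) * u)"
      by (simp add: mult.assoc exp_add[symmetric] field_simps)
    finally show ?thesis .
  qed
  then show thesis using assms c by (intro that[of "(c / \<kappa>) ^ m * exp (\<kappa> / 2)"]) auto
qed

lemma integrable_poly_exp:
  fixes h :: "real \<Rightarrow> real"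
  assumes [measurable]: "h \<in> borel_measurable borel" and "\<kappa> > 0"
    and le: "\<And>t. \<bar>h t\<bar> \<le> C * ((1 + \<bar>t\<bar>) ^ m * exp (- \<kappa> * \<bar>t\<bar>))"
  shows "integrable lborel h"
proof -
  obtain A where A: "A \<ge> 0" "\<And>u. u \<ge> 0 \<Longrightarrow> (1 + u) ^ m * exp (- \<kappa> * u) \<le> A * exp (- (\<kappa> / 2) * u)"
    using poly_exp_le_exp[OF assms(2)] by blast
  show ?thesis
  proof (rule Bochner_Integration.integrable_bound)
    show "integrable lborel (\<lambda>t::real. (\<bar>C\<bar> * A) * exp (- (\<kappa>/2) * \<bar>t\<bar>))"
      using integrable_exp_abs[of "\<kappa>/2"] \<open>\<kappa> > 0\<close> by (intro integrable_mult_right) auto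
    show "AE t in lborel. norm (h t) \<le> norm ((\<bar>C\<bar> * A) * exp (- (\<kappa>/2) * \<bar>t\<bar>))"
    proof (rule AE_I2)
      fix t
      have "\<bar>h t\<bar> \<le> \<bar>C\<bar> * ((1 + \<bar>t\<bar>) ^ m * exp (- \<kappa> * \<bar>t\<bar>))"
        by (rule order_trans[OF le], intro mult_right_mono) auto
      also have "\<dots> \<le> \<bar>C\<bar> * (A * exp (- (\<kappa>/2) * \<bar>t\<bar>))"
        by (intro mult_left_mono A) auto
      finally show "norm (h t) \<le> norm ((\<bar>C\<bar> * A) * exp (- (\<kappa>/2) * \<bar>t\<bar>))"
        using order_trans[OF _ abs_ge_self] by (simp add: mult.assoc)
    qed
  qed simp
qed

lemma integrable_exp_l1:
  assumes "\<kappa> > 0"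
  shows "integrable (leb d) (\<lambda>x. exp (- \<kappa> * l1_norm d x))"
proof -
  have "exp (- \<kappa> * l1_norm d x) = (\<Prod>i<d. exp (- \<kappa> * \<bar>x i\<bar>))" for x
    by (simp add: l1_norm_def sum_distrib_left exp_sum sum_negf[symmetric])
  then show ?thesis
    unfolding leb_def using lebP.product_integrable_prod[of "{..<d}" "\<lambda>_ t. exp (- \<kappa> * \<bar>t\<bar>)"]
      integrable_exp_abs[OF assms] by simp
qed

text \<open>An algebra of functions integrable against every coercive weight. Membership follows
  from the rules collected in \<open>tame_intros\<close>, so linearity and monotonicity of
  expectations require no separate integrability arguments.\<close>

definition tame :: "nat \<Rightarrow> ((nat \<Rightarrow> real) \<Rightarrow> real) \<Rightarrow> bool" where
  "tame d f \<longleftrightarrow> f \<in> borel_measurable (leb d) \<and> (\<exists>K m. \<forall>x. \<bar>f x\<bar> \<le> K * (1 + l1_norm d x) ^ m)"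

text \<open>Linear growth is the natural demand: a strictly convex \<psi> may itself grow only
  linearly, as sqrt (1 + t^2) does, and V then does no better.\<close>

definition coercive :: "nat \<Rightarrow> ((nat \<Rightarrow> real) \<Rightarrow> real) \<Rightarrow> bool" where
  "coercive d W \<longleftrightarrow> W \<in> borel_measurable (leb d) \<and> (\<exists>\<kappa>>0. \<exists>K. \<forall>x. \<kappa> * l1_norm d x - K \<le> W x)"

named_theorems tame_intros

lemma tame_measurable: "tame d f \<Longrightarrow> f \<in> borel_measurable (leb d)"
  by (simp add: tame_def)

lemma tameI: "f \<in> borel_measurable (leb d) \<Longrightarrow> (\<And>x. \<bar>f x\<bar> \<le> K * (1 + l1_norm d x) ^ m) \<Longrightarrow> tame d f"
  by (auto simp: tame_def)

lemma tameE:
  assumes "tame d f"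
  obtains K m where "K \<ge> 0" "\<And>x. \<bar>f x\<bar> \<le> K * (1 + l1_norm d x) ^ m"
proof -
  from assms obtain K m where *: "\<And>x. \<bar>f x\<bar> \<le> K * (1 + l1_norm d x) ^ m" by (auto simp: tame_def)
  have "\<bar>f x\<bar> \<le> \<bar>K\<bar> * (1 + l1_norm d x) ^ m" for x
    by (rule order_trans[OF *], rule mult_right_mono) auto
  then show thesis by (intro that[of "\<bar>K\<bar>" m]) auto
qed

lemma tame_bound:
  assumes "tame d g" "f \<in> borel_measurable (leb d)" "\<And>x. \<bar>f x\<bar> \<le> \<bar>g x\<bar>"
  shows "tame d f"
  using assms unfolding tame_def by (meson order_trans)

lemma tame_const [tame_intros]: "tame d (\<lambda>_. c)"
  by (rule tameI[where K = "\<bar>c\<bar>" and m = 0]) auto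

lemma tame_coord [tame_intros]: "i < d \<Longrightarrow> tame d (\<lambda>x. x i)"
proof (rule tameI[where K = 1 and m = 1])
  show "\<bar>x i\<bar> \<le> 1 * (1 + l1_norm d x) ^ 1" if "i < d" for x
    using coord_le_l1[OF that, of x] by simp
qed simp

lemma tame_add [tame_intros]:
  assumes "tame d f" "tame d g" shows "tame d (\<lambda>x. f x + g x)"
proof -
  from assms(1) obtain K m where K: "K \<ge> 0" "\<And>x. \<bar>f x\<bar> \<le> K * (1 + l1_norm d x) ^ m" by (rule tameE) blast
  from assms(2) obtain L k where L: "L \<ge> 0" "\<And>x. \<bar>g x\<bar> \<le> L * (1 + l1_norm d x) ^ k" by (rule tameE) blast
  show ?thesis
  proof (rule tameI[where K = "K + L" and m = "max m k"])
    show "(\<lambda>x. f x + g x) \<in> borel_measurable (leb d)"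
      using assms[THEN tame_measurable] by simp
    fix x
    have "\<bar>f x + g x\<bar> \<le> K * (1 + l1_norm d x) ^ m + L * (1 + l1_norm d x) ^ k"
      using K(2)[of x] L(2)[of x] by linarith
    also have "\<dots> \<le> K * (1 + l1_norm d x) ^ max m k + L * (1 + l1_norm d x) ^ max m k"
      using K(1) L(1) by (intro add_mono mult_left_mono power_increasing) auto
    finally show "\<bar>f x + g x\<bar> \<le> (K + L) * (1 + l1_norm d x) ^ max m k" by (simp add: algebra_simps)
  qed
qed

lemma tame_mult [tame_intros]:
  assumes "tame d f" "tame d g" shows "tame d (\<lambda>x. f x * g x)"
proof -
  from assms(1) obtain K m where K: "K \<ge> 0" "\<And>x. \<bar>f x\<bar> \<le> K * (1 + l1_norm d x) ^ m" by (rule tameE) blast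
  from assms(2) obtain L k where L: "L \<ge> 0" "\<And>x. \<bar>g x\<bar> \<le> L * (1 + l1_norm d x) ^ k" by (rule tameE) blast
  show ?thesis
  proof (rule tameI[where K = "K * L" and m = "m + k"])
    show "(\<lambda>x. f x * g x) \<in> borel_measurable (leb d)"
      using assms[THEN tame_measurable] by simp
    fix x
    have "\<bar>f x * g x\<bar> \<le> (K * (1 + l1_norm d x) ^ m) * (L * (1 + l1_norm d x) ^ k)"
      unfolding abs_mult using K L by (intro mult_mono) auto
    then show "\<bar>f x * g x\<bar> \<le> K * L * (1 + l1_norm d x) ^ (m + k)" by (simp add: power_add algebra_simps)
  qed
qed

lemma tame_uminus [tame_intros]: "tame d f \<Longrightarrow> tame d (\<lambda>x. - f x)"
  using tame_mult[OF tame_const[of d "-1"], of f] by simp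

lemma tame_diff [tame_intros]: "tame d f \<Longrightarrow> tame d g \<Longrightarrow> tame d (\<lambda>x. f x - g x)"
  using tame_add[OF _ tame_uminus, of d f g] by simp

lemma tame_divide [tame_intros]: "tame d f \<Longrightarrow> tame d (\<lambda>x. f x / c)"
  using tame_mult[OF _ tame_const[of d "1 / c"], of f] by simp

lemma tame_abs [tame_intros]: "tame d f \<Longrightarrow> tame d (\<lambda>x. \<bar>f x\<bar>)"
  by (rule tame_bound[of d f]) (auto intro: borel_measurable_abs tame_measurable)

lemma tame_power [tame_intros]: "tame d f \<Longrightarrow> tame d (\<lambda>x. f x ^ k)"
  by (induction k) (auto intro: tame_intros)

lemma tame_sum [tame_intros]: "(\<And>i. i \<in> I \<Longrightarrow> tame d (f i)) \<Longrightarrow> tame d (\<lambda>x. \<Sum>i\<in>I. f i x)"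
  by (induction I rule: infinite_finite_induct) (auto intro: tame_intros)

lemma integrable_tame:
  assumes "tame d f" "coercive d W"
  shows "integrable (leb d) (\<lambda>x. f x * exp (- W x))"
proof -
  from assms(1) obtain C m where C: "C \<ge> 0" "\<And>x. \<bar>f x\<bar> \<le> C * (1 + l1_norm d x) ^ m" by (rule tameE) blast
  from assms(2) obtain \<kappa> K where K: "\<kappa> > 0" "\<And>x. \<kappa> * l1_norm d x - K \<le> W x" by (auto simp: coercive_def)
  note [measurable] = tame_measurable[OF assms(1)]
  have [measurable]: "W \<in> borel_measurable (leb d)" using assms(2) by (simp add: coercive_def)
  obtain A where A: "A \<ge> 0" "\<And>u. u \<ge> 0 \<Longrightarrow> (1 + u) ^ m * exp (- \<kappa> * u) \<le> A * exp (- (\<kappa> / 2) * u)"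
    using poly_exp_le_exp[OF K(1)] by blast
  show ?thesis
  proof (rule Bochner_Integration.integrable_bound)
    show "integrable (leb d) (\<lambda>x. (C * exp K * A) * exp (- (\<kappa>/2) * l1_norm d x))"
      using integrable_exp_l1[of "\<kappa>/2" d] K(1) by (intro integrable_mult_right) auto
    show "AE x in leb d. norm (f x * exp (- W x)) \<le> norm ((C * exp K * A) * exp (- (\<kappa>/2) * l1_norm d x))"
    proof (rule AE_I2)
      fix x
      have "\<bar>f x\<bar> * exp (- W x) \<le> (C * (1 + l1_norm d x) ^ m) * exp (- (\<kappa> * l1_norm d x - K))"
        using C K(2)[of x] by (intro mult_mono) auto
      also have "\<dots> = C * exp K * ((1 + l1_norm d x) ^ m * exp (- \<kappa> * l1_norm d x))"
        by (simp add: exp_diff exp_minus field_simps)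
      also have "\<dots> \<le> C * exp K * (A * exp (- (\<kappa>/2) * l1_norm d x))"
        using C(1) by (intro mult_left_mono A) auto
      finally show "norm (f x * exp (- W x)) \<le> norm ((C * exp K * A) * exp (- (\<kappa>/2) * l1_norm d x))"
        using A(1) C(1) by (simp add: abs_mult mult.assoc)
    qed
  qed measurable
qed

section \<open>Calculus along coordinate lines\<close>

text \<open>The functions of this development depend on the first \<open>d\<close> coordinates only and are considered on
  all of \<open>nat \<Rightarrow> real\<close>, so that updating a coordinate never leaves the domain.\<close>

definition pd :: "nat \<Rightarrow> ((nat \<Rightarrow> real) \<Rightarrow> real) \<Rightarrow> ((nat \<Rightarrow> real) \<Rightarrow> real) \<Rightarrow> bool" where
  "pd i f f' \<longleftrightarrow> (\<forall>x t. ((\<lambda>t. f (x(i := t))) has_real_derivative f' (x(i := t))) (at t)) \<and>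
     (\<forall>x. continuous_on UNIV (\<lambda>t. f' (x(i := t))))"

lemma pd_deriv: "pd i f f' \<Longrightarrow> ((\<lambda>t. f (x(i := t))) has_real_derivative f' (x(i := t))) (at t)"
  by (simp add: pd_def)

lemma pd_cont: "pd i f f' \<Longrightarrow> continuous_on UNIV (\<lambda>t. f (x(i := t)))"
  using DERIV_isCont[OF pd_deriv] by (intro continuous_at_imp_continuous_on) auto

lemma pd_cont': "pd i f f' \<Longrightarrow> continuous_on UNIV (\<lambda>t. f' (x(i := t)))"
  by (simp add: pd_def)

lemma pd_partial: "pd i f f' \<Longrightarrow> partial i f x = f' x"
  unfolding partial_def using pd_deriv[of i f f' x "x i"] by (simp add: DERIV_imp_deriv)

lemma pd_eq: "pd i f f' \<Longrightarrow> (\<And>x. f' x = g x) \<Longrightarrow> pd i f g"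
  by (simp add: pd_def)

lemma pd_indep: "(\<And>x t. f (x(i := t)) = f x) \<Longrightarrow> pd i f (\<lambda>_. 0)"
  by (simp add: pd_def)

lemma pd_const: "pd i (\<lambda>_. c) (\<lambda>_. 0)"
  by (simp add: pd_def)

lemma pd_coord: "pd i (\<lambda>x. x j) (\<lambda>x. if j = i then 1 else 0)"
  by (auto simp: pd_def)

lemma pd_add: "pd i f f' \<Longrightarrow> pd i g g' \<Longrightarrow> pd i (\<lambda>x. f x + g x) (\<lambda>x. f' x + g' x)"
  by (auto simp: pd_def intro!: DERIV_add continuous_intros)

lemma pd_diff: "pd i f f' \<Longrightarrow> pd i g g' \<Longrightarrow> pd i (\<lambda>x. f x - g x) (\<lambda>x. f' x - g' x)"
  by (auto simp: pd_def intro!: DERIV_diff continuous_intros)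

lemma pd_mult:
  assumes "pd i f f'" "pd i g g'"
  shows "pd i (\<lambda>x. f x * g x) (\<lambda>x. f' x * g x + g' x * f x)"
  using assms[THEN pd_cont] assms[THEN pd_cont'] assms[THEN pd_deriv]
  unfolding pd_def by (auto intro!: DERIV_mult continuous_intros)

lemma pd_cmult: "pd i f f' \<Longrightarrow> pd i (\<lambda>x. c * f x) (\<lambda>x. c * f' x)"
  by (auto simp: pd_def intro!: DERIV_cmult continuous_intros)

lemma pd_compose:
  assumes "pd i f f'" "\<And>t. (h has_real_derivative h' t) (at t)" "continuous_on UNIV h'"
  shows "pd i (\<lambda>x. h (f x)) (\<lambda>x. h' (f x) * f' x)"
  unfolding pd_def
proof (intro conjI allI)
  show "((\<lambda>t. h (f (x(i := t)))) has_real_derivative h' (f (x(i := t))) * f' (x(i := t))) (at t)" for x t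
    by (rule DERIV_chain2[OF assms(2) pd_deriv[OF assms(1)]])
  show "continuous_on UNIV (\<lambda>t. h' (f (x(i := t))) * f' (x(i := t)))" for x
    using pd_cont[OF assms(1)] pd_cont'[OF assms(1)]
    by (auto intro!: continuous_intros continuous_on_compose2[OF assms(3)])
qed

lemma pd_power: "pd i f f' \<Longrightarrow> pd i (\<lambda>x. f x ^ k) (\<lambda>x. real k * f x ^ (k - 1) * f' x)"
  by (rule pd_compose[where h = "\<lambda>t. t ^ k"]) (auto intro!: derivative_eq_intros continuous_intros)

lemma pd_sum:
  "(\<And>j. j \<in> J \<Longrightarrow> pd i (f j) (f' j)) \<Longrightarrow> pd i (\<lambda>x. \<Sum>j\<in>J. f j x) (\<lambda>x. \<Sum>j\<in>J. f' j x)"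
  by (induction J rule: infinite_finite_induct) (auto intro: pd_const pd_add)

text \<open>By the fundamental theorem and dominated convergence, F T - F (- T) tends to the
  integral L of F'. If L were nonzero, F t - F (- t) would exceed |L|/2 in modulus on a half-line,
  contradicting the integrability of F. Limits of F at infinity thus never have to be
  established.\<close>

lemma integral_deriv_eq_0:
  fixes F F' :: "real \<Rightarrow> real"
  assumes F: "\<And>t. (F has_real_derivative F' t) (at t)" and cont: "continuous_on UNIV F'"
    and int: "integrable lborel F" "integrable lborel F'"
  shows "(LINT t|lborel. F' t) = 0"
proof (rule ccontr)
  let ?L = "LINT t|lborel. F' t"
  assume L: "?L \<noteq> 0"
  have m [measurable]: "F \<in> borel_measurable borel" "F' \<in> borel_measurable borel"
    using int by (auto dest: borel_measurable_integrable)
  have "((\<lambda>T. LINT t|lborel. indicator {-T..T} t *\<^sub>R F' t) \<longlongrightarrow> ?L) at_top"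
  proof (rule integral_dominated_convergence_at_top[where w = "\<lambda>t. norm (F' t)"])
    show "\<forall>\<^sub>F T in at_top. AE t in lborel. norm (indicator {- T..T} t *\<^sub>R F' t) \<le> norm (F' t)"
      by (auto simp: indicator_def)
    show "AE t in lborel. ((\<lambda>T. indicator {- T..T} t *\<^sub>R F' t) \<longlongrightarrow> F' t) at_top"
    proof (rule AE_I2)
      fix t :: real
      show "((\<lambda>T. indicator {- T..T} t *\<^sub>R F' t) \<longlongrightarrow> F' t) at_top"
        by (rule tendsto_eventually, rule eventually_mono[OF eventually_ge_at_top[of "\<bar>t\<bar>"]])
          (auto simp: indicator_def)
    qed
  qed (use int in auto)
  then have "((\<lambda>T. F T - F (- T)) \<longlongrightarrow> ?L) at_top"
  proof (rule Lim_transform_eventually)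
    show "\<forall>\<^sub>F T in at_top. (LINT t|lborel. indicator {-T..T} t *\<^sub>R F' t) = F T - F (- T)"
    proof (rule eventually_mono[OF eventually_ge_at_top[of 0]])
      fix T :: real assume "0 \<le> T"
      then show "(LINT t|lborel. indicator {-T..T} t *\<^sub>R F' t) = F T - F (- T)"
        by (intro integral_FTC_atLeastAtMost)
          (auto intro: has_field_derivative_at_within[OF F] continuous_on_subset[OF cont]
            simp: has_real_derivative_iff_has_vector_derivative[symmetric])
    qed
  qed
  then have "\<forall>\<^sub>F T in at_top. dist (F T - F (- T)) ?L < \<bar>?L\<bar> / 2"
    using L by (intro tendstoD) auto
  then obtain T0 where T0: "\<And>T. T \<ge> T0 \<Longrightarrow> dist (F T - F (- T)) ?L < \<bar>?L\<bar> / 2"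
    by (auto simp: eventually_at_top_linorder)
  have "integrable lborel (\<lambda>t. F t - F (- t))"
    using int(1) lborel_integrable_real_affine_iff[of "-1" F 0] by simp
  then have "integrable lborel (\<lambda>t. indicator {T0..} t * (\<bar>?L\<bar> / 2))"
  proof (rule Bochner_Integration.integrable_bound)
    show "AE t in lborel. norm (indicator {T0..} t * (\<bar>?L\<bar> / 2)) \<le> norm (F t - F (- t))"
    proof (rule AE_I2)
      fix t
      show "norm (indicator {T0..} t * (\<bar>?L\<bar> / 2)) \<le> norm (F t - F (- t))"
        using T0[of t] abs_triangle_ineq2_sym[of ?L "?L - (F t - F (- t))"]
          abs_minus_commute[of "F t - F (- t)" ?L] abs_minus_commute[of "F (- t)" "F t"]
        by (auto simp: indicator_def dist_real_def)
    qed
  qed measurable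
  then have "integrable lborel (\<lambda>t. indicator {T0..} t * (\<bar>?L\<bar> / 2) * (2 / \<bar>?L\<bar>))"
    by (rule integrable_mult_left)
  then have "integrable lborel (indicator {T0..} :: real \<Rightarrow> real)"
    using L by (simp add: mult.assoc)
  then have "emeasure lborel {T0..} < \<top>"
    by (simp add: integrable_indicator_iff top.not_eq_extremum)
  then obtain r where r: "r \<ge> 0" "emeasure lborel {T0..} = ennreal r"
    by (auto simp: less_top_ennreal)
  have "ennreal (r + 1) = emeasure lborel {T0..T0 + (r + 1)}"
    using r(1) by (subst emeasure_lborel_Icc) auto
  also have "\<dots> \<le> emeasure lborel {T0..}" by (intro emeasure_mono) auto
  finally show False
    using r by (simp add: ennreal_le_iff)
qed

text \<open>A quotient of Lebesgue integrals, in which the normalisation of \<open>gibbs d W\<close>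
  and additive constants in W cancel; \<open>integral_gibbs\<close> links it to the measure.\<close>

definition expect :: "nat \<Rightarrow> ((nat \<Rightarrow> real) \<Rightarrow> real) \<Rightarrow> ((nat \<Rightarrow> real) \<Rightarrow> real) \<Rightarrow> real" where
  "expect d W f = (\<integral>x. f x * exp (- W x) \<partial>leb d) / (\<integral>x. exp (- W x) \<partial>leb d)"

locale coercive_potential =
  fixes d :: nat and W :: "(nat \<Rightarrow> real) \<Rightarrow> real"
  assumes W: "coercive d W"
begin

lemma W_meas [measurable]: "W \<in> borel_measurable (leb d)"
  using W by (simp add: coercive_def)

lemma int_tame: "tame d f \<Longrightarrow> integrable (leb d) (\<lambda>x. f x * exp (- W x))"
  by (rule integrable_tame[OF _ W])

lemma int_exp: "integrable (leb d) (\<lambda>x. exp (- W x))"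
  using int_tame[OF tame_const[of d 1]] by simp

lemma Z_pos: "(\<integral>x. exp (- W x) \<partial>leb d) > 0"
proof -
  have "(\<integral>x. exp (- W x) \<partial>leb d) \<noteq> 0"
  proof
    assume "(\<integral>x. exp (- W x) \<partial>leb d) = 0"
    then have "AE x in leb d. False"
      using int_exp by (subst (asm) integral_nonneg_eq_0_iff_AE) auto
    then have "emeasure (leb d) (space (leb d)) = 0"
      by (simp add: AE_iff_measurable[OF _ refl])
    moreover have "emeasure (leb d) (space (leb d)) = (\<Prod>i<d. emeasure lborel (UNIV::real set))"
      unfolding leb_def space_PiM using lebP.emeasure_PiM[of "{..<d}" "\<lambda>_. UNIV"] by simp
    ultimately show False by simp
  qed
  moreover have "(\<integral>x. exp (- W x) \<partial>leb d) \<ge> 0" by simp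
  ultimately show ?thesis by linarith
qed

lemma E_const [simp]: "expect d W (\<lambda>_. c) = c"
  using Z_pos by (simp add: expect_def)

lemma E_add: "tame d f \<Longrightarrow> tame d g \<Longrightarrow> expect d W (\<lambda>x. f x + g x) = expect d W f + expect d W g"
  by (simp add: expect_def distrib_right add_divide_distrib int_tame)

lemma E_cmult: "expect d W (\<lambda>x. c * f x) = c * expect d W f"
  by (simp add: expect_def mult.assoc)

lemma E_uminus: "expect d W (\<lambda>x. - f x) = - expect d W f"
  using E_cmult[of "-1" f] by simp

lemma E_diff: "tame d f \<Longrightarrow> tame d g \<Longrightarrow> expect d W (\<lambda>x. f x - g x) = expect d W f - expect d W g"
  using E_add[OF _ tame_uminus, of f g] by (simp add: E_uminus)

lemma E_divide: "expect d W (\<lambda>x. f x / c) = expect d W f / c"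
  using E_cmult[of "1/c" f] by simp

lemma E_sum: "(\<And>i. i \<in> I \<Longrightarrow> tame d (f i)) \<Longrightarrow> expect d W (\<lambda>x. \<Sum>i\<in>I. f i x) = (\<Sum>i\<in>I. expect d W (f i))"
  by (induction I rule: infinite_finite_induct) (auto simp: E_add tame_sum)

lemma E_mono: "tame d f \<Longrightarrow> tame d g \<Longrightarrow> (\<And>x. f x \<le> g x) \<Longrightarrow> expect d W f \<le> expect d W g"
  unfolding expect_def using Z_pos by (intro divide_right_mono integral_mono int_tame mult_right_mono) auto

lemma E_nonneg: "(\<And>x. 0 \<le> f x) \<Longrightarrow> 0 \<le> expect d W f"
  unfolding expect_def using Z_pos by (intro divide_nonneg_nonneg) (auto simp: less_imp_le)

lemma E_abs: "tame d f \<Longrightarrow> \<bar>expect d W f\<bar> \<le> expect d W (\<lambda>x. \<bar>f x\<bar>)"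
  using E_mono[of f "\<lambda>x. \<bar>f x\<bar>"] E_mono[of "\<lambda>x. - f x" "\<lambda>x. \<bar>f x\<bar>"]
  by (auto simp: E_uminus tame_intros abs_le_iff)

lemma E_abs_le: "tame d f \<Longrightarrow> tame d g \<Longrightarrow> (\<And>x. \<bar>f x\<bar> \<le> g x) \<Longrightarrow> \<bar>expect d W f\<bar> \<le> expect d W g"
  using E_abs[of f] E_mono[of "\<lambda>x. \<bar>f x\<bar>" g] tame_abs by fastforce

text \<open>The derivative of f e^(-W) in direction i is (f' - f D) e^(-W), whose integral over
  every line parallel to that axis vanishes by \<open>integral_deriv_eq_0\<close>; Fubini then gives
  the identity. All moment bounds below start from it.\<close>

lemma IBP:
  assumes i: "i < d" and tame: "tame d f" "tame d f'" "tame d D" and pd: "pd i f f'" "pd i W D"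
  shows "expect d W f' = expect d W (\<lambda>x. f x * D x)"
proof -
  let ?F = "\<lambda>x. f x * exp (- W x)" and ?F' = "\<lambda>x. (f' x - f x * D x) * exp (- W x)"
  obtain \<kappa> K where K: "\<kappa> > 0" "\<And>x. \<kappa> * l1_norm d x - K \<le> W x" using W by (auto simp: coercive_def)
  have t: "tame d (\<lambda>x. f' x - f x * D x)" by (intro tame_intros tame)
  have ins: "insert i ({..<d} - {i}) = {..<d}" using i by auto
  \<comment> \<open>On the line through x the l1 norm is s + |t|, so tameness and coercivity reduce
    to a polynomial times an exponential in t, with constants depending on s.\<close>
  have slice: "integrable lborel (\<lambda>t. g (x(i := t)) * exp (- W (x(i := t))))"
    if g: "tame d g" and c: "\<And>x. continuous_on UNIV (\<lambda>t. g (x(i := t)))" for g x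
  proof -
    obtain C m where C: "C \<ge> 0" "\<And>x. \<bar>g x\<bar> \<le> C * (1 + l1_norm d x) ^ m" using g by (rule tameE) blast
    define s where "s = (\<Sum>j\<in>{..<d}-{i}. \<bar>x j\<bar>)"
    have s: "s \<ge> 0" by (simp add: s_def sum_nonneg)
    show ?thesis
    proof (rule integrable_poly_exp[OF _ K(1)])
      show "(\<lambda>t. g (x(i := t)) * exp (- W (x(i := t)))) \<in> borel_measurable borel"
        by (intro borel_measurable_continuous_onI continuous_intros c pd_cont[OF pd(2)])
      fix t
      have l: "l1_norm d (x(i := t)) = s + \<bar>t\<bar>" using i by (simp add: l1_fun_upd s_def)
      have "\<bar>g (x(i := t)) * exp (- W (x(i := t)))\<bar>
          \<le> (C * (1 + (s + \<bar>t\<bar>)) ^ m) * exp (K - \<kappa> * (s + \<bar>t\<bar>))"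
        unfolding abs_mult using C K(2)[of "x(i := t)"] l s C(2)[of "x(i := t)", unfolded l] by (intro mult_mono) auto
      also have "\<dots> \<le> (C * ((1 + s) * (1 + \<bar>t\<bar>)) ^ m) * exp (K - \<kappa> * (s + \<bar>t\<bar>))"
        using C(1) s by (intro mult_right_mono mult_left_mono power_mono) (auto simp: algebra_simps)
      also have "\<dots> = (C * (1 + s) ^ m * exp (K - \<kappa> * s)) * ((1 + \<bar>t\<bar>) ^ m * exp (- \<kappa> * \<bar>t\<bar>))"
        unfolding power_mult_distrib by (simp add: distrib_left exp_diff exp_add exp_minus divide_inverse mult_ac)
      finally show "\<bar>g (x(i := t)) * exp (- W (x(i := t)))\<bar>
          \<le> (C * (1 + s) ^ m * exp (K - \<kappa> * s)) * ((1 + \<bar>t\<bar>) ^ m * exp (- \<kappa> * \<bar>t\<bar>))" .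
    qed
  qed
  have zero: "(LINT t|lborel. ?F' (x(i := t))) = 0" for x
  proof (rule integral_deriv_eq_0[where F = "\<lambda>t. ?F (x(i := t))"])
    show "((\<lambda>t. ?F (x(i := t))) has_real_derivative ?F' (x(i := t))) (at t)" for t
      by (rule derivative_eq_intros pd_deriv[OF pd(1)] pd_deriv[OF pd(2)] refl)+ (simp add: algebra_simps)
    show "continuous_on UNIV (\<lambda>t. ?F' (x(i := t)))"
      by (intro continuous_intros pd_cont[OF pd(1)] pd_cont[OF pd(2)] pd_cont'[OF pd(1)] pd_cont'[OF pd(2)])
    show "integrable lborel (\<lambda>t. ?F (x(i := t)))"
      by (intro slice tame pd_cont[OF pd(1)])
    show "integrable lborel (\<lambda>t. ?F' (x(i := t)))"
      by (intro slice t continuous_intros pd_cont[OF pd(1)] pd_cont'[OF pd(1)] pd_cont'[OF pd(2)])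
  qed
  have "(\<integral>x. ?F' x \<partial>leb d) = (\<integral>x. (\<integral>t. ?F' (x(i := t)) \<partial>lborel) \<partial>PiM ({..<d}-{i}) (\<lambda>_. lborel))"
    using lebP.product_integral_insert[of "{..<d}-{i}" i ?F'] int_tame[OF t]
    unfolding ins leb_def by simp
  also have "\<dots> = 0" by (simp only: zero) simp
  finally have "expect d W (\<lambda>x. f' x - f x * D x) = 0" by (simp add: expect_def)
  then show ?thesis by (subst (asm) E_diff) (auto intro: tame_intros tame)
qed

end

text \<open>A product measure is determined by its values on boxes, and the preimage of a box under
  a coordinatewise affine map is again a box. Used for the substitution by H^(-1/2) and, with one
  negative factor, for reflections.\<close>

lemma leb_affine:
  fixes \<sigma> m :: "nat \<Rightarrow> real"
  assumes "\<And>i. i < d \<Longrightarrow> \<sigma> i \<noteq> 0"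
  shows "leb d = density (distr (leb d) (leb d) (\<lambda>x. \<lambda>i\<in>{..<d}. m i + \<sigma> i * x i)) (\<lambda>_. ennreal (\<Prod>i<d. \<bar>\<sigma> i\<bar>))"
proof -
  let ?T = "\<lambda>x::nat \<Rightarrow> real. \<lambda>i\<in>{..<d}. m i + \<sigma> i * x i"
  have T [measurable]: "?T \<in> measurable (leb d) (leb d)"
    unfolding measurable_cong_sets[OF refl sets_leb]
    by (rule measurable_restrict) (auto simp: measurable_coord)
  have "density (distr (leb d) (leb d) ?T) (\<lambda>_. ennreal (\<Prod>i<d. \<bar>\<sigma> i\<bar>)) = PiM {..<d} (\<lambda>_. lborel)"
  proof (rule lebP.PiM_eqI)
    fix A :: "nat \<Rightarrow> real set" assume "\<And>i. i \<in> {..<d} \<Longrightarrow> A i \<in> sets lborel"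
    then have A: "A i \<in> sets borel" if "i < d" for i using that by simp
    have PA: "Pi\<^sub>E {..<d} A \<in> sets (leb d)"
      unfolding leb_def using A by (intro sets_PiM_I_finite) auto
    have vim: "?T -` Pi\<^sub>E {..<d} A \<inter> space (leb d) = Pi\<^sub>E {..<d} (\<lambda>i. (\<lambda>t. m i + \<sigma> i * t) -` A i)"
      unfolding space_leb Rd_def by (auto simp: PiE_iff extensional_def)
    have one: "ennreal \<bar>\<sigma> i\<bar> * emeasure lborel ((\<lambda>t. m i + \<sigma> i * t) -` A i) = emeasure lborel (A i)"
      if "i < d" for i
    proof -
      have "emeasure lborel (A i) = emeasure (density (distr lborel borel (\<lambda>t. m i + \<sigma> i * t)) (\<lambda>_. ennreal \<bar>\<sigma> i\<bar>)) (A i)"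
        by (subst lborel_real_affine[OF assms[OF that], of "m i"]) (rule refl)
      also have "\<dots> = ennreal \<bar>\<sigma> i\<bar> * emeasure lborel ((\<lambda>t. m i + \<sigma> i * t) -` A i)"
        using A[OF that] by (subst emeasure_density_const) (auto simp: emeasure_distr)
      finally show ?thesis by simp
    qed
    have "emeasure (density (distr (leb d) (leb d) ?T) (\<lambda>_. ennreal (\<Prod>i<d. \<bar>\<sigma> i\<bar>))) (Pi\<^sub>E {..<d} A)
        = ennreal (\<Prod>i<d. \<bar>\<sigma> i\<bar>) * emeasure (leb d) (Pi\<^sub>E {..<d} (\<lambda>i. (\<lambda>t. m i + \<sigma> i * t) -` A i))"
      using PA by (subst emeasure_density_const) (auto simp: emeasure_distr vim)
    also have "emeasure (leb d) (Pi\<^sub>E {..<d} (\<lambda>i. (\<lambda>t. m i + \<sigma> i * t) -` A i))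
        = (\<Prod>i<d. emeasure lborel ((\<lambda>t. m i + \<sigma> i * t) -` A i))"
      unfolding leb_def
    proof (rule lebP.emeasure_PiM)
      fix i assume "i \<in> {..<d}"
      then have "A i \<in> sets borel" using A by simp
      then have "(\<lambda>t. m i + \<sigma> i * t) -` A i \<inter> space borel \<in> sets borel"
        by (intro measurable_sets[of _ borel borel]) auto
      then show "(\<lambda>t. m i + \<sigma> i * t) -` A i \<in> sets lborel" by simp
    qed simp
    also have "ennreal (\<Prod>i<d. \<bar>\<sigma> i\<bar>) * (\<Prod>i<d. emeasure lborel ((\<lambda>t. m i + \<sigma> i * t) -` A i))
      = (\<Prod>i<d. ennreal \<bar>\<sigma> i\<bar>) * (\<Prod>i<d. emeasure lborel ((\<lambda>t. m i + \<sigma> i * t) -` A i))"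
      by (simp add: prod_ennreal)
    also have "(\<Prod>i<d. ennreal \<bar>\<sigma> i\<bar>) * (\<Prod>i<d. emeasure lborel ((\<lambda>t. m i + \<sigma> i * t) -` A i))
        = (\<Prod>i<d. emeasure lborel (A i))"
      unfolding prod.distrib[symmetric] by (rule prod.cong) (auto simp: one)
    finally show "emeasure (density (distr (leb d) (leb d) ?T) (\<lambda>_. ennreal (\<Prod>i<d. \<bar>\<sigma> i\<bar>))) (Pi\<^sub>E {..<d} A)
      = (\<Prod>i\<in>{..<d}. emeasure lborel (A i))" .
  qed (simp_all add: leb_def)
  then show ?thesis by (simp add: leb_def)
qed

lemma integral_leb_affine:
  fixes \<sigma> m :: "nat \<Rightarrow> real"
  assumes "\<And>i. i < d \<Longrightarrow> \<sigma> i \<noteq> 0" and [measurable]: "f \<in> borel_measurable (leb d)"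
  shows "(\<integral>x. f x \<partial>leb d) = (\<Prod>i<d. \<bar>\<sigma> i\<bar>) * (\<integral>x. f (\<lambda>i\<in>{..<d}. m i + \<sigma> i * x i) \<partial>leb d)"
proof -
  let ?T = "\<lambda>x::nat \<Rightarrow> real. \<lambda>i\<in>{..<d}. m i + \<sigma> i * x i"
  have T [measurable]: "?T \<in> measurable (leb d) (leb d)"
    unfolding measurable_cong_sets[OF refl sets_leb]
    by (rule measurable_restrict) (auto simp: measurable_coord)
  have "(\<integral>x. f x \<partial>leb d) = (\<integral>x. f x \<partial>density (distr (leb d) (leb d) ?T) (\<lambda>_. ennreal (\<Prod>i<d. \<bar>\<sigma> i\<bar>)))"
    using leb_affine[OF assms(1), where m = m] by simp
  also have "\<dots> = (\<integral>x. (\<Prod>i<d. \<bar>\<sigma> i\<bar>) * f x \<partial>distr (leb d) (leb d) ?T)"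
    by (subst integral_density) (auto simp: prod_nonneg)
  also have "\<dots> = (\<Prod>i<d. \<bar>\<sigma> i\<bar>) * (\<integral>x. f (?T x) \<partial>leb d)"
    by (subst integral_distr) auto
  finally show ?thesis .
qed

text \<open>The Jacobian appears in numerator and denominator of \<open>expect\<close> and
  cancels.\<close>

lemma expect_affine:
  fixes \<sigma> m :: "nat \<Rightarrow> real"
  assumes \<sigma>: "\<And>i. i < d \<Longrightarrow> \<sigma> i \<noteq> 0"
    and [measurable]: "f \<in> borel_measurable (leb d)" "W \<in> borel_measurable (leb d)"
  shows "expect d W f = expect d (\<lambda>x. W (\<lambda>i\<in>{..<d}. m i + \<sigma> i * x i)) (\<lambda>x. f (\<lambda>i\<in>{..<d}. m i + \<sigma> i * x i))"
proof -
  have "(\<Prod>i<d. \<bar>\<sigma> i\<bar>) \<noteq> 0" using \<sigma> by auto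
  then show ?thesis
    unfolding expect_def
    by (subst (1 2) integral_leb_affine[OF \<sigma>, where m = m]) auto
qed

section \<open>Gaussian expectations\<close>

definition tame1 :: "(real \<Rightarrow> real) \<Rightarrow> bool" where
  "tame1 f \<longleftrightarrow> f \<in> borel_measurable borel \<and> (\<exists>K m. \<forall>t. \<bar>f t\<bar> \<le> K * (1 + \<bar>t\<bar>) ^ m)"

lemma tame1I: "f \<in> borel_measurable borel \<Longrightarrow> (\<And>t. \<bar>f t\<bar> \<le> K * (1 + \<bar>t\<bar>) ^ m) \<Longrightarrow> tame1 f"
  by (auto simp: tame1_def)

lemma tame1E:
  assumes "tame1 f"
  obtains K m where "K \<ge> 0" "\<And>t. \<bar>f t\<bar> \<le> K * (1 + \<bar>t\<bar>) ^ m"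
proof -
  from assms obtain K m where *: "\<And>t. \<bar>f t\<bar> \<le> K * (1 + \<bar>t\<bar>) ^ m" by (auto simp: tame1_def)
  have "\<bar>f t\<bar> \<le> \<bar>K\<bar> * (1 + \<bar>t\<bar>) ^ m" for t
    by (rule order_trans[OF *], rule mult_right_mono) auto
  then show thesis by (intro that[of "\<bar>K\<bar>" m]) auto
qed

lemma tame1_measurable: "tame1 f \<Longrightarrow> f \<in> borel_measurable borel"
  by (simp add: tame1_def)

lemma tame1_mult_power:
  assumes "tame1 f" shows "tame1 (\<lambda>t. f t * t ^ k)"
proof -
  from assms obtain K m where K: "K \<ge> 0" "\<And>t. \<bar>f t\<bar> \<le> K * (1 + \<bar>t\<bar>) ^ m" by (rule tame1E) blast
  show ?thesis
  proof (rule tame1I[where K = K and m = "m + k"])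
    show "(\<lambda>t. f t * t ^ k) \<in> borel_measurable borel" using tame1_measurable[OF assms] by simp
    fix t
    have "\<bar>f t * t ^ k\<bar> \<le> (K * (1 + \<bar>t\<bar>) ^ m) * (1 + \<bar>t\<bar>) ^ k"
      unfolding abs_mult power_abs using K by (intro mult_mono power_mono) auto
    then show "\<bar>f t * t ^ k\<bar> \<le> K * (1 + \<bar>t\<bar>) ^ (m + k)" by (simp add: power_add mult.assoc)
  qed
qed

lemma abs_dot_le: "\<bar>dot d z x\<bar> \<le> l1_norm d z * l1_norm d x"
proof -
  have "\<bar>dot d z x\<bar> \<le> (\<Sum>i<d. \<bar>z i\<bar> * \<bar>x i\<bar>)"
    unfolding dot_def abs_mult[symmetric] by (rule sum_abs)
  also have "\<dots> \<le> (\<Sum>i<d. \<bar>z i\<bar> * l1_norm d x)"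
    by (intro sum_mono mult_left_mono coord_le_l1) auto
  also have "\<dots> = l1_norm d z * l1_norm d x" by (simp add: l1_norm_def sum_distrib_right)
  finally show ?thesis .
qed

lemma one_plus_dot_le: "1 + \<bar>dot d z x\<bar> \<le> (1 + l1_norm d z) * (1 + l1_norm d x)"
proof -
  have "(1 + l1_norm d z) * (1 + l1_norm d x) = 1 + l1_norm d z + l1_norm d x + l1_norm d z * l1_norm d x" by (simp add: algebra_simps)
  then show ?thesis using abs_dot_le[of d z x] l1_nonneg[of d z] l1_nonneg[of d x] by linarith
qed

lemma dot_commute: "dot d x y = dot d y x"
  by (simp add: dot_def mult.commute)

lemma tame_compose:
  assumes f: "tame1 f" and g: "tame d g"
  shows "tame d (\<lambda>z. f (g z))"
proof -
  from f obtain K m where K: "K \<ge> 0" "\<And>t. \<bar>f t\<bar> \<le> K * (1 + \<bar>t\<bar>) ^ m" by (rule tame1E) blast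
  have "tame d (\<lambda>z. K * (1 + \<bar>g z\<bar>) ^ m)" by (intro tame_intros g)
  then show ?thesis
  proof (rule tame_bound)
    show "(\<lambda>z. f (g z)) \<in> borel_measurable (leb d)"
      using measurable_compose[OF tame_measurable[OF g] tame1_measurable[OF f]] .
    show "\<bar>f (g z)\<bar> \<le> \<bar>K * (1 + \<bar>g z\<bar>) ^ m\<bar>" for z
      using order_trans[OF K(2)[of "g z"] abs_ge_self] .
  qed
qed

lemma tame_dot [tame_intros]: "tame d (\<lambda>z. dot d z x)"
  unfolding dot_def by (intro tame_intros) auto

text \<open>The standard Gaussian is treated as one more potential, so everything in
  \<open>coercive_potential\<close> applies to it and integration by parts becomes Stein's
  identity.\<close>

definition gauss_potential :: "nat \<Rightarrow> (nat \<Rightarrow> real) \<Rightarrow> real" where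
  "gauss_potential d x = (\<Sum>i<d. (x i)\<^sup>2) / 2"

abbreviation "EG d \<equiv> expect d (gauss_potential d)"

lemma tame_gw: "tame d (gauss_potential d)"
  unfolding gauss_potential_def by (intro tame_intros) auto

lemma coercive_gw: "coercive d (gauss_potential d)"
  unfolding coercive_def
proof
  show "gauss_potential d \<in> borel_measurable (leb d)" by (rule tame_measurable[OF tame_gw])
  have "1 * l1_norm d x - real d / 2 \<le> gauss_potential d x" for x :: "nat \<Rightarrow> real"
  proof -
    have "(\<Sum>i<d. \<bar>x i\<bar> - 1/2) \<le> (\<Sum>i<d. (x i)\<^sup>2 / 2)"
  proof (rule sum_mono)
    fix i
    have "0 \<le> (\<bar>x i\<bar> - 1)\<^sup>2" by simp
    then show "\<bar>x i\<bar> - 1/2 \<le> (x i)\<^sup>2 / 2" by (simp add: power2_diff)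
  qed
    then show ?thesis
      by (simp add: l1_norm_def gauss_potential_def sum_subtractf sum_divide_distrib)
  qed
  then show "\<exists>\<kappa>>0. \<exists>K. \<forall>x. \<kappa> * l1_norm d x - K \<le> gauss_potential d x"
    by (intro exI[of _ "1::real"] conjI exI[of _ "real d / 2"]) auto
qed

interpretation G: coercive_potential d "gauss_potential d" for d
  by (rule coercive_potential.intro) (rule coercive_gw)

lemma pd_gw: "i < d \<Longrightarrow> pd i (gauss_potential d) (\<lambda>x. x i)"
proof -
  assume "i < d"
  moreover have "pd i (\<lambda>x. (1/2) * (\<Sum>j<d. (x j)\<^sup>2)) (\<lambda>x. (1/2) * (\<Sum>j<d. real 2 * x j ^ (2 - 1) * (if j = i then 1 else 0)))"
    by (intro pd_cmult pd_sum pd_power pd_coord)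
  ultimately show ?thesis by (simp add: gauss_potential_def[abs_def] mult_delta_right sum.delta)
qed

lemma EG_stein:
  assumes "i < d" "tame d f" "tame d f'" "pd i f f'"
  shows "EG d (\<lambda>z. f z * z i) = EG d f'"
  by (rule G.IBP[OF assms(1-3) tame_coord[OF assms(1)] assms(4) pd_gw[OF assms(1)], symmetric])

text \<open>One factor of L^(k+1) is expanded as the sum of y_j z_j and Stein's identity is applied
  to each z_j; as g is constant in these coordinates, only L^k gets differentiated. The recursion
  yields all Gaussian moments used later. For k = 0 the truncated exponent is masked by the factor
  k.\<close>

lemma EG_linear_moment:
  fixes y :: "nat \<Rightarrow> real"
  assumes J: "J \<subseteq> {..<d}" and g: "tame d g" and ind: "\<And>x t i. i \<in> J \<Longrightarrow> g (x(i := t)) = g x"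
  defines "L \<equiv> \<lambda>z. \<Sum>j\<in>J. y j * z j"
  shows "EG d (\<lambda>z. g z * L z ^ Suc k) = real k * (\<Sum>j\<in>J. (y j)\<^sup>2) * EG d (\<lambda>z. g z * L z ^ (k - 1))"
proof -
  have fin: "finite J" using J by (rule finite_subset) simp
  have tL: "tame d L" unfolding L_def using J by (intro tame_intros) auto
  have pL: "pd j L (\<lambda>_. y j)" if "j \<in> J" for j
  proof -
    have "pd j L (\<lambda>x. \<Sum>i\<in>J. y i * (if i = j then 1 else 0))"
      unfolding L_def by (intro pd_sum pd_cmult pd_coord)
    then show ?thesis using fin that by (simp add: mult_delta_right sum.delta)
  qed
  have step: "EG d (\<lambda>z. g z * L z ^ k * z j) = real k * y j * EG d (\<lambda>z. g z * L z ^ (k - 1))" if j: "j \<in> J" for j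
  proof -
    have "EG d (\<lambda>z. g z * L z ^ k * z j) = EG d (\<lambda>z. (real k * y j) * (g z * L z ^ (k - 1)))"
    proof (rule EG_stein)
      show "j < d" using j J by auto
      show "pd j (\<lambda>z. g z * L z ^ k) (\<lambda>z. (real k * y j) * (g z * L z ^ (k - 1)))"
        by (rule pd_eq, rule pd_mult[OF pd_indep[OF ind[OF j]] pd_power[OF pL[OF j]]]) (simp add: algebra_simps)
    qed (intro tame_intros g tL)+
    then show ?thesis by (simp add: G.E_cmult)
  qed
  have "EG d (\<lambda>z. g z * L z ^ Suc k) = EG d (\<lambda>z. \<Sum>j\<in>J. y j * (g z * L z ^ k * z j))"
  proof -
    have "g z * L z ^ Suc k = (\<Sum>j\<in>J. y j * (g z * L z ^ k * z j))" for z
    proof -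
      have "g z * L z ^ Suc k = (g z * L z ^ k) * (\<Sum>j\<in>J. y j * z j)"
        by (simp add: L_def)
      then show ?thesis by (simp add: sum_distrib_left mult_ac)
    qed
    then show ?thesis by simp
  qed
  also have "\<dots> = (\<Sum>j\<in>J. y j * EG d (\<lambda>z. g z * L z ^ k * z j))"
    using J by (subst G.E_sum) (auto intro!: tame_intros g tL simp: G.E_cmult)
  also have "\<dots> = (\<Sum>j\<in>J. y j * (real k * y j * EG d (\<lambda>z. g z * L z ^ (k - 1))))"
    by (simp add: step)
  also have "\<dots> = (\<Sum>j\<in>J. (y j)\<^sup>2 * (real k * EG d (\<lambda>z. g z * L z ^ (k - 1))))"
    by (intro sum.cong refl) (simp add: power2_eq_square mult_ac)
  also have "\<dots> = real k * (\<Sum>j\<in>J. (y j)\<^sup>2) * EG d (\<lambda>z. g z * L z ^ (k - 1))"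
    by (subst sum_distrib_right[symmetric]) simp
  finally show ?thesis .
qed

text \<open>The constants \<open>a\<close>, \<open>b\<close>, \<open>al\<close>, \<open>be\<close>
  below are built from this one-dimensional average, so that they visibly do not depend on d;
  \<open>EG_marginal\<close> relates it to \<open>EG\<close>.\<close>

definition E1 :: "(real \<Rightarrow> real) \<Rightarrow> real" where
  "E1 h = (\<integral>t. h t * exp (- t\<^sup>2 / 2) \<partial>lborel) / (\<integral>t. exp (- t\<^sup>2 / 2) \<partial>lborel)"

lemma integrable_tame1:
  assumes "tame1 h" shows "integrable lborel (\<lambda>t. h t * exp (- t\<^sup>2 / 2))"
proof -
  from assms obtain K m where K: "K \<ge> 0" "\<And>t. \<bar>h t\<bar> \<le> K * (1 + \<bar>t\<bar>) ^ m" by (rule tame1E) blast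
  note [measurable] = tame1_measurable[OF assms]
  have *: "\<bar>h t * exp (- t\<^sup>2 / 2)\<bar> \<le> K * exp (1/2) * ((1 + \<bar>t\<bar>) ^ m * exp (- 1 * \<bar>t\<bar>))" for t
  proof -
    have "0 \<le> (\<bar>t\<bar> - 1)\<^sup>2" by simp
    then have "- t\<^sup>2 / 2 \<le> 1/2 - \<bar>t\<bar>" by (simp add: power2_diff)
    then have "exp (- t\<^sup>2 / 2) \<le> exp (1/2 - \<bar>t\<bar>)" by (simp only: exp_le_cancel_iff)
    also have "1/2 - \<bar>t\<bar> = 1/2 + - 1 * \<bar>t\<bar>" by simp
    finally have e: "exp (- t\<^sup>2 / 2) \<le> exp (1/2) * exp (- 1 * \<bar>t\<bar>)" by (simp only: exp_add)
    have "\<bar>h t * exp (- t\<^sup>2 / 2)\<bar> = \<bar>h t\<bar> * exp (- t\<^sup>2 / 2)" by (simp add: abs_mult)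
    also have "\<dots> \<le> (K * (1 + \<bar>t\<bar>) ^ m) * (exp (1/2) * exp (- 1 * \<bar>t\<bar>))"
      by (rule mult_mono[OF K(2) e]) (simp_all add: K(1))
    finally show ?thesis by (simp only: mult_ac)
  qed
  show ?thesis
    by (rule integrable_poly_exp[where \<kappa> = 1, OF _ _ *]) simp_all
qed

lemma tame1_const: "tame1 (\<lambda>_. c)"
  by (rule tame1I[where K = "\<bar>c\<bar>" and m = 0]) auto

lemma gauss1_pos: "(\<integral>t. exp (- t\<^sup>2 / 2) \<partial>(lborel::real measure)) > 0"
proof -
  have int: "integrable lborel (\<lambda>t::real. exp (- t\<^sup>2 / 2))"
    using integrable_tame1[OF tame1_const[of 1]] by simp
  have "(\<integral>t. exp (- t\<^sup>2 / 2) \<partial>(lborel::real measure)) \<noteq> 0"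
    using int by (subst integral_nonneg_eq_0_iff_AE) (auto simp: AE_iff_measurable[OF _ refl])
  moreover have "(\<integral>t. exp (- t\<^sup>2 / 2) \<partial>(lborel::real measure)) \<ge> 0" by simp
  ultimately show ?thesis by linarith
qed

text \<open>If the integral vanished, h would vanish almost everywhere; the zero set of a continuous
  function is closed, and a closed set of full measure is the whole line.\<close>

lemma E1_pos:
  assumes h: "tame1 h" and cont: "continuous_on UNIV h" and nn: "\<And>t. 0 \<le> h t" and ne: "h t0 \<noteq> 0"
  shows "0 < E1 h"
proof -
  have "(\<integral>t. h t * exp (- t\<^sup>2 / 2) \<partial>lborel) \<noteq> 0"
  proof
    assume "(\<integral>t. h t * exp (- t\<^sup>2 / 2) \<partial>lborel) = 0"
    then have "AE t in lborel. h t = 0"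
      using integrable_tame1[OF h] nn by (subst (asm) integral_nonneg_eq_0_iff_AE) auto
    then have "AE t in lebesgue. t \<in> {t. h t = 0}"
      by (auto intro: AE_completion)
    moreover have "closed {t. h t = 0}"
      using cont by (intro closed_Collect_eq) auto
    ultimately have "t0 \<in> {t. h t = 0}" by (rule mem_closed_if_AE_lebesgue[rotated])
    with ne show False by simp
  qed
  moreover have "(\<integral>t. h t * exp (- t\<^sup>2 / 2) \<partial>lborel) \<ge> 0" using nn by simp
  ultimately show ?thesis using gauss1_pos by (simp add: E1_def)
qed

text \<open>The other d - 1 coordinates contribute the same factor to numerator and
  denominator.\<close>

lemma EG_marginal:
  assumes "i < d" "tame1 h"
  shows "EG d (\<lambda>z. h (z i)) = E1 h"
proof -
  define f where "f = (\<lambda>j t. (if j = i then h t else 1) * exp (- t\<^sup>2 / 2))"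
  define s where "s = (\<integral>t. exp (- t\<^sup>2 / 2) \<partial>(lborel::real measure))"
  have int: "integrable lborel (f j)" for j
    using integrable_tame1[OF assms(2)] integrable_tame1[OF tame1_const[of 1]]
    by (cases "j = i") (simp_all add: f_def)
  have int1: "integrable lborel (\<lambda>t::real. exp (- t\<^sup>2 / 2))"
    using integrable_tame1[OF tame1_const[of 1]] by simp
  have e: "exp (- gauss_potential d z) = (\<Prod>j<d. exp (- (z j)\<^sup>2 / 2))" for z
    by (simp add: gauss_potential_def exp_sum[symmetric] sum_negf sum_divide_distrib)
  have "h (z i) * exp (- gauss_potential d z) = (\<Prod>j<d. f j (z j))" for z
  proof -
    have "(\<Prod>j<d. f j (z j)) = (\<Prod>j<d. if j = i then h (z j) else 1) * (\<Prod>j<d. exp (- (z j)\<^sup>2 / 2))"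
      unfolding f_def by (rule prod.distrib)
    then show ?thesis using assms(1) by (simp add: e prod.delta)
  qed
  then have "(\<integral>z. h (z i) * exp (- gauss_potential d z) \<partial>leb d) = (\<Prod>j<d. \<integral>t. f j t \<partial>lborel)"
    unfolding leb_def using lebP.product_integral_prod[of "{..<d}" f] int by simp
  also have "\<dots> = (\<Prod>j\<in>{..<d}-{i}. \<integral>t. f j t \<partial>lborel) * (\<integral>t. f i t \<partial>lborel)"
    using assms(1) by (subst prod.remove[of _ i]) auto
  also have "\<dots> = (\<Prod>j\<in>{..<d}-{i}. s) * (\<integral>t. h t * exp (- t\<^sup>2 / 2) \<partial>lborel)"
    by (simp add: f_def s_def)
  finally have num: "(\<integral>z. h (z i) * exp (- gauss_potential d z) \<partial>leb d) = (\<Prod>j\<in>{..<d}-{i}. s) * (\<integral>t. h t * exp (- t\<^sup>2 / 2) \<partial>lborel)" .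
  have "(\<integral>z. exp (- gauss_potential d z) \<partial>leb d) = (\<Prod>j<d. s)"
    unfolding leb_def s_def e using lebP.product_integral_prod[of "{..<d}" "\<lambda>_ t. exp (- t\<^sup>2 / 2)"] int1 by simp
  also have "\<dots> = (\<Prod>j\<in>{..<d}-{i}. s) * s"
    using assms(1) by (subst prod.remove[of _ i]) auto
  finally show ?thesis
    using num gauss1_pos by (simp add: expect_def E1_def s_def)
qed

text \<open>This class is closed under differentiation: by \<open>pd_PE\<close> the derivative in
  x_i replaces f by f' and the weight w by z_i w. The function \<phi> and its partial derivatives up
  to order three all have this form.\<close>

definition gauss_avg :: "nat \<Rightarrow> (real \<Rightarrow> real) \<Rightarrow> ((nat \<Rightarrow> real) \<Rightarrow> real) \<Rightarrow> (nat \<Rightarrow> real) \<Rightarrow> real" where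
  "gauss_avg d f w x = EG d (\<lambda>z. f (dot d z x) * w z)"

text \<open>The inequality 1 + |z . x| \<le> (1 + |z|_1) (1 + |x|_1) separates the variables, so the
  growth in x factors out of the expectation.\<close>

lemma tame_PE:
  assumes f: "tame1 f" and w: "tame d w"
  shows "tame d (gauss_avg d f w)"
proof -
  from f obtain K m where K: "K \<ge> 0" "\<And>t. \<bar>f t\<bar> \<le> K * (1 + \<bar>t\<bar>) ^ m" by (rule tame1E) blast
  note [measurable] = tame1_measurable[OF f] tame_measurable[OF w]
  define A where "A = EG d (\<lambda>z. K * (1 + l1_norm d z) ^ m * \<bar>w z\<bar>)"
  have tl: "tame d (l1_norm d)" unfolding l1_norm_def by (intro tame_intros) auto
  show ?thesis
  proof (rule tameI[where K = A and m = m])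
    have [measurable]: "(\<lambda>p. dot d (snd p) (fst p)) \<in> borel_measurable (leb d \<Otimes>\<^sub>M leb d)"
      unfolding dot_def
    proof (intro borel_measurable_sum borel_measurable_times)
      fix i assume i: "i \<in> {..<d}"
      show "(\<lambda>p. snd p i) \<in> borel_measurable (leb d \<Otimes>\<^sub>M leb d)"
        using measurable_compose[OF measurable_snd measurable_coord[of i d]] i by simp
      show "(\<lambda>p. fst p i) \<in> borel_measurable (leb d \<Otimes>\<^sub>M leb d)"
        using measurable_compose[OF measurable_fst measurable_coord[of i d]] i by simp
    qed
    show "gauss_avg d f w \<in> borel_measurable (leb d)"
      unfolding gauss_avg_def expect_def
      by (intro borel_measurable_divide sigma_finite_measure.borel_measurable_lebesgue_integral[OF sigma_finite_leb])
        (simp_all add: case_prod_beta)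
    fix x
    have "\<bar>gauss_avg d f w x\<bar> \<le> EG d (\<lambda>z. (1 + l1_norm d x) ^ m * (K * (1 + l1_norm d z) ^ m * \<bar>w z\<bar>))"
      unfolding gauss_avg_def
    proof (rule G.E_abs_le)
      show "tame d (\<lambda>z. f (dot d z x) * w z)" by (intro tame_intros w tame_compose[OF f])
      show "tame d (\<lambda>z. (1 + l1_norm d x) ^ m * (K * (1 + l1_norm d z) ^ m * \<bar>w z\<bar>))" by (intro tame_intros w tl)
      fix z
      have "\<bar>f (dot d z x)\<bar> \<le> K * (1 + \<bar>dot d z x\<bar>) ^ m" by (rule K)
      also have "\<dots> \<le> K * ((1 + l1_norm d z) * (1 + l1_norm d x)) ^ m"
        using K(1) one_plus_dot_le by (intro mult_left_mono power_mono) auto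
      finally have "\<bar>f (dot d z x)\<bar> * \<bar>w z\<bar> \<le> K * ((1 + l1_norm d z) * (1 + l1_norm d x)) ^ m * \<bar>w z\<bar>"
        by (rule mult_right_mono) simp
      then show "\<bar>f (dot d z x) * w z\<bar> \<le> (1 + l1_norm d x) ^ m * (K * (1 + l1_norm d z) ^ m * \<bar>w z\<bar>)"
        by (simp add: abs_mult power_mult_distrib mult_ac)
    qed
    then show "\<bar>gauss_avg d f w x\<bar> \<le> A * (1 + l1_norm d x) ^ m" by (simp add: A_def G.E_cmult mult.commute)
  qed
qed

text \<open>\<open>lip1\<close> and \<open>dif1\<close> are Lipschitz and first-order Taylor bounds
  with a polynomial weight. The weight is a product in s and t, so for s = z . x and t = h z_i it
  stays below one tame function of z for all |h| \<le> 1.\<close>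

definition lip1 :: "(real \<Rightarrow> real) \<Rightarrow> bool" where
  "lip1 f \<longleftrightarrow> (\<exists>K\<ge>0. \<exists>m. \<forall>s t. \<bar>f (s + t) - f s\<bar> \<le> K * ((1 + \<bar>s\<bar>) * (1 + \<bar>t\<bar>)) ^ m * \<bar>t\<bar>)"

definition dif1 :: "(real \<Rightarrow> real) \<Rightarrow> (real \<Rightarrow> real) \<Rightarrow> bool" where
  "dif1 f f' \<longleftrightarrow> (\<exists>K\<ge>0. \<exists>m. \<forall>s t. \<bar>f (s + t) - f s - f' s * t\<bar> \<le> K * ((1 + \<bar>s\<bar>) * (1 + \<bar>t\<bar>)) ^ m * t\<^sup>2)"

lemma dot_fun_upd: "i < d \<Longrightarrow> dot d z (x(i := t)) = (\<Sum>j\<in>{..<d}-{i}. z j * x j) + t * z i"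
  by (simp add: dot_def sum.remove[of "{..<d}" i])

lemma dot_shift: "i < d \<Longrightarrow> dot d z (x(i := t + h)) = dot d z (x(i := t)) + h * z i"
  by (simp add: dot_fun_upd algebra_simps)

lemma has_derivative_quadratic:
  fixes F :: "real \<Rightarrow> real"
  assumes "\<And>h::real. \<bar>h\<bar> \<le> 1 \<Longrightarrow> \<bar>F (t + h) - F t - h * L\<bar> \<le> C * h\<^sup>2"
  shows "(F has_real_derivative L) (at t)"
  unfolding DERIV_def
proof (rule LIM_I)
  fix r :: real assume r: "0 < r"
  have C: "0 \<le> C" using assms[of 1] abs_ge_zero[of "F (t + 1) - F t - 1 * L"] by simp
  show "\<exists>s>0. \<forall>h. h \<noteq> 0 \<and> norm (h - 0) < s \<longrightarrow> norm ((F (t + h) - F t) / h - L) < r"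
  proof (intro exI[of _ "min 1 (r / (C + 1))"] conjI allI impI)
    show "0 < min 1 (r / (C + 1))" using r C by simp
    fix h :: real assume h: "h \<noteq> 0 \<and> norm (h - 0) < min 1 (r / (C + 1))"
    have "\<bar>(F (t + h) - F t) / h - L\<bar> = \<bar>F (t + h) - F t - h * L\<bar> / \<bar>h\<bar>"
      using h by (simp add: field_simps flip: abs_divide)
    also have "\<dots> \<le> C * h\<^sup>2 / \<bar>h\<bar>" using h by (intro divide_right_mono assms) auto
    also have "\<dots> = C * \<bar>h\<bar>" using h by (simp add: power2_eq_square field_simps)
    also have "\<dots> \<le> (C + 1) * \<bar>h\<bar>" by (intro mult_right_mono) auto
    also have "\<dots> < r" using h C by (simp add: field_simps)
    finally show "norm ((F (t + h) - F t) / h - L) < r" by simp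
  qed
qed

lemma continuous_lipschitz:
  fixes F :: "real \<Rightarrow> real"
  assumes "\<And>h::real. \<bar>h\<bar> \<le> 1 \<Longrightarrow> \<bar>F (t + h) - F t\<bar> \<le> C * \<bar>h\<bar>"
  shows "isCont F t"
  unfolding isCont_iff
proof (rule LIM_I)
  fix r :: real assume r: "0 < r"
  have C: "0 \<le> C" using assms[of 1] abs_ge_zero[of "F (t + 1) - F t"] by simp
  show "\<exists>s>0. \<forall>h. h \<noteq> 0 \<and> norm (h - 0) < s \<longrightarrow> norm (F (t + h) - F t) < r"
  proof (intro exI[of _ "min 1 (r / (C + 1))"] conjI allI impI)
    show "0 < min 1 (r / (C + 1))" using r C by simp
    fix h :: real assume h: "h \<noteq> 0 \<and> norm (h - 0) < min 1 (r / (C + 1))"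
    have "\<bar>F (t + h) - F t\<bar> \<le> C * \<bar>h\<bar>" using h by (intro assms) auto
    also have "\<dots> \<le> (C + 1) * \<bar>h\<bar>" by (intro mult_right_mono) auto
    also have "\<dots> < r" using h C by (simp add: field_simps)
    finally show "norm (F (t + h) - F t) < r" by simp
  qed
qed

lemma PE_slice_continuous:
  assumes i: "i < d" and f: "tame1 f" and w: "tame d w" and lip: "lip1 f"
  shows "continuous_on UNIV (\<lambda>t. gauss_avg d f w (x(i := t)))"
proof (intro continuous_at_imp_continuous_on ballI)
  fix t
  from lip obtain K m where K: "K \<ge> 0"
    "\<And>s t. \<bar>f (s + t) - f s\<bar> \<le> K * ((1 + \<bar>s\<bar>) * (1 + \<bar>t\<bar>)) ^ m * \<bar>t\<bar>" by (auto simp: lip1_def)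
  define Q where "Q z = K * ((1 + \<bar>dot d z (x(i := t))\<bar>) * (1 + \<bar>z i\<bar>)) ^ m * \<bar>z i\<bar> * \<bar>w z\<bar>" for z
  have tQ: "tame d Q" unfolding Q_def by (intro tame_intros w i)
  show "isCont (\<lambda>t. gauss_avg d f w (x(i := t))) t"
  proof (rule continuous_lipschitz)
    fix h :: real assume h: "\<bar>h\<bar> \<le> 1"
    have "gauss_avg d f w (x(i := t + h)) - gauss_avg d f w (x(i := t))
      = EG d (\<lambda>z. f (dot d z (x(i := t + h))) * w z - f (dot d z (x(i := t))) * w z)"
      unfolding gauss_avg_def by (subst G.E_diff) (auto intro!: tame_intros w tame_compose[OF f])
    also have "\<bar>\<dots>\<bar> \<le> EG d (\<lambda>z. \<bar>h\<bar> * Q z)"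
    proof (rule G.E_abs_le)
      show "tame d (\<lambda>z. f (dot d z (x(i := t + h))) * w z - f (dot d z (x(i := t))) * w z)"
        by (intro tame_intros w tame_compose[OF f])
      show "tame d (\<lambda>z. \<bar>h\<bar> * Q z)" by (intro tame_intros tQ)
      fix z
      let ?s = "dot d z (x(i := t))"
      have hz: "\<bar>h * z i\<bar> \<le> \<bar>z i\<bar>" using h by (simp add: abs_mult mult_left_le_one_le)
      have "\<bar>f (?s + h * z i) - f ?s\<bar> \<le> K * ((1 + \<bar>?s\<bar>) * (1 + \<bar>h * z i\<bar>)) ^ m * \<bar>h * z i\<bar>" by (rule K)
      also have "\<dots> \<le> K * ((1 + \<bar>?s\<bar>) * (1 + \<bar>z i\<bar>)) ^ m * \<bar>h * z i\<bar>"
        using K(1) hz by (intro mult_right_mono mult_left_mono power_mono) auto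
      finally have "\<bar>f (?s + h * z i) - f ?s\<bar> * \<bar>w z\<bar> \<le> K * ((1 + \<bar>?s\<bar>) * (1 + \<bar>z i\<bar>)) ^ m * \<bar>h * z i\<bar> * \<bar>w z\<bar>"
        by (rule mult_right_mono) simp
      then show "\<bar>f (dot d z (x(i := t + h))) * w z - f (dot d z (x(i := t))) * w z\<bar> \<le> \<bar>h\<bar> * Q z"
        unfolding dot_shift[OF i] Q_def left_diff_distrib[symmetric] abs_mult by (simp add: mult_ac)
    qed
    finally show "\<bar>gauss_avg d f w (x(i := t + h)) - gauss_avg d f w (x(i := t))\<bar> \<le> EG d Q * \<bar>h\<bar>"
      by (simp add: G.E_cmult mult.commute)
  qed
qed

text \<open>The remainder of the expansion in h is at most h^2 times a tame function Q of z, so the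
  derivative passes under the expectation with an error h^2 EG Q. This quantitative remainder takes
  the place of dominated convergence.\<close>

lemma pd_PE:
  assumes i: "i < d" and f: "tame1 f" "tame1 f'" and w: "tame d w" and dif: "dif1 f f'" and lip: "lip1 f'"
  shows "pd i (gauss_avg d f w) (gauss_avg d f' (\<lambda>z. z i * w z))"
  unfolding pd_def
proof (intro conjI allI)
  fix x
  show "continuous_on UNIV (\<lambda>t. gauss_avg d f' (\<lambda>z. z i * w z) (x(i := t)))"
    by (intro PE_slice_continuous i f lip tame_intros w)
  fix t
  from dif obtain K m where K: "K \<ge> 0"
    "\<And>s t. \<bar>f (s + t) - f s - f' s * t\<bar> \<le> K * ((1 + \<bar>s\<bar>) * (1 + \<bar>t\<bar>)) ^ m * t\<^sup>2" by (auto simp: dif1_def)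
  define Q where "Q z = K * ((1 + \<bar>dot d z (x(i := t))\<bar>) * (1 + \<bar>z i\<bar>)) ^ m * (z i)\<^sup>2 * \<bar>w z\<bar>" for z
  have tQ: "tame d Q" unfolding Q_def by (intro tame_intros w i)
  let ?D = "\<lambda>h z. f (dot d z (x(i := t + h))) * w z - f (dot d z (x(i := t))) * w z
        - h * (f' (dot d z (x(i := t))) * (z i * w z))"
  show "((\<lambda>t. gauss_avg d f w (x(i := t))) has_real_derivative gauss_avg d f' (\<lambda>z. z i * w z) (x(i := t))) (at t)"
  proof (rule has_derivative_quadratic)
    fix h :: real assume h: "\<bar>h\<bar> \<le> 1"
    have tD: "tame d (?D h)"
      by (intro tame_diff tame_mult tame_const w tame_compose[OF f(1)] tame_compose[OF f(2)] tame_dot tame_coord i)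
    have eq: "gauss_avg d f w (x(i := t + h)) - gauss_avg d f w (x(i := t)) - h * gauss_avg d f' (\<lambda>z. z i * w z) (x(i := t)) = EG d (?D h)"
    proof -
      have t1: "tame d (\<lambda>z. f (dot d z x) * w z)" for x
        by (intro tame_mult w tame_compose[OF f(1)] tame_dot)
      have t2: "tame d (\<lambda>z. h * (f' (dot d z (x(i := t))) * (z i * w z)))"
        by (intro tame_mult tame_const w tame_compose[OF f(2)] tame_dot tame_coord i)
      show ?thesis
        unfolding gauss_avg_def by (simp only: G.E_diff[OF tame_diff[OF t1 t1] t2] G.E_diff[OF t1 t1] G.E_cmult)
    qed
    moreover have "\<bar>EG d (?D h)\<bar> \<le> EG d (\<lambda>z. h\<^sup>2 * Q z)"
    proof (rule G.E_abs_le[OF tD])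
      show "tame d (\<lambda>z. h\<^sup>2 * Q z)" by (intro tame_intros tQ)
      fix z
      let ?s = "dot d z (x(i := t))"
      have hz: "\<bar>h * z i\<bar> \<le> \<bar>z i\<bar>" using h by (simp add: abs_mult mult_left_le_one_le)
      have "\<bar>f (?s + h * z i) - f ?s - f' ?s * (h * z i)\<bar> \<le> K * ((1 + \<bar>?s\<bar>) * (1 + \<bar>h * z i\<bar>)) ^ m * (h * z i)\<^sup>2"
        by (rule K)
      also have "\<dots> \<le> K * ((1 + \<bar>?s\<bar>) * (1 + \<bar>z i\<bar>)) ^ m * (h * z i)\<^sup>2"
        using K(1) hz by (intro mult_right_mono mult_left_mono power_mono) auto
      finally have "\<bar>f (?s + h * z i) - f ?s - f' ?s * (h * z i)\<bar> * \<bar>w z\<bar>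
          \<le> K * ((1 + \<bar>?s\<bar>) * (1 + \<bar>z i\<bar>)) ^ m * (h * z i)\<^sup>2 * \<bar>w z\<bar>"
        by (rule mult_right_mono) simp
      moreover have "?D h z = (f (?s + h * z i) - f ?s - f' ?s * (h * z i)) * w z"
        unfolding dot_shift[OF i] by (simp add: algebra_simps)
      ultimately show "\<bar>?D h z\<bar> \<le> h\<^sup>2 * Q z"
        by (simp add: abs_mult Q_def power_mult_distrib mult_ac)
    qed
    ultimately show "\<bar>gauss_avg d f w (x(i := t + h)) - gauss_avg d f w (x(i := t)) - h * gauss_avg d f' (\<lambda>z. z i * w z) (x(i := t))\<bar>
        \<le> EG d Q * h\<^sup>2"
      by (simp only: eq G.E_cmult) (simp only: mult.commute)
  qed
qed


lemma lip1_of_dif1: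
  assumes "dif1 f f'" "tame1 f'"
  shows "lip1 f"
proof -
  from assms(1) obtain K m where K: "K \<ge> 0"
    "\<And>s t. \<bar>f (s + t) - f s - f' s * t\<bar> \<le> K * ((1 + \<bar>s\<bar>) * (1 + \<bar>t\<bar>)) ^ m * t\<^sup>2" by (auto simp: dif1_def)
  from assms(2) obtain L k where L: "L \<ge> 0" "\<And>t. \<bar>f' t\<bar> \<le> L * (1 + \<bar>t\<bar>) ^ k" by (rule tame1E) blast
  have "\<bar>f (s + t) - f s\<bar> \<le> (K + L) * ((1 + \<bar>s\<bar>) * (1 + \<bar>t\<bar>)) ^ (m + k + 1) * \<bar>t\<bar>" for s t
  proof -
    let ?u = "(1 + \<bar>s\<bar>) * (1 + \<bar>t\<bar>)"
    have u: "1 \<le> ?u" "1 + \<bar>s\<bar> \<le> ?u" "\<bar>t\<bar> \<le> ?u" by (auto simp: algebra_simps)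
    have 1: "\<bar>f (s + t) - f s\<bar> \<le> K * ?u ^ m * t\<^sup>2 + \<bar>f' s * t\<bar>"
      using K(2)[of s t] by linarith
    have "\<bar>f' s\<bar> \<le> L * ?u ^ k"
      by (rule order_trans[OF L(2)], intro mult_left_mono power_mono) (use L u in auto)
    also have "\<dots> \<le> L * ?u ^ (m + k + 1)" using L(1) u by (intro mult_left_mono power_increasing) auto
    finally have "\<bar>f' s\<bar> * \<bar>t\<bar> \<le> L * ?u ^ (m + k + 1) * \<bar>t\<bar>" by (rule mult_right_mono) simp
    then have 2: "\<bar>f' s * t\<bar> \<le> L * ?u ^ (m + k + 1) * \<bar>t\<bar>" by (simp only: abs_mult)
    have "K * ?u ^ m * \<bar>t\<bar> \<le> K * ?u ^ m * ?u" using K(1) u by (intro mult_left_mono) auto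
    also have "\<dots> = K * ?u ^ (m + 1)" by simp
    also have "\<dots> \<le> K * ?u ^ (m + k + 1)" using K(1) u by (intro mult_left_mono power_increasing) auto
    finally have "K * ?u ^ m * \<bar>t\<bar> * \<bar>t\<bar> \<le> K * ?u ^ (m + k + 1) * \<bar>t\<bar>" by (rule mult_right_mono) simp
    then have 3: "K * ?u ^ m * t\<^sup>2 \<le> K * ?u ^ (m + k + 1) * \<bar>t\<bar>"
      by (simp only: mult.assoc abs_mult_self_eq power2_eq_square)
    show ?thesis using 1 2 3 unfolding distrib_right by linarith
  qed
  then show ?thesis unfolding lip1_def using K(1) L(1) by (intro exI[of _ "K + L"] conjI exI[of _ "m + k + 1"] allI) auto
qed

section \<open>Diagonal matrices, Gaussian measures and total variation\<close>

text \<open>By symmetry the Hessian of V at e1 has this shape (\<open>hessian_V\<close>), so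
  inverse, square root, determinant and quadratic form are evaluated for diagonal matrices.\<close>

definition diagonal_mat :: "nat \<Rightarrow> (nat \<Rightarrow> real) \<Rightarrow> real mat" where
  "diagonal_mat d s = mat d d (\<lambda>(i, j). if i = j then s i else 0)"

lemma dg_carrier [simp]: "diagonal_mat d s \<in> carrier_mat d d"
  by (simp add: diagonal_mat_def)

lemma dg_dim [simp]: "dim_row (diagonal_mat d s) = d" "dim_col (diagonal_mat d s) = d"
  by (simp_all add: diagonal_mat_def)

lemma dg_index: "i < d \<Longrightarrow> j < d \<Longrightarrow> diagonal_mat d s $$ (i, j) = (if i = j then s i else 0)"
  by (simp add: diagonal_mat_def)

lemma dg_cong: "(\<And>i. i < d \<Longrightarrow> s i = t i) \<Longrightarrow> diagonal_mat d s = diagonal_mat d t"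
  by (auto simp: diagonal_mat_def intro: eq_matI)

lemma one_mat_dg: "1\<^sub>m d = diagonal_mat d (\<lambda>_. 1)"
  by (auto simp: diagonal_mat_def intro: eq_matI)

lemma mat_mult_index_sum:
  "A \<in> carrier_mat n k \<Longrightarrow> B \<in> carrier_mat k m \<Longrightarrow> i < n \<Longrightarrow> j < m \<Longrightarrow>
    (A * B) $$ (i, j) = (\<Sum>l<k. A $$ (i, l) * B $$ (l, j))"
  by (auto simp: scalar_prod_def lessThan_atLeast0 intro!: sum.cong)

lemma dg_mult: "diagonal_mat d s * diagonal_mat d t = diagonal_mat d (\<lambda>i. s i * t i)"
proof (rule eq_matI)
  fix i j assume "i < dim_row (diagonal_mat d (\<lambda>i. s i * t i))" "j < dim_col (diagonal_mat d (\<lambda>i. s i * t i))"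
  then have ij: "i < d" "j < d" by auto
  have "(diagonal_mat d s * diagonal_mat d t) $$ (i, j) = (\<Sum>l<d. diagonal_mat d s $$ (i, l) * diagonal_mat d t $$ (l, j))"
    by (rule mat_mult_index_sum[OF dg_carrier dg_carrier ij])
  also have "\<dots> = (\<Sum>l<d. if l = i then s i * diagonal_mat d t $$ (i, j) else 0)"
    using ij by (intro sum.cong) (auto simp: dg_index)
  also have "\<dots> = diagonal_mat d (\<lambda>i. s i * t i) $$ (i, j)"
    using ij by (simp add: dg_index)
  finally show "(diagonal_mat d s * diagonal_mat d t) $$ (i, j) = diagonal_mat d (\<lambda>i. s i * t i) $$ (i, j)" .
qed auto

lemma quad_form_dg: "quad_form (diagonal_mat d s) x = (\<Sum>i<d. s i * (x i)\<^sup>2)"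
proof -
  have "(\<Sum>j<d. x i * diagonal_mat d s $$ (i, j) * x j) = s i * (x i)\<^sup>2" if "i < d" for i
  proof -
    have "(\<Sum>j<d. x i * diagonal_mat d s $$ (i, j) * x j) = (\<Sum>j<d. if j = i then s i * (x i)\<^sup>2 else 0)"
      using that by (intro sum.cong) (auto simp: dg_index power2_eq_square)
    then show ?thesis using that by simp
  qed
  then show ?thesis by (simp add: quad_form_def)
qed

lemma mat_app_dg: "mat_app (diagonal_mat d s) x = (\<lambda>i\<in>{..<d}. s i * x i)"
proof -
  have "(\<Sum>j<d. diagonal_mat d s $$ (i, j) * x j) = s i * x i" if "i < d" for i
  proof -
    have "(\<Sum>j<d. diagonal_mat d s $$ (i, j) * x j) = (\<Sum>j<d. if j = i then s i * x i else 0)"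
      using that by (intro sum.cong) (auto simp: dg_index)
    then show ?thesis using that by simp
  qed
  then show ?thesis by (auto simp: mat_app_def restrict_def)
qed

text \<open>The inverse is an optional result of Gauss-Jordan elimination: exhibiting a two-sided
  inverse shows that a result exists, and uniqueness of inverses identifies it.\<close>

lemma inv_mat_dg:
  assumes "\<And>i. i < d \<Longrightarrow> s i \<noteq> 0"
  shows "inv_mat (diagonal_mat d s) = diagonal_mat d (\<lambda>i. 1 / s i)"
proof -
  let ?A = "diagonal_mat d s" and ?B = "diagonal_mat d (\<lambda>i. 1 / s i)"
  have AB: "?A * ?B = 1\<^sub>m d" "?B * ?A = 1\<^sub>m d"
    unfolding dg_mult one_mat_dg using assms by (auto intro!: dg_cong)
  have "?A \<in> Units (ring_mat TYPE(real) d ())"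
    unfolding Units_def using AB by (auto simp: ring_mat_simps intro!: bexI[of _ ?B])
  then obtain C where C: "mat_inverse ?A = Some C"
    using mat_inverse(1)[OF dg_carrier, of d s "()"] by (cases "mat_inverse ?A") auto
  then have CA: "C * ?A = 1\<^sub>m d" and Cc: "C \<in> carrier_mat d d"
    using mat_inverse(2)[OF dg_carrier C] by auto
  have "C = C * (?A * ?B)" using Cc AB by simp
  also have "\<dots> = (C * ?A) * ?B" using Cc by (simp add: assoc_mult_mat[OF Cc dg_carrier dg_carrier])
  also have "\<dots> = ?B" by (simp add: CA)
  finally show ?thesis by (simp add: inv_mat_def C)
qed

lemma det_dg: "det (diagonal_mat d s) = (\<Prod>i<d. s i)"
proof -
  have "det (diagonal_mat d s) = prod_list (diag_mat (diagonal_mat d s))"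
    by (rule det_upper_triangular[OF _ dg_carrier]) (auto simp: upper_triangular_def dg_index)
  also have "\<dots> = (\<Prod>i\<in>{0..<d}. s i)"
    unfolding diag_mat_def dg_dim by (subst prod.list_conv_set_nth) (auto simp: dg_index intro!: prod.cong)
  finally show ?thesis by (simp add: lessThan_atLeast0)
qed

lemma pos_semidef_dg: "(\<And>i. i < d \<Longrightarrow> 0 \<le> s i) \<Longrightarrow> pos_semidef (diagonal_mat d s)"
  unfolding pos_semidef_def
  by (auto simp: quad_form_dg dg_index intro!: eq_matI sum_nonneg)

text \<open>
  With \<open>D = S - T\<close> and \<open>S\<^sup>2 = T\<^sup>2\<close> one has \<open>D S + T D = 0\<close>, so
  \<open>tr (D S D) + tr (D T D) = 0\<close>; as both traces are nonnegative and \<open>T\<close> is positive definite, \<open>D = 0\<close>.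
\<close>

lemma sqrt_mat_dg:
  assumes pos: "\<And>i. i < d \<Longrightarrow> 0 < s i"
  shows "sqrt_mat (diagonal_mat d s) = diagonal_mat d (\<lambda>i. sqrt (s i))"
  unfolding sqrt_mat_def
proof (rule the_equality)
  let ?T = "diagonal_mat d (\<lambda>i. sqrt (s i))"
  have TT: "?T * ?T = diagonal_mat d s"
    unfolding dg_mult using pos by (intro dg_cong) (auto simp: less_imp_le)
  then show "pos_semidef ?T \<and> dim_row ?T = dim_row (diagonal_mat d s) \<and> ?T * ?T = diagonal_mat d s"
    using pos by (auto intro!: pos_semidef_dg simp: less_imp_le)
  fix S assume S: "pos_semidef S \<and> dim_row S = dim_row (diagonal_mat d s) \<and> S * S = diagonal_mat d s"
  then have Sc: "S \<in> carrier_mat d d" by (auto simp: pos_semidef_def)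
  have symS: "S $$ (i, j) = S $$ (j, i)" if "i < d" "j < d" for i j
  proof -
    have "S $$ (i, j) = transpose_mat S $$ (i, j)" using S by (simp add: pos_semidef_def)
    then show ?thesis using that Sc by simp
  qed
  define D where "D i j = S $$ (i, j) - ?T $$ (i, j)" for i j
  have symD: "D i j = D j i" if "i < d" "j < d" for i j
    using symS[OF that] that by (auto simp: D_def dg_index)
  have comm: "(\<Sum>k<d. D i k * S $$ (k, j)) + (\<Sum>k<d. ?T $$ (i, k) * D k j) = 0" if "i < d" "j < d" for i j
  proof -
    have "(\<Sum>k<d. D i k * S $$ (k, j)) + (\<Sum>k<d. ?T $$ (i, k) * D k j)
        = (\<Sum>k<d. S $$ (i, k) * S $$ (k, j)) - (\<Sum>k<d. ?T $$ (i, k) * ?T $$ (k, j))"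
      by (simp add: D_def sum.distrib[symmetric] sum_subtractf[symmetric] algebra_simps)
    also have "\<dots> = (S * S) $$ (i, j) - (?T * ?T) $$ (i, j)"
      using that by (simp add: mat_mult_index_sum[OF Sc Sc that] mat_mult_index_sum[OF dg_carrier dg_carrier that])
    also have "\<dots> = 0" using S TT by simp
    finally show ?thesis .
  qed
  have "(\<Sum>j<d. quad_form S (\<lambda>i. D i j)) + (\<Sum>j<d. quad_form ?T (\<lambda>i. D i j)) = 0"
  proof -
    have "(\<Sum>j<d. quad_form S (\<lambda>i. D i j)) = (\<Sum>j<d. \<Sum>i<d. \<Sum>k<d. D i j * S $$ (i, k) * D k j)"
      using Sc by (simp add: quad_form_def)
    also have "\<dots> = (\<Sum>j<d. \<Sum>k<d. \<Sum>i<d. D i j * S $$ (i, k) * D k j)"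
      by (rule sum.cong[OF refl], rule sum.swap)
    also have "\<dots> = (\<Sum>j<d. \<Sum>k<d. (\<Sum>i<d. D j i * S $$ (i, k)) * D k j)"
    proof (intro sum.cong refl)
      fix j k assume "j \<in> {..<d}"
      then have "(\<Sum>i<d. D i j * S $$ (i, k) * D k j) = (\<Sum>i<d. D j i * S $$ (i, k) * D k j)"
        by (intro sum.cong refl) (simp add: symD[of _ j])
      then show "(\<Sum>i<d. D i j * S $$ (i, k) * D k j) = (\<Sum>i<d. D j i * S $$ (i, k)) * D k j"
        by (simp add: sum_distrib_right)
    qed
    also have "\<dots> = (\<Sum>j<d. \<Sum>k<d. - (\<Sum>i<d. ?T $$ (j, i) * D i k) * D k j)"
    proof (intro sum.cong refl)
      fix j k assume "j \<in> {..<d}" "k \<in> {..<d}"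
      then have "(\<Sum>i<d. D j i * S $$ (i, k)) = - (\<Sum>i<d. ?T $$ (j, i) * D i k)"
        using comm[of j k] by simp
      then show "(\<Sum>i<d. D j i * S $$ (i, k)) * D k j = - (\<Sum>i<d. ?T $$ (j, i) * D i k) * D k j"
        by (simp only:)
    qed
    also have "\<dots> = (\<Sum>j<d. \<Sum>k<d. - (\<Sum>i<d. D j k * ?T $$ (j, i) * D i k))"
    proof (rule sum.cong[OF refl], rule sum.cong[OF refl])
      fix j k assume "j \<in> {..<d}" "k \<in> {..<d}"
      then have "D k j = D j k" by (intro symD) auto
      then show "- (\<Sum>i<d. ?T $$ (j, i) * D i k) * D k j = - (\<Sum>i<d. D j k * ?T $$ (j, i) * D i k)"
        by (simp add: sum_distrib_right sum_distrib_left mult_ac)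
    qed
    also have "\<dots> = - (\<Sum>j<d. \<Sum>k<d. \<Sum>i<d. D j k * ?T $$ (j, i) * D i k)"
      by (simp add: sum_negf)
    also have "\<dots> = - (\<Sum>k<d. \<Sum>j<d. \<Sum>i<d. D j k * ?T $$ (j, i) * D i k)"
      by (subst sum.swap) (rule refl)
    also have "\<dots> = - (\<Sum>k<d. quad_form ?T (\<lambda>i. D i k))"
      by (simp add: quad_form_def)
    finally show ?thesis by simp
  qed
  moreover have "0 \<le> (\<Sum>j<d. quad_form S (\<lambda>i. D i j))"
    using S by (intro sum_nonneg) (auto simp: pos_semidef_def)
  moreover have nn: "0 \<le> quad_form ?T x" for x
    using pos by (auto simp: quad_form_dg less_imp_le intro!: sum_nonneg)
  then have "0 \<le> (\<Sum>j<d. quad_form ?T (\<lambda>i. D i j))" by (intro sum_nonneg)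
  ultimately have "(\<Sum>j<d. quad_form ?T (\<lambda>i. D i j)) = 0" by linarith
  then have z: "quad_form ?T (\<lambda>i. D i j) = 0" if "j < d" for j
    using nn that by (subst (asm) sum_nonneg_eq_0_iff) auto
  have D0: "D i j = 0" if ij: "i < d" "j < d" for i j
  proof -
    have "(\<Sum>i<d. sqrt (s i) * (D i j)\<^sup>2) = 0"
      using z[OF ij(2)] by (simp add: quad_form_dg)
    then have "sqrt (s i) * (D i j)\<^sup>2 = 0"
      using pos ij by (subst (asm) sum_nonneg_eq_0_iff) (auto simp: less_imp_le)
    then show ?thesis using pos[OF ij(1)] by simp
  qed
  show "S = ?T"
    using Sc D0 by (intro eq_matI) (auto simp: D_def)
qed

section \<open>Gaussian measures with diagonal covariance\<close>

lemma integrable_gauss1: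
  assumes "s > 0"
  shows "integrable lborel (\<lambda>t::real. exp (- (t - m)\<^sup>2 / (2 * s)))"
    "(\<integral>t. exp (- (t - m)\<^sup>2 / (2 * s)) \<partial>(lborel::real measure)) = sqrt (2 * pi * s)"
proof -
  have c: "sqrt (2 * pi * s) > 0" using assms by simp
  have eq: "exp (- (t - m)\<^sup>2 / (2 * s)) = sqrt (2 * pi * s) * normal_density m (sqrt s) t" for t
    using assms c by (simp add: normal_density_def)
  show "integrable lborel (\<lambda>t::real. exp (- (t - m)\<^sup>2 / (2 * s)))"
    unfolding eq using assms by (intro integrable_mult_right integrable_normal_density) auto
  show "(\<integral>t. exp (- (t - m)\<^sup>2 / (2 * s)) \<partial>(lborel::real measure)) = sqrt (2 * pi * s)"
    unfolding eq using assms by (simp add: integral_normal_density)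
qed

lemma sqrt_prod: "sqrt (\<Prod>i\<in>I. f i) = (\<Prod>i\<in>I. sqrt (f i))"
  by (induction I rule: infinite_finite_induct) (auto simp: real_sqrt_mult)

text \<open>The exponential factors over the coordinates, and the product of the one-dimensional
  normalisations is exactly the square root in \<open>gaussian\<close>; the explicit normalising
  factor therefore equals the integral in \<open>gibbs\<close>.\<close>

lemma gaussian_dg:
  assumes pos: "\<And>i. i < d \<Longrightarrow> 0 < s i"
  shows "gaussian d m (diagonal_mat d s) = gibbs d (\<lambda>x. \<Sum>i<d. (x i - m i)\<^sup>2 / (2 * s i))"
proof -
  let ?V = "\<lambda>x. \<Sum>i<d. (x i - m i)\<^sup>2 / (2 * s i)"
  have e: "exp (- ?V x) = (\<Prod>i<d. exp (- (x i - m i)\<^sup>2 / (2 * s i)))" for x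
    by (simp add: exp_sum[symmetric] sum_negf)
  have "(\<integral>x. exp (- ?V x) \<partial>leb d) = (\<Prod>i<d. \<integral>t. exp (- (t - m i)\<^sup>2 / (2 * s i)) \<partial>(lborel::real measure))"
    unfolding leb_def e
    by (rule lebP.product_integral_prod) (use integrable_gauss1(1) pos in auto)
  also have "\<dots> = (\<Prod>i<d. sqrt (2 * pi * s i))"
    using integrable_gauss1(2)[OF pos] by (intro prod.cong) simp_all
  also have "\<dots> = sqrt ((2 * pi) ^ d * det (diagonal_mat d s))"
    by (simp add: det_dg sqrt_prod[symmetric] prod.distrib)
  finally have Z: "(\<integral>x. exp (- ?V x) \<partial>leb d) = sqrt ((2 * pi) ^ d * det (diagonal_mat d s))" .
  have q: "- quad_form (inv_mat (diagonal_mat d s)) (\<lambda>i. x i - m i) / 2 = - ?V x" for x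
  proof -
    have "inv_mat (diagonal_mat d s) = diagonal_mat d (\<lambda>i. 1 / s i)"
      using pos by (intro inv_mat_dg) fastforce
    then show ?thesis by (simp add: quad_form_dg sum_divide_distrib mult.commute)
  qed
  show ?thesis unfolding gaussian_def gibbs_def Z q ..
qed

lemma std_gaussian_gibbs: "std_gaussian d = gibbs d (gauss_potential d)"
proof -
  have "std_gaussian d = gibbs d (\<lambda>x. \<Sum>i<d. (x i - origin d i)\<^sup>2 / (2 * 1))"
    unfolding std_gaussian_def one_mat_dg by (rule gaussian_dg) simp
  also have "(\<lambda>x. \<Sum>i<d. (x i - origin d i)\<^sup>2 / (2 * 1)) = gauss_potential d"
    by (auto simp: gauss_potential_def origin_def sum_divide_distrib intro!: sum.cong)
  finally show ?thesis .
qed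

lemma integral_gibbs:
  assumes "coercive d W" and [measurable]: "f \<in> borel_measurable (leb d)"
  shows "(\<integral>x. f x \<partial>gibbs d W) = expect d W f"
proof -
  interpret coercive_potential d W by (rule coercive_potential.intro) fact
  show ?thesis
    unfolding gibbs_def using Z_pos
    by (subst integral_density) (auto simp: expect_def mult.commute)
qed

lemma gibbs_shift: "gibbs d (\<lambda>x. W x + c) = gibbs d W"
proof -
  have e: "exp (- (W x + c)) = exp (- c) * exp (- W x)" for x by (simp add: exp_add[symmetric])
  show ?thesis unfolding gibbs_def e by simp
qed

lemma expect_shift: "expect d (\<lambda>x. W x + c) f = expect d W f"
proof -
  have "exp (- (W x + c)) = exp (- c) * exp (- W x)" for x by (simp add: exp_add[symmetric])
  then show ?thesis by (simp add: expect_def mult.left_commute[of _ "exp (- c)"])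
qed

lemma coercive_shift:
  assumes "coercive d W" shows "coercive d (\<lambda>x. W x + c)"
proof -
  from assms obtain \<kappa> K where K: "\<kappa> > 0" "\<And>x. \<kappa> * l1_norm d x - K \<le> W x" and [measurable]: "W \<in> borel_measurable (leb d)"
    by (auto simp: coercive_def)
  have "\<kappa> * l1_norm d x - (K - c) \<le> W x + c" for x using K(2)[of x] by simp
  then show ?thesis using K(1) unfolding coercive_def by (intro conjI exI[of _ \<kappa>] exI[of _ "K - c"]) auto
qed

section \<open>Total variation between densities\<close>

lemma measure_density_real:
  assumes p: "integrable M p" "\<And>x. 0 \<le> p x" and A: "A \<in> sets M"
  shows "measure (density M (\<lambda>x. ennreal (p x))) A = (\<integral>x. indicator A x * p x \<partial>M)"
proof -
  have [measurable]: "p \<in> borel_measurable M" using p by simp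
  have "emeasure (density M (\<lambda>x. ennreal (p x))) A = (\<integral>\<^sup>+x. ennreal (indicator A x * p x) \<partial>M)"
    using A by (subst emeasure_density) (auto intro!: nn_integral_cong simp: indicator_def)
  also have "\<dots> = ennreal (\<integral>x. indicator A x * p x \<partial>M)"
    using p A by (intro nn_integral_eq_integral) (auto intro!: integrable_real_mult_indicator simp: mult.commute)
  finally show ?thesis
    using p by (simp add: measure_def)
qed

text \<open>The supremum is attained at the set where q < p. Equal masses allow 2 (P(A) - Q(A)) to
  be written as the integral of p - q against the sign 2 1_A - 1; this is at most the L1 distance
  for every A, with equality for that set.\<close>

lemma TV_density:
  assumes p: "integrable M p" "\<And>x. 0 \<le> p x" and q: "integrable M q" "\<And>x. 0 \<le> q x"
    and eq: "(\<integral>x. p x \<partial>M) = (\<integral>x. q x \<partial>M)"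
  shows "TV (density M (\<lambda>x. ennreal (p x))) (density M (\<lambda>x. ennreal (q x))) = 1 / 2 * (\<integral>x. \<bar>p x - q x\<bar> \<partial>M)"
proof -
  let ?P = "density M (\<lambda>x. ennreal (p x))" and ?Q = "density M (\<lambda>x. ennreal (q x))"
  have [measurable]: "p \<in> borel_measurable M" "q \<in> borel_measurable M" using p q by auto
  let ?I = "\<integral>x. \<bar>p x - q x\<bar> \<partial>M"
  have int: "integrable M (\<lambda>x. indicator A x * f x)" if "A \<in> sets M" "integrable M f" for A and f :: "'a \<Rightarrow> real"
    using integrable_real_mult_indicator[OF that] by (simp add: mult.commute)
  have D: "2 * (measure ?P A - measure ?Q A) = (\<integral>x. (2 * indicator A x - 1) * (p x - q x) \<partial>M)" if A: "A \<in> sets M" for A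
  proof -
    have "(\<integral>x. (2 * indicator A x - 1) * (p x - q x) \<partial>M)
       = (\<integral>x. 2 * (indicator A x * p x) - 2 * (indicator A x * q x) - (p x - q x) \<partial>M)"
      by (intro Bochner_Integration.integral_cong) (auto simp: algebra_simps)
    also have "\<dots> = 2 * (\<integral>x. indicator A x * p x \<partial>M) - 2 * (\<integral>x. indicator A x * q x \<partial>M)
        - ((\<integral>x. p x \<partial>M) - (\<integral>x. q x \<partial>M))"
      using p q A by (simp add: int)
    also have "\<dots> = 2 * (measure ?P A - measure ?Q A)"
      by (simp add: eq measure_density_real[OF p A] measure_density_real[OF q A])
    finally show ?thesis by simp
  qed
  have le: "\<bar>measure ?P A - measure ?Q A\<bar> \<le> 1 / 2 * ?I" if A: "A \<in> sets M" for A
  proof -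
    have "\<bar>2 * (measure ?P A - measure ?Q A)\<bar> \<le> (\<integral>x. \<bar>(2 * indicator A x - 1) * (p x - q x)\<bar> \<partial>M)"
      unfolding D[OF A] by (rule integral_abs_bound)
    also have "\<dots> = ?I"
      by (intro Bochner_Integration.integral_cong) (auto simp: indicator_def)
    finally show ?thesis unfolding abs_mult by simp
  qed
  have I0: "0 \<le> ?I" by simp
  define A where "A = {x \<in> space M. q x < p x}"
  have A: "A \<in> sets M" unfolding A_def by measurable
  have "2 * (measure ?P A - measure ?Q A) = ?I"
    unfolding D[OF A] by (intro Bochner_Integration.integral_cong) (auto simp: indicator_def A_def)
  then have m: "measure ?P A - measure ?Q A = 1 / 2 * ?I" by simp
  have "1 / 2 * ?I = \<bar>measure ?P A - measure ?Q A\<bar>"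
    unfolding m using I0 by (subst abs_of_nonneg) auto
  moreover have "bdd_above ((\<lambda>A. \<bar>measure ?P A - measure ?Q A\<bar>) ` sets M)"
    by (rule bdd_aboveI2) (rule le)
  then have "\<bar>measure ?P A - measure ?Q A\<bar> \<le> TV ?P ?Q"
    unfolding TV_def sets_density by (rule cSUP_upper[OF A])
  moreover have "TV ?P ?Q \<le> 1 / 2 * ?I"
    unfolding TV_def using le A by (intro cSUP_least) auto
  ultimately show ?thesis by linarith
qed

text \<open>Everything comes from e^(Q-V) e^(-Q) = e^(-V), with Z the ratio of the two normalising
  integrals. The third clause is an identity between quotients of integrals, valid for every f; it
  turns an average of f e^(Q-V) under Q into an average of f under V.\<close>

lemma TV_gibbs:
  assumes "coercive d V" "coercive d Q"
  defines "Z \<equiv> expect d Q (\<lambda>x. exp (Q x - V x))"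
  shows "TV (gibbs d V) (gibbs d Q) = 1 / 2 * expect d Q (\<lambda>x. \<bar>exp (Q x - V x) / Z - 1\<bar>)" "Z > 0"
    "\<And>f. expect d Q (\<lambda>x. f x * exp (Q x - V x)) = Z * expect d V f"
proof -
  interpret V: coercive_potential d V by (rule coercive_potential.intro) fact
  interpret Q: coercive_potential d Q by (rule coercive_potential.intro) fact
  define ZV where "ZV = (\<integral>x. exp (- V x) \<partial>leb d)"
  define ZQ where "ZQ = (\<integral>x. exp (- Q x) \<partial>leb d)"
  have pos: "ZV > 0" "ZQ > 0" using V.Z_pos Q.Z_pos by (auto simp: ZV_def ZQ_def)
  have e: "exp (Q x - V x) * exp (- Q x) = exp (- V x)" for x by (simp add: exp_add[symmetric])
  have Z: "Z = ZV / ZQ" by (simp add: Z_def expect_def e ZV_def ZQ_def)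
  then show "Z > 0" using pos by simp
  show "expect d Q (\<lambda>x. f x * exp (Q x - V x)) = Z * expect d V f" for f
    using pos by (simp add: expect_def mult.assoc e Z ZV_def[symmetric] ZQ_def[symmetric])
  have "TV (gibbs d V) (gibbs d Q) = 1 / 2 * (\<integral>x. \<bar>exp (- V x) / ZV - exp (- Q x) / ZQ\<bar> \<partial>leb d)"
    unfolding gibbs_def ZV_def[symmetric] ZQ_def[symmetric]
    using pos V.int_exp Q.int_exp by (intro TV_density) (auto simp: ZV_def ZQ_def)
  also have "(\<lambda>x. \<bar>exp (- V x) / ZV - exp (- Q x) / ZQ\<bar>) = (\<lambda>x. (\<bar>exp (Q x - V x) / Z - 1\<bar> * exp (- Q x)) / ZQ)"
  proof
    fix x
    have "exp (- V x) / ZV - exp (- Q x) / ZQ = (exp (Q x - V x) / Z - 1) * (exp (- Q x) / ZQ)"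
      using pos by (simp add: Z e[of x, symmetric] field_simps)
    then show "\<bar>exp (- V x) / ZV - exp (- Q x) / ZQ\<bar> = (\<bar>exp (Q x - V x) / Z - 1\<bar> * exp (- Q x)) / ZQ"
      using pos by (simp add: abs_mult)
  qed
  finally show "TV (gibbs d V) (gibbs d Q) = 1 / 2 * expect d Q (\<lambda>x. \<bar>exp (Q x - V x) / Z - 1\<bar>)"
    by (simp add: expect_def ZQ_def)
qed

text \<open>The upper bound follows from |u - 1| \<le> u + 1 for the density ratio u, which has mean
  1 under the second measure.\<close>

lemma TV_nonneg_le_1:
  assumes "coercive d V" "coercive d Q"
  shows "0 \<le> TV (gibbs d V) (gibbs d Q)" "TV (gibbs d V) (gibbs d Q) \<le> 1"
proof -
  interpret V: coercive_potential d V by (rule coercive_potential.intro) fact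
  interpret Q: coercive_potential d Q by (rule coercive_potential.intro) fact
  define Z where "Z = expect d Q (\<lambda>x. exp (Q x - V x))"
  note TV = TV_gibbs[OF assms, folded Z_def]
  show "0 \<le> TV (gibbs d V) (gibbs d Q)"
    unfolding TV(1) using Q.E_nonneg by simp
  have e: "exp (Q x - V x) * exp (- Q x) = exp (- V x)" for x by (simp add: exp_add[symmetric])
  have "expect d Q (\<lambda>x. \<bar>exp (Q x - V x) / Z - 1\<bar>) \<le> expect d Q (\<lambda>x. exp (Q x - V x) / Z + 1)"
    unfolding expect_def
  proof (rule divide_right_mono[OF integral_mono_AE'])
    have "(\<lambda>x. (exp (Q x - V x) / Z + 1) * exp (- Q x)) = (\<lambda>x. exp (- V x) / Z + exp (- Q x))"
      by (simp add: distrib_right e)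
    then show "integrable (leb d) (\<lambda>x. (exp (Q x - V x) / Z + 1) * exp (- Q x))"
      using V.int_exp Q.int_exp by simp
    show "AE x in leb d. \<bar>exp (Q x - V x) / Z - 1\<bar> * exp (- Q x) \<le> (exp (Q x - V x) / Z + 1) * exp (- Q x)"
      using TV(2) by (intro AE_I2 mult_right_mono) (auto simp: abs_le_iff)
    show "AE x in leb d. 0 \<le> (exp (Q x - V x) / Z + 1) * exp (- Q x)"
      using TV(2) by simp
    show "0 \<le> (\<integral>x. exp (- Q x) \<partial>leb d)" using Q.Z_pos by simp
  qed
  also have "\<dots> = 2"
  proof -
    have "(\<lambda>x. (exp (Q x - V x) / Z + 1) * exp (- Q x)) = (\<lambda>x. exp (- V x) / Z + exp (- Q x))"
      by (simp add: distrib_right e)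
    then have "expect d Q (\<lambda>x. exp (Q x - V x) / Z + 1) = (\<integral>x. exp (- V x) \<partial>leb d) / Z / (\<integral>x. exp (- Q x) \<partial>leb d) + 1"
      using V.int_exp Q.int_exp Q.Z_pos by (simp add: expect_def add_divide_distrib)
    moreover have "Z = (\<integral>x. exp (- V x) \<partial>leb d) / (\<integral>x. exp (- Q x) \<partial>leb d)"
      by (simp add: Z_def expect_def e)
    ultimately show ?thesis using TV(2) V.Z_pos Q.Z_pos by simp
  qed
  finally show "TV (gibbs d V) (gibbs d Q) \<le> 1" unfolding TV(1) by simp
qed

section \<open>The function \<open>\<psi>\<close>\<close>

locale smooth_convex =
  fixes \<psi> :: "real \<Rightarrow> real" and B :: real
  assumes C4: "C4 \<psi>" and strict: "strictly_convex \<psi>"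
    and B3: "\<And>t. \<bar>(deriv ^^ 3) \<psi> t\<bar> \<le> B" and B4: "\<And>t. \<bar>(deriv ^^ 4) \<psi> t\<bar> \<le> B"
begin

definition p :: "nat \<Rightarrow> real \<Rightarrow> real" where
  "p k = (deriv ^^ k) \<psi>"

lemma p_0: "p 0 = \<psi>" and p_1: "p 1 = deriv \<psi>"
  by (simp_all add: p_def)

lemma B_nonneg: "0 \<le> B"
  using B3[of 0] abs_ge_zero order_trans by blast

lemma p_bound: "\<bar>p 3 t\<bar> \<le> B" "\<bar>p 4 t\<bar> \<le> B"
  using B3 B4 by (simp_all add: p_def)

lemma deriv_p: "k < 4 \<Longrightarrow> (p k has_real_derivative p (Suc k) t) (at t)"
  using C4 by (simp add: C4_def p_def DERIV_deriv_iff_real_differentiable)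

lemma continuous_p:
  assumes "k \<le> 4" shows "continuous_on UNIV (p k)"
proof (cases "k = 4")
  case True
  then show ?thesis using C4 by (simp add: C4_def p_def)
next
  case False
  then show ?thesis
    using assms by (intro continuous_at_imp_continuous_on ballI DERIV_isCont[OF deriv_p]) auto
qed

lemma measurable_p: "k \<le> 4 \<Longrightarrow> p k \<in> borel_measurable borel"
  by (intro borel_measurable_continuous_onI continuous_p)

section \<open>Taylor bounds for the derivatives of psi\<close>

lemma taylor:
  assumes n: "0 < n" "j + n \<le> 4" and M: "\<And>u. \<bar>p (j + n) u\<bar> \<le> M"
  shows "\<bar>p j (s + t) - (\<Sum>m<n. p (j + m) s / fact m * t ^ m)\<bar> \<le> M / fact n * \<bar>t\<bar> ^ n"
proof (cases "t = 0")
  case True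
  have "(\<Sum>m<n. p (j + m) s / fact m * 0 ^ m) = p j s"
    using n(1) by (subst sum.remove[of _ 0]) (auto simp: power_0_left)
  then show ?thesis using True n(1) by (simp add: power_0_left)
next
  case False
  have "\<exists>u. (if s + t < s then s + t < u \<and> u < s else s < u \<and> u < s + t) \<and>
     p j (s + t) = (\<Sum>m<n. p (j + m) s / fact m * (s + t - s) ^ m) + p (j + n) u / fact n * (s + t - s) ^ n"
    using n False
    by (intro Taylor[of n "\<lambda>m. p (j + m)" "p j" "min s (s + t)" "max s (s + t)" s "s + t"])
      (auto intro!: deriv_p)
  then obtain u where u: "p j (s + t) = (\<Sum>m<n. p (j + m) s / fact m * t ^ m) + p (j + n) u / fact n * t ^ n"
    by auto
  then have "\<bar>p j (s + t) - (\<Sum>m<n. p (j + m) s / fact m * t ^ m)\<bar> = \<bar>p (j + n) u\<bar> / fact n * \<bar>t\<bar> ^ n"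
    by (simp add: abs_mult power_abs)
  also have "\<dots> \<le> M / fact n * \<bar>t\<bar> ^ n"
    using M by (intro mult_right_mono divide_right_mono) auto
  finally show ?thesis .
qed

lemma taylor_04: "\<bar>p 0 (s + t) - (p 0 s + p 1 s * t + p 2 s * t\<^sup>2 / 2 + p 3 s * t ^ 3 / 6)\<bar> \<le> B / 24 * t ^ 4"
  using taylor[of 4 0 B s t] p_bound(2)
  by (simp add: eval_nat_numeral lessThan_Suc algebra_simps)

lemma taylor_03: "\<bar>p 0 (s + t) - (p 0 s + p 1 s * t + p 2 s * t\<^sup>2 / 2)\<bar> \<le> B / 6 * \<bar>t\<bar> ^ 3"
  using taylor[of 3 0 B s t] p_bound(1)
  by (simp add: eval_nat_numeral lessThan_Suc algebra_simps)

lemma taylor_13: "\<bar>p 1 (s + t) - (p 1 s + p 2 s * t + p 3 s * t\<^sup>2 / 2)\<bar> \<le> B / 6 * \<bar>t\<bar> ^ 3"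
  using taylor[of 3 1 B s t] p_bound(2)
  by (simp add: eval_nat_numeral lessThan_Suc algebra_simps)

lemma taylor_12: "\<bar>p 1 (s + t) - (p 1 s + p 2 s * t)\<bar> \<le> B / 2 * t\<^sup>2"
  using taylor[of 2 1 B s t] p_bound(1)
  by (simp add: eval_nat_numeral lessThan_Suc algebra_simps)

lemma taylor_22: "\<bar>p 2 (s + t) - (p 2 s + p 3 s * t)\<bar> \<le> B / 2 * t\<^sup>2"
  using taylor[of 2 2 B s t] p_bound(2)
  by (simp add: eval_nat_numeral lessThan_Suc algebra_simps)

lemma taylor_31: "\<bar>p 3 (s + t) - p 3 s\<bar> \<le> B * \<bar>t\<bar>"
  using taylor[of 1 3 B s t] p_bound(2)
  by (simp add: eval_nat_numeral lessThan_Suc algebra_simps)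

lemma abs_le2: "\<bar>x - (u + v)\<bar> \<le> e \<Longrightarrow> \<bar>x\<bar> \<le> \<bar>u\<bar> + \<bar>v\<bar> + e" for x u v e :: real
  by linarith

lemma abs_le3: "\<bar>x - (u + v + w)\<bar> \<le> e \<Longrightarrow> \<bar>x\<bar> \<le> \<bar>u\<bar> + \<bar>v\<bar> + \<bar>w\<bar> + e" for x u v w e :: real
  by linarith

lemma tame1_cubic:
  assumes "f \<in> borel_measurable borel"
    and "\<And>t. \<bar>f t\<bar> \<le> ka + kb * \<bar>t\<bar> + kc * \<bar>t\<bar> ^ 2 + kd * \<bar>t\<bar> ^ 3"
    and "0 \<le> ka" "0 \<le> kb" "0 \<le> kc" "0 \<le> kd"
  shows "tame1 f"
proof (rule tame1I[where K = "ka + kb + kc + kd" and m = 3])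
  fix t :: real
  let ?u = "1 + \<bar>t\<bar>"
  have u: "?u \<ge> 1" by simp
  have pw: "\<bar>t\<bar> ^ k \<le> ?u ^ 3" if "k \<le> 3" for k
    using power_mono[of "\<bar>t\<bar>" ?u k] power_increasing[OF that u] by simp
  have "\<bar>f t\<bar> \<le> ka * \<bar>t\<bar> ^ 0 + kb * \<bar>t\<bar> ^ 1 + kc * \<bar>t\<bar> ^ 2 + kd * \<bar>t\<bar> ^ 3"
    using assms(2)[of t] by simp
  also have "\<dots> \<le> ka * ?u ^ 3 + kb * ?u ^ 3 + kc * ?u ^ 3 + kd * ?u ^ 3"
    using assms(3-6) by (intro add_mono mult_left_mono pw) auto
  finally show "\<bar>f t\<bar> \<le> (ka + kb + kc + kd) * ?u ^ 3" by (simp add: distrib_right)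
qed fact

lemma tame1_p0: "tame1 (p 0)"
proof (rule tame1_cubic[where kd = "B / 6" and kc = "\<bar>p 2 0\<bar>" and kb = "\<bar>p 1 0\<bar>" and ka = "\<bar>p 0 0\<bar>"])
  fix t
  have a: "\<bar>p 2 0 * t\<^sup>2 / 2\<bar> \<le> \<bar>p 2 0\<bar> * \<bar>t\<bar>\<^sup>2" by (simp add: abs_mult)
  have b: "\<bar>p 1 0 * t\<bar> = \<bar>p 1 0\<bar> * \<bar>t\<bar>" by (simp add: abs_mult)
  have c: "\<bar>p 0 t - (p 0 0 + p 1 0 * t + p 2 0 * t\<^sup>2 / 2)\<bar> \<le> B / 6 * \<bar>t\<bar> ^ 3"
    using taylor_03[of 0 t] by simp
  show "\<bar>p 0 t\<bar> \<le> \<bar>p 0 0\<bar> + \<bar>p 1 0\<bar> * \<bar>t\<bar> + \<bar>p 2 0\<bar> * \<bar>t\<bar>\<^sup>2 + B / 6 * \<bar>t\<bar> ^ 3"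
    using abs_le3[OF c] a unfolding b by linarith
qed (use B_nonneg measurable_p in auto)

lemma tame1_p1: "tame1 (p 1)"
proof (rule tame1_cubic[where kd = 0 and kc = "B / 2" and kb = "\<bar>p 2 0\<bar>" and ka = "\<bar>p 1 0\<bar>"])
  fix t
  have b: "\<bar>p 2 0 * t\<bar> = \<bar>p 2 0\<bar> * \<bar>t\<bar>" by (simp add: abs_mult)
  show "\<bar>p 1 t\<bar> \<le> \<bar>p 1 0\<bar> + \<bar>p 2 0\<bar> * \<bar>t\<bar> + B / 2 * \<bar>t\<bar>\<^sup>2 + 0 * \<bar>t\<bar> ^ 3"
    using abs_le2[OF taylor_12[of 0 t]] b by simp
qed (use B_nonneg measurable_p in auto)

lemma tame1_p2: "tame1 (p 2)"
proof (rule tame1_cubic[where kd = 0 and kc = "B / 2" and kb = "\<bar>p 3 0\<bar>" and ka = "\<bar>p 2 0\<bar>"])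
  fix t
  have b: "\<bar>p 3 0 * t\<bar> = \<bar>p 3 0\<bar> * \<bar>t\<bar>" by (simp add: abs_mult)
  show "\<bar>p 2 t\<bar> \<le> \<bar>p 2 0\<bar> + \<bar>p 3 0\<bar> * \<bar>t\<bar> + B / 2 * \<bar>t\<bar>\<^sup>2 + 0 * \<bar>t\<bar> ^ 3"
    using abs_le2[OF taylor_22[of 0 t]] b by simp
qed (use B_nonneg measurable_p in auto)

lemma tame1_p3: "tame1 (p 3)"
  by (rule tame1I[where K = B and m = 0]) (use p_bound measurable_p in auto)

lemmas tame1_p = tame1_p0 tame1_p1 tame1_p2 tame1_p3

lemma dif1_p0: "dif1 (p 0) (p 1)"
proof -
  from tame1_p2 obtain K m where K: "K \<ge> 0" "\<And>t. \<bar>p 2 t\<bar> \<le> K * (1 + \<bar>t\<bar>) ^ m" by (rule tame1E) blast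
  have "\<bar>p 0 (s + t) - p 0 s - p 1 s * t\<bar> \<le> (K + B) * ((1 + \<bar>s\<bar>) * (1 + \<bar>t\<bar>)) ^ (m + 1) * t\<^sup>2" for s t
  proof -
    let ?u = "(1 + \<bar>s\<bar>) * (1 + \<bar>t\<bar>)"
    have u: "1 \<le> ?u" "1 + \<bar>s\<bar> \<le> ?u" "\<bar>t\<bar> \<le> ?u" by (auto simp: algebra_simps)
    have "\<bar>p 2 s\<bar> \<le> K * ?u ^ m"
      by (rule order_trans[OF K(2)], intro mult_left_mono power_mono) (use K u in auto)
    also have "\<dots> \<le> K * ?u ^ (m + 1)" using K(1) u by (intro mult_left_mono power_increasing) auto
    finally have a: "\<bar>p 2 s\<bar> * t\<^sup>2 \<le> K * ?u ^ (m + 1) * t\<^sup>2" by (rule mult_right_mono) simp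
    have "?u ^ 1 \<le> ?u ^ (m + 1)" using u by (intro power_increasing) auto
    then have "B * \<bar>t\<bar> \<le> B * ?u ^ (m + 1)" using B_nonneg u by (intro mult_left_mono) auto
    then have b: "B * \<bar>t\<bar> * t\<^sup>2 \<le> B * ?u ^ (m + 1) * t\<^sup>2" by (rule mult_right_mono) simp
    have b': "B / 6 * \<bar>t\<bar> ^ 3 \<le> B * \<bar>t\<bar> * t\<^sup>2"
    proof -
      have "0 \<le> B * \<bar>t\<bar> * t\<^sup>2" using B_nonneg by simp
      moreover have "B / 6 * \<bar>t\<bar> ^ 3 = B * \<bar>t\<bar> * t\<^sup>2 / 6"
        by (simp add: power3_eq_cube power2_eq_square mult.assoc)
      ultimately show ?thesis by linarith
    qed
    have c: "\<bar>p 2 s * t\<^sup>2 / 2\<bar> \<le> \<bar>p 2 s\<bar> * t\<^sup>2" by (simp add: abs_mult)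
    have "\<bar>p 0 (s + t) - p 0 s - p 1 s * t\<bar> \<le> \<bar>p 2 s * t\<^sup>2 / 2\<bar> + B / 6 * \<bar>t\<bar> ^ 3"
      using taylor_03[of s t] by linarith
    then show ?thesis using a b b' c unfolding distrib_right by linarith
  qed
  then show ?thesis unfolding dif1_def using K(1) B_nonneg by (intro exI[of _ "K + B"] conjI exI[of _ "m + 1"] allI) auto
qed

lemma dif1_p1: "dif1 (p 1) (p 2)"
  unfolding dif1_def using B_nonneg taylor_12
  by (intro exI[of _ "B / 2"] conjI exI[of _ 0] allI) (auto simp: algebra_simps)

lemma dif1_p2: "dif1 (p 2) (p 3)"
  unfolding dif1_def using B_nonneg taylor_22
  by (intro exI[of _ "B / 2"] conjI exI[of _ 0] allI) (auto simp: algebra_simps)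

lemma lip1_p3: "lip1 (p 3)"
  unfolding lip1_def using B_nonneg taylor_31
  by (intro exI[of _ B] conjI exI[of _ 0] allI) auto

lemmas lip1_p = lip1_of_dif1[OF dif1_p1 tame1_p2] lip1_of_dif1[OF dif1_p2 tame1_p3] lip1_p3

section \<open>Consequences of convexity\<close>

lemma convex_p0: "convex_on UNIV (p 0)"
proof (rule convex_onI)
  fix t x y :: real assume t: "0 < t" "t < 1"
  show "p 0 ((1 - t) *\<^sub>R x + t *\<^sub>R y) \<le> (1 - t) * p 0 x + t * p 0 y"
  proof (cases "x = y")
    case True
    then show ?thesis by (simp add: algebra_simps)
  next
    case False
    then show ?thesis
      using strict[unfolded strictly_convex_def, rule_format, OF False t] by (simp add: p_0)
  qed
qed simp

lemma tangent: "p 0 s + p 1 s * t \<le> p 0 (s + t)"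
  using convex_on_imp_above_tangent[OF convex_p0, of s "s + t" "p 1 s"] deriv_p[of 0 s]
  by (simp add: has_field_derivative_at_within)

lemma mono_p1: "0 \<le> (p 1 (s + t) - p 1 s) * t"
  using tangent[of s t] tangent[of "s + t" "- t"] by (simp add: algebra_simps)

lemma p1_mono: "s \<le> t \<Longrightarrow> p 1 s \<le> p 1 t"
  using mono_p1[of s "t - s"] by (cases "s = t") (auto simp: zero_le_mult_iff)

lemma p2_nonneg: "0 \<le> p 2 t"
proof (rule ccontr)
  assume "\<not> 0 \<le> p 2 t"
  then obtain e where e: "e > 0" "\<And>h. 0 < h \<Longrightarrow> h < e \<Longrightarrow> p 1 (t + h) < p 1 t"
    using DERIV_neg_dec_right[of "p 1" "p 2 t" t] deriv_p[of 1 t] by (auto simp: numeral_2_eq_2)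
  have "p 1 (t + e / 2) < p 1 t" by (rule e(2)) (use e(1) in auto)
  then show False using e(1) p1_mono[of t "t + e / 2"] by simp
qed

text \<open>Strict convexity on [1, 2] produces two mean-value points at which \<psi>' takes
  different values, hence a point between them where \<psi>'' is nonzero. The interval avoids 0,
  where the weight t^2 in \<open>a\<close> vanishes.\<close>

lemma p2_nonzero: "\<exists>t. t \<noteq> 0 \<and> p 2 t \<noteq> 0"
proof -
  have "\<exists>z. 1 < z \<and> z < 3/2 \<and> p 0 (3/2) - p 0 1 = (3/2 - 1) * p 1 z"
    using deriv_p[of 0] by (intro MVT2) auto
  then obtain z where z: "1 < z" "z < 3/2" "p 0 (3/2) - p 0 1 = 1/2 * p 1 z" by auto
  have "\<exists>z. 3/2 < z \<and> z < 2 \<and> p 0 2 - p 0 (3/2) = (2 - 3/2) * p 1 z"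
    using deriv_p[of 0] by (intro MVT2) auto
  then obtain z' where z': "3/2 < z'" "z' < 2" "p 0 2 - p 0 (3/2) = 1/2 * p 1 z'" by auto
  have "p 0 ((1 - 1/2) * 1 + 1/2 * 2) < (1 - 1/2) * p 0 1 + 1/2 * p 0 2"
    unfolding p_0 by (rule strict[unfolded strictly_convex_def, rule_format]) auto
  then have lt: "p 1 z < p 1 z'" using z(3) z'(3) by simp
  have "\<exists>y. z < y \<and> y < z' \<and> p 1 z' - p 1 z = (z' - z) * p 2 y"
    using deriv_p[of 1] z z' by (intro MVT2) (auto simp: numeral_2_eq_2)
  then obtain y where y: "z < y" "p 1 z' - p 1 z = (z' - z) * p 2 y" by auto
  then have "p 2 y \<noteq> 0" using lt by auto
  then show ?thesis using y(1) z(1) by (intro exI[of _ y]) auto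
qed

text \<open>The powers t^0 and t^1 are kept explicit so that the four constants match the right-hand
  sides of \<open>EG_dot\<close> literally.\<close>

definition a where "a = E1 (\<lambda>t. p 2 t * t ^ 2)"
definition b where "b = E1 (\<lambda>t. p 2 t * t ^ 0)"
definition al where "al = E1 (\<lambda>t. p 3 t * t ^ 3)"
definition be where "be = E1 (\<lambda>t. p 3 t * t ^ 1)"

lemma a_pos: "0 < a"
proof -
  obtain t0 where t0: "t0 \<noteq> 0" "p 2 t0 \<noteq> 0" using p2_nonzero by blast
  show ?thesis unfolding a_def
  proof (rule E1_pos)
    show "tame1 (\<lambda>t. p 2 t * t ^ 2)" by (rule tame1_mult_power[OF tame1_p2])
    show "continuous_on UNIV (\<lambda>t. p 2 t * t ^ 2)" by (intro continuous_intros continuous_p) simp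
    show "0 \<le> p 2 t * t ^ 2" for t using p2_nonneg by simp
    show "p 2 t0 * t0 ^ 2 \<noteq> 0" using t0 by simp
  qed
qed

lemma b_pos: "0 < b"
proof -
  obtain t0 where t0: "t0 \<noteq> 0" "p 2 t0 \<noteq> 0" using p2_nonzero by blast
  show ?thesis unfolding b_def
  proof (rule E1_pos)
    show "tame1 (\<lambda>t. p 2 t * t ^ 0)" by (rule tame1_mult_power[OF tame1_p2])
    show "continuous_on UNIV (\<lambda>t. p 2 t * t ^ 0)" by (intro continuous_intros continuous_p) simp
    show "0 \<le> p 2 t * t ^ 0" for t using p2_nonneg by simp
    show "p 2 t0 * t0 ^ 0 \<noteq> 0" using t0 by simp
  qed
qed

end

section \<open>Gaussian moments of linear forms\<close>

lemma (in coercive_potential) E_lin2: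
  "tame d f1 \<Longrightarrow> tame d f2 \<Longrightarrow> expect d W (\<lambda>x. c1 * f1 x + f2 x) = c1 * expect d W f1 + expect d W f2"
  by (subst E_add) (auto intro: tame_mult tame_const simp: E_cmult)

lemma (in coercive_potential) E_lin3:
  "tame d f1 \<Longrightarrow> tame d f2 \<Longrightarrow> tame d f3 \<Longrightarrow>
    expect d W (\<lambda>x. c1 * f1 x + (c2 * f2 x + f3 x)) = c1 * expect d W f1 + (c2 * expect d W f2 + expect d W f3)"
  by (subst E_lin2) (auto intro!: tame_add tame_mult tame_const simp: E_lin2)

lemma (in coercive_potential) E_lin4:
  "tame d f1 \<Longrightarrow> tame d f2 \<Longrightarrow> tame d f3 \<Longrightarrow> tame d f4 \<Longrightarrow>
    expect d W (\<lambda>x. c1 * f1 x + (c2 * f2 x + (c3 * f3 x + f4 x))) =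
    c1 * expect d W f1 + (c2 * expect d W f2 + (c3 * expect d W f3 + expect d W f4))"
  by (subst E_lin2) (auto intro!: tame_add tame_mult tame_const simp: E_lin3)

definition perp :: "nat \<Rightarrow> (nat \<Rightarrow> real) \<Rightarrow> (nat \<Rightarrow> real) \<Rightarrow> real" where
  "perp d z y = (\<Sum>i\<in>{1..<d}. y i * z i)"

definition rho2 :: "nat \<Rightarrow> (nat \<Rightarrow> real) \<Rightarrow> real" where
  "rho2 d y = (\<Sum>i\<in>{1..<d}. (y i)\<^sup>2)"

definition nrm2 :: "nat \<Rightarrow> (nat \<Rightarrow> real) \<Rightarrow> real" where
  "nrm2 d y = (\<Sum>i<d. (y i)\<^sup>2)"

lemma lessThan_split0: "1 \<le> d \<Longrightarrow> {..<d::nat} = insert 0 {1..<d}"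
  by auto

lemma sum_split0: "1 \<le> d \<Longrightarrow> (\<Sum>i<d. f i) = f 0 + (\<Sum>i\<in>{1..<d}. f i)" for d :: nat and f :: "nat \<Rightarrow> real"
  by (subst lessThan_split0) auto

lemma dot_split: "1 \<le> d \<Longrightarrow> dot d z y = z 0 * y 0 + perp d z y"
  by (simp add: dot_def perp_def sum_split0 mult.commute)

lemma nrm2_split: "1 \<le> d \<Longrightarrow> nrm2 d y = (y 0)\<^sup>2 + rho2 d y"
  by (simp add: nrm2_def rho2_def sum_split0)

lemma rho2_nonneg [simp]: "0 \<le> rho2 d y"
  by (simp add: rho2_def sum_nonneg)

lemma nrm2_nonneg [simp]: "0 \<le> nrm2 d y"
  by (simp add: nrm2_def sum_nonneg)

lemma rho2_le_nrm2: "1 \<le> d \<Longrightarrow> rho2 d y \<le> nrm2 d y"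
  by (simp add: nrm2_split)

lemma coord_sq_le_nrm2: "i < d \<Longrightarrow> (y i)\<^sup>2 \<le> nrm2 d y"
  unfolding nrm2_def by (rule member_le_sum) auto

lemma dot_first_unit: "1 \<le> d \<Longrightarrow> dot d z (first_unit d) = z 0"
  by (simp add: dot_split perp_def first_unit_def)

lemma nrm2_first_unit: "1 \<le> d \<Longrightarrow> nrm2 d (first_unit d) = 1"
  by (simp add: nrm2_split rho2_def first_unit_def)

lemma tame_perp [tame_intros]: "tame d (\<lambda>z. perp d z y)"
  unfolding perp_def by (intro tame_intros) auto

text \<open>The form \<open>perp\<close> does not involve z 0, so the recursion of
  \<open>EG_linear_moment\<close> applies with f (z 0) as the weight.\<close>

lemma EG_perp:
  assumes d: "1 \<le> d" and f: "tame1 f"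
  shows "EG d (\<lambda>z. f (z 0) * perp d z y ^ 1) = 0"
    and "EG d (\<lambda>z. f (z 0) * perp d z y ^ 2) = rho2 d y * E1 f"
    and "EG d (\<lambda>z. f (z 0) * perp d z y ^ 3) = 0"
proof -
  have t: "tame d (\<lambda>z. f (z 0))" using d by (intro tame_compose[OF f] tame_coord) auto
  have m: "EG d (\<lambda>z. f (z 0) * perp d z y ^ Suc k) = real k * rho2 d y * EG d (\<lambda>z. f (z 0) * perp d z y ^ (k - 1))" for k
    unfolding perp_def rho2_def by (rule EG_linear_moment) (auto intro: t)
  show 1: "EG d (\<lambda>z. f (z 0) * perp d z y ^ 1) = 0" using m[of 0] by simp
  have "EG d (\<lambda>z. f (z 0)) = E1 f" using d by (intro EG_marginal f) auto
  then show "EG d (\<lambda>z. f (z 0) * perp d z y ^ 2) = rho2 d y * E1 f" using m[of 1] by (simp add: numeral_2_eq_2)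
  show "EG d (\<lambda>z. f (z 0) * perp d z y ^ 3) = 0" using m[of 2] 1 by (simp add: numeral_3_eq_3 numeral_2_eq_2)
qed

lemma EG_dot_moments:
  shows "EG d (\<lambda>z. (dot d z y) ^ 2) = nrm2 d y" and "EG d (\<lambda>z. (dot d z y) ^ 4) = 3 * (nrm2 d y)\<^sup>2"
proof -
  have m: "EG d (\<lambda>z. 1 * dot d z y ^ Suc k) = real k * nrm2 d y * EG d (\<lambda>z. 1 * dot d z y ^ (k - 1))" for k
    unfolding dot_commute[of d _ y] unfolding dot_def nrm2_def
    by (rule EG_linear_moment) (auto intro: tame_intros)
  show 2: "EG d (\<lambda>z. (dot d z y) ^ 2) = nrm2 d y" using m[of 1] by (simp add: numeral_2_eq_2)
  show "EG d (\<lambda>z. (dot d z y) ^ 4) = 3 * (nrm2 d y)\<^sup>2"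
    using m[of 3] 2 by (simp add: eval_nat_numeral)
qed

lemma EG_perp_pow4: "1 \<le> d \<Longrightarrow> EG d (\<lambda>z. (perp d z y) ^ 4) = 3 * (rho2 d y)\<^sup>2"
proof -
  assume d: "1 \<le> d"
  have m: "EG d (\<lambda>z. 1 * perp d z y ^ Suc k) = real k * rho2 d y * EG d (\<lambda>z. 1 * perp d z y ^ (k - 1))" for k
    unfolding perp_def rho2_def by (rule EG_linear_moment) (auto intro: tame_intros)
  show ?thesis using m[of 3] m[of 1] by (simp add: eval_nat_numeral)
qed

text \<open>Binomial expansion of z . y = z_0 y_0 + perp, in which odd powers of perp average to
  zero. The third identity exhibits the shape of the cubic form: each term keeps a factor
  y_0.\<close>

lemma EG_dot:
  assumes d: "1 \<le> d" and f: "tame1 f"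
  shows "EG d (\<lambda>z. f (z 0) * dot d z y) = y 0 * E1 (\<lambda>t. f t * t ^ 1)"
    and "EG d (\<lambda>z. f (z 0) * (dot d z y)\<^sup>2) = (y 0)\<^sup>2 * E1 (\<lambda>t. f t * t ^ 2) + rho2 d y * E1 (\<lambda>t. f t * t ^ 0)"
    and "EG d (\<lambda>z. f (z 0) * (dot d z y) ^ 3) = (y 0) ^ 3 * E1 (\<lambda>t. f t * t ^ 3) + 3 * y 0 * rho2 d y * E1 (\<lambda>t. f t * t ^ 1)"
    and "EG d (\<lambda>z. f (z 0) * (dot d z y * perp d z y)) = rho2 d y * E1 (\<lambda>t. f t * t ^ 0)"
    and "EG d (\<lambda>z. f (z 0) * ((dot d z y)\<^sup>2 * perp d z y)) = 2 * y 0 * rho2 d y * E1 (\<lambda>t. f t * t ^ 1)"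
proof -
  let ?P = "\<lambda>z. perp d z y"
  have fj: "tame1 (\<lambda>t. f t * t ^ j)" for j by (rule tame1_mult_power[OF f])
  have t: "tame d (\<lambda>z. f (z 0) * z 0 ^ j * ?P z ^ k)" for j k
    using d by (intro tame_intros tame_compose[OF f]) auto
  have e0: "EG d (\<lambda>z. f (z 0) * z 0 ^ j * ?P z ^ 0) = E1 (\<lambda>t. f t * t ^ j)" for j
    using EG_marginal[OF _ fj, of 0 d j] d by simp
  note e = EG_perp[OF d fj]
  have "EG d (\<lambda>z. f (z 0) * dot d z y)
      = EG d (\<lambda>z. y 0 * (f (z 0) * z 0 ^ 1 * ?P z ^ 0) + f (z 0) * z 0 ^ 0 * ?P z ^ 1)"
    using d by (simp add: dot_split algebra_simps)
  also have "\<dots> = y 0 * EG d (\<lambda>z. f (z 0) * z 0 ^ 1 * ?P z ^ 0) + EG d (\<lambda>z. f (z 0) * z 0 ^ 0 * ?P z ^ 1)"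
    by (rule G.E_lin2[OF t t])
  finally show "EG d (\<lambda>z. f (z 0) * dot d z y) = y 0 * E1 (\<lambda>t. f t * t ^ 1)"
    unfolding e0 e by simp
  have "EG d (\<lambda>z. f (z 0) * (dot d z y)\<^sup>2)
      = EG d (\<lambda>z. (y 0)\<^sup>2 * (f (z 0) * z 0 ^ 2 * ?P z ^ 0) + (2 * y 0 * (f (z 0) * z 0 ^ 1 * ?P z ^ 1) + f (z 0) * z 0 ^ 0 * ?P z ^ 2))"
    using d by (simp add: dot_split algebra_simps power2_eq_square)
  also have "\<dots> = (y 0)\<^sup>2 * EG d (\<lambda>z. f (z 0) * z 0 ^ 2 * ?P z ^ 0) + (2 * y 0 * EG d (\<lambda>z. f (z 0) * z 0 ^ 1 * ?P z ^ 1)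
      + EG d (\<lambda>z. f (z 0) * z 0 ^ 0 * ?P z ^ 2))"
    by (rule G.E_lin3[OF t t t])
  finally show "EG d (\<lambda>z. f (z 0) * (dot d z y)\<^sup>2) = (y 0)\<^sup>2 * E1 (\<lambda>t. f t * t ^ 2) + rho2 d y * E1 (\<lambda>t. f t * t ^ 0)"
    unfolding e0 e by simp
  have "EG d (\<lambda>z. f (z 0) * (dot d z y) ^ 3)
      = EG d (\<lambda>z. (y 0) ^ 3 * (f (z 0) * z 0 ^ 3 * ?P z ^ 0) + (3 * (y 0)\<^sup>2 * (f (z 0) * z 0 ^ 2 * ?P z ^ 1)
        + (3 * y 0 * (f (z 0) * z 0 ^ 1 * ?P z ^ 2) + f (z 0) * z 0 ^ 0 * ?P z ^ 3)))"
    using d by (simp add: dot_split algebra_simps power2_eq_square power3_eq_cube)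
  also have "\<dots> = (y 0) ^ 3 * EG d (\<lambda>z. f (z 0) * z 0 ^ 3 * ?P z ^ 0) + (3 * (y 0)\<^sup>2 * EG d (\<lambda>z. f (z 0) * z 0 ^ 2 * ?P z ^ 1)
        + (3 * y 0 * EG d (\<lambda>z. f (z 0) * z 0 ^ 1 * ?P z ^ 2) + EG d (\<lambda>z. f (z 0) * z 0 ^ 0 * ?P z ^ 3)))"
    by (rule G.E_lin4[OF t t t t])
  finally show "EG d (\<lambda>z. f (z 0) * (dot d z y) ^ 3)
      = (y 0) ^ 3 * E1 (\<lambda>t. f t * t ^ 3) + 3 * y 0 * rho2 d y * E1 (\<lambda>t. f t * t ^ 1)"
    unfolding e0 e by simp
  have "EG d (\<lambda>z. f (z 0) * (dot d z y * ?P z))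
      = EG d (\<lambda>z. y 0 * (f (z 0) * z 0 ^ 1 * ?P z ^ 1) + f (z 0) * z 0 ^ 0 * ?P z ^ 2)"
    using d by (simp add: dot_split algebra_simps power2_eq_square)
  also have "\<dots> = y 0 * EG d (\<lambda>z. f (z 0) * z 0 ^ 1 * ?P z ^ 1) + EG d (\<lambda>z. f (z 0) * z 0 ^ 0 * ?P z ^ 2)"
    by (rule G.E_lin2[OF t t])
  finally show "EG d (\<lambda>z. f (z 0) * (dot d z y * perp d z y)) = rho2 d y * E1 (\<lambda>t. f t * t ^ 0)"
    unfolding e0 e by simp
  have "EG d (\<lambda>z. f (z 0) * ((dot d z y)\<^sup>2 * ?P z))
      = EG d (\<lambda>z. (y 0)\<^sup>2 * (f (z 0) * z 0 ^ 2 * ?P z ^ 1) + (2 * y 0 * (f (z 0) * z 0 ^ 1 * ?P z ^ 2) + f (z 0) * z 0 ^ 0 * ?P z ^ 3))"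
    using d by (simp add: dot_split algebra_simps power2_eq_square power3_eq_cube)
  also have "\<dots> = (y 0)\<^sup>2 * EG d (\<lambda>z. f (z 0) * z 0 ^ 2 * ?P z ^ 1) + (2 * y 0 * EG d (\<lambda>z. f (z 0) * z 0 ^ 1 * ?P z ^ 2)
      + EG d (\<lambda>z. f (z 0) * z 0 ^ 0 * ?P z ^ 3))"
    by (rule G.E_lin3[OF t t t])
  finally show "EG d (\<lambda>z. f (z 0) * ((dot d z y)\<^sup>2 * perp d z y)) = 2 * y 0 * rho2 d y * E1 (\<lambda>t. f t * t ^ 1)"
    unfolding e0 e by simp
qed

text \<open>This and the next two inequalities trade odd or mixed absolute moments for even ones,
  which are known exactly.\<close>

lemma young_3_1:
  fixes u w :: real
  assumes "0 \<le> u" "0 \<le> w"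
  shows "w * u ^ 3 \<le> w ^ 4 + u ^ 4"
proof (cases "w \<le> u")
  case True
  then have "w * u ^ 3 \<le> u * u ^ 3" using assms by (intro mult_right_mono) auto
  also have "u * u ^ 3 = u ^ 4" by (simp add: eval_nat_numeral)
  finally show ?thesis using zero_le_power[OF assms(2), of 4] by linarith
next
  case False
  then have "w * u ^ 3 \<le> w * w ^ 3" using assms by (intro mult_left_mono power_mono) auto
  also have "w * w ^ 3 = w ^ 4" by (simp add: eval_nat_numeral)
  finally show ?thesis using zero_le_power[OF assms(1), of 4] by linarith
qed

lemma young_2_1:
  fixes u w :: real
  assumes "0 \<le> u" "0 \<le> w"
  shows "w * u ^ 2 \<le> w ^ 2 + u ^ 4"
proof -
  have "0 \<le> (w - u\<^sup>2)\<^sup>2" by simp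
  then have "2 * (w * u\<^sup>2) \<le> w\<^sup>2 + u ^ 4" by (simp add: power2_diff algebra_simps flip: power_mult)
  moreover have "0 \<le> w * u\<^sup>2" using assms by simp
  ultimately show ?thesis by linarith
qed

lemma young_3:
  fixes u :: real
  assumes "0 \<le> u"
  shows "u ^ 3 \<le> u ^ 2 + u ^ 4"
proof -
  have "0 \<le> (u - u\<^sup>2)\<^sup>2" by simp
  then have "2 * u ^ 3 \<le> u\<^sup>2 + u ^ 4" by (simp add: power2_diff algebra_simps eval_nat_numeral)
  moreover have "0 \<le> u ^ 3" using assms by simp
  ultimately show ?thesis by linarith
qed

text \<open>After division by r the form has unit variance, fourth moment 3 and the Young
  inequalities apply; the constants are 4 = 1 + 3 and 6 = 3 + 3, independent of d. The case r = 0,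
  where the division fails, forces the form to vanish and is treated apart.\<close>

lemma EG_abs_moments:
  fixes y :: "nat \<Rightarrow> real"
  assumes d: "1 \<le> d"
  defines "r \<equiv> sqrt (nrm2 d y)"
  shows "EG d (\<lambda>z. \<bar>dot d z y\<bar> ^ 3) \<le> 4 * r ^ 3"
    and "EG d (\<lambda>z. \<bar>z 0\<bar> * (dot d z y)\<^sup>2) \<le> 4 * r\<^sup>2"
    and "EG d (\<lambda>z. \<bar>z 0\<bar> * \<bar>dot d z y\<bar> ^ 3) \<le> 6 * r ^ 3"
    and "EG d (\<lambda>z. \<bar>perp d z y\<bar> * \<bar>dot d z y\<bar> ^ 3) \<le> 6 * r ^ 4"
proof -
  let ?t = "\<lambda>z. dot d z y"
  have r0: "0 \<le> r" by (simp add: r_def)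
  have r2: "nrm2 d y = r\<^sup>2" by (simp add: r_def)
  have m2: "EG d (\<lambda>z. ?t z ^ 2) = r ^ 2" and m4: "EG d (\<lambda>z. ?t z ^ 4) = 3 * r ^ 4"
    by (simp_all add: EG_dot_moments r2 flip: power_mult)
  have z2: "EG d (\<lambda>z. z 0 ^ 2) = 1" and z4: "EG d (\<lambda>z. z 0 ^ 4) = 3"
    using EG_dot_moments[of d "first_unit d"] d by (simp_all add: dot_first_unit nrm2_first_unit)
  have lin: "EG d (\<lambda>z. k1 * f z + k2 * ?t z ^ m) = k1 * EG d f + k2 * EG d (\<lambda>z. ?t z ^ m)"
    if "tame d f" for f k1 k2 m
    by (subst G.E_add) (intro tame_intros that | simp only: G.E_cmult)+
  have d0: "0 < d" using d by simp
  show "EG d (\<lambda>z. \<bar>perp d z y\<bar> * \<bar>?t z\<bar> ^ 3) \<le> 6 * r ^ 4"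
  proof -
    have "EG d (\<lambda>z. \<bar>perp d z y\<bar> * \<bar>?t z\<bar> ^ 3) \<le> EG d (\<lambda>z. 1 * perp d z y ^ 4 + 1 * ?t z ^ 4)"
    proof (intro G.E_mono tame_intros)
      show "\<bar>perp d z y\<bar> * \<bar>?t z\<bar> ^ 3 \<le> 1 * perp d z y ^ 4 + 1 * ?t z ^ 4" for z
        using young_3_1[of "\<bar>?t z\<bar>" "\<bar>perp d z y\<bar>"] by simp
    qed
    also have "\<dots> = 3 * (rho2 d y)\<^sup>2 + 3 * r ^ 4"
      by (subst lin) (auto intro!: tame_intros simp: EG_perp_pow4[OF d] m4)
    also have "(rho2 d y)\<^sup>2 \<le> (r\<^sup>2)\<^sup>2"
      using rho2_le_nrm2[OF d, of y] r2 by (intro power_mono) auto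
    finally show ?thesis by (simp flip: power_mult)
  qed
  consider "r = 0" | "r > 0" using r0 by linarith
  then have "EG d (\<lambda>z. \<bar>?t z\<bar> ^ 3) \<le> 4 * r ^ 3 \<and> EG d (\<lambda>z. \<bar>z 0\<bar> * (?t z)\<^sup>2) \<le> 4 * r\<^sup>2
    \<and> EG d (\<lambda>z. \<bar>z 0\<bar> * \<bar>?t z\<bar> ^ 3) \<le> 6 * r ^ 3"
  proof cases
    case 1
    then have "(\<Sum>i<d. (y i)\<^sup>2) = 0" using r2 by (simp add: nrm2_def)
    then have "y i = 0" if "i < d" for i using that by (subst (asm) sum_nonneg_eq_0_iff) auto
    then have "?t z = 0" for z by (simp add: dot_def)
    then show ?thesis using 1 by simp
  next
    case 2
    have pw: "(\<bar>?t z\<bar> / r) ^ 4 = ?t z ^ 4 / r ^ 4" for z by (simp add: power_divide)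
    have "EG d (\<lambda>z. \<bar>?t z\<bar> ^ 3) \<le> EG d (\<lambda>z. r * ?t z ^ 2 + (1 / r) * ?t z ^ 4)"
    proof (intro G.E_mono tame_intros)
      fix z
      have "r ^ 3 * (\<bar>?t z\<bar> / r) ^ 3 \<le> r ^ 3 * ((\<bar>?t z\<bar> / r) ^ 2 + (\<bar>?t z\<bar> / r) ^ 4)"
        using 2 by (intro mult_left_mono young_3) auto
      then show "\<bar>?t z\<bar> ^ 3 \<le> r * ?t z ^ 2 + (1 / r) * ?t z ^ 4"
        using 2 unfolding pw by (simp add: power_divide distrib_left eval_nat_numeral)
    qed
    also have "\<dots> = r * r ^ 2 + (1 / r) * (3 * r ^ 4)"
      by (subst lin) (auto intro!: tame_intros simp: m2 m4)
    also have "\<dots> = 4 * r ^ 3" using 2 by (simp add: eval_nat_numeral)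
    finally have A: "EG d (\<lambda>z. \<bar>?t z\<bar> ^ 3) \<le> 4 * r ^ 3" .
    have "EG d (\<lambda>z. \<bar>z 0\<bar> * (?t z)\<^sup>2) \<le> EG d (\<lambda>z. r\<^sup>2 * z 0 ^ 2 + (1 / r\<^sup>2) * ?t z ^ 4)"
    proof (intro G.E_mono tame_intros d0)
      fix z :: "nat \<Rightarrow> real"
      have "r ^ 2 * (\<bar>z 0\<bar> * (\<bar>?t z\<bar> / r) ^ 2) \<le> r ^ 2 * (\<bar>z 0\<bar> ^ 2 + (\<bar>?t z\<bar> / r) ^ 4)"
        using 2 by (intro mult_left_mono young_2_1) auto
      then show "\<bar>z 0\<bar> * (?t z)\<^sup>2 \<le> r\<^sup>2 * z 0 ^ 2 + (1 / r\<^sup>2) * ?t z ^ 4"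
        using 2 unfolding pw by (simp add: power_divide distrib_left eval_nat_numeral)
    qed
    also have "\<dots> = r\<^sup>2 * 1 + (1 / r\<^sup>2) * (3 * r ^ 4)"
      by (subst lin) (auto intro!: tame_intros d0 simp: z2 m4)
    also have "\<dots> = 4 * r\<^sup>2" using 2 by (simp add: eval_nat_numeral)
    finally have C: "EG d (\<lambda>z. \<bar>z 0\<bar> * (?t z)\<^sup>2) \<le> 4 * r\<^sup>2" .
    have "EG d (\<lambda>z. \<bar>z 0\<bar> * \<bar>?t z\<bar> ^ 3) \<le> EG d (\<lambda>z. r ^ 3 * z 0 ^ 4 + (1 / r) * ?t z ^ 4)"
    proof (intro G.E_mono tame_intros d0)
      fix z :: "nat \<Rightarrow> real"
      have "r ^ 3 * (\<bar>z 0\<bar> * (\<bar>?t z\<bar> / r) ^ 3) \<le> r ^ 3 * (\<bar>z 0\<bar> ^ 4 + (\<bar>?t z\<bar> / r) ^ 4)"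
        using 2 by (intro mult_left_mono young_3_1) auto
      then show "\<bar>z 0\<bar> * \<bar>?t z\<bar> ^ 3 \<le> r ^ 3 * z 0 ^ 4 + (1 / r) * ?t z ^ 4"
        using 2 unfolding pw by (simp add: power_divide distrib_left eval_nat_numeral)
    qed
    also have "\<dots> = r ^ 3 * 3 + (1 / r) * (3 * r ^ 4)"
      by (subst lin) (auto intro!: tame_intros d0 simp: z4 m4)
    also have "\<dots> = 6 * r ^ 3" using 2 by (simp add: eval_nat_numeral)
    finally have D: "EG d (\<lambda>z. \<bar>z 0\<bar> * \<bar>?t z\<bar> ^ 3) \<le> 6 * r ^ 3" .
    from A C D show ?thesis by simp
  qed
  then show "EG d (\<lambda>z. \<bar>?t z\<bar> ^ 3) \<le> 4 * r ^ 3" "EG d (\<lambda>z. \<bar>z 0\<bar> * (?t z)\<^sup>2) \<le> 4 * r\<^sup>2"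
    "EG d (\<lambda>z. \<bar>z 0\<bar> * \<bar>?t z\<bar> ^ 3) \<le> 6 * r ^ 3" by auto
qed

section \<open>Dimension-free Taylor estimates\<close>

lemma (in coercive_potential) E_close:
  assumes "tame d f" "tame d g" "tame d h" "\<And>x. \<bar>f x - g x\<bar> \<le> h x"
  shows "\<bar>expect d W f - expect d W g\<bar> \<le> expect d W h"
  using E_abs_le[of "\<lambda>x. f x - g x" h] assms by (simp add: E_diff tame_diff)

text \<open>Here r0 = L/(2 (M + 1)) is the threshold of \<open>growth_bound\<close> between
  quadratic and linear growth, and the constant is L/2 times min 1 r0; adding 1 to M covers M =
  0.\<close>

definition growth_const :: "real \<Rightarrow> real \<Rightarrow> real" where
  "growth_const L M = L / 2 * min 1 (L / (2 * (M + 1)))"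

lemma growth_const_pos: "0 < L \<Longrightarrow> 0 \<le> M \<Longrightarrow> 0 < growth_const L M"
  by (simp add: growth_const_def)

text \<open>X is bounded below by an expansion at a fraction k of the displacement. For r \<le> r0
  take k = 1; beyond, k = r0/r freezes the displacement at length r0 and leaves linear growth in r.
  In both cases M r0 \<le> L/2 lets the leading term dominate the error.\<close>

lemma growth_bound:
  fixes L M r X :: real
  assumes L: "0 < L" and M: "0 \<le> M" and r: "0 \<le> r"
    and X: "\<And>k. 0 < k \<Longrightarrow> k \<le> 1 \<Longrightarrow> L * k * r\<^sup>2 - M * k\<^sup>2 * r ^ 3 \<le> X"
  shows "growth_const L M * min (r\<^sup>2) r \<le> X"
proof -
  define r0 where "r0 = L / (2 * (M + 1))"
  have r0: "0 < r0" "M * r0 \<le> L / 2"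
  proof -
    show "0 < r0" using L M by (simp add: r0_def)
    have "M * r0 = L / 2 * (M / (M + 1))" using M by (simp add: r0_def field_simps)
    also have "\<dots> \<le> L / 2 * 1" using L M by (intro mult_left_mono) auto
    finally show "M * r0 \<le> L / 2" by simp
  qed
  have g: "growth_const L M = L / 2 * min 1 r0" by (simp add: growth_const_def r0_def)
  show ?thesis
  proof (cases "r \<le> r0")
    case True
    have "growth_const L M * min (r\<^sup>2) r \<le> (L / 2 * 1) * r\<^sup>2"
      unfolding g using L r r0 by (intro mult_mono mult_left_mono) auto
    also have "\<dots> \<le> (L - M * r) * r\<^sup>2"
    proof (intro mult_right_mono)
      have "M * r \<le> M * r0" using True M by (intro mult_left_mono) auto
      then show "L / 2 * 1 \<le> L - M * r" using r0 by simp
    qed simp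
    also have "\<dots> = L * 1 * r\<^sup>2 - M * 1\<^sup>2 * r ^ 3" by (simp add: algebra_simps eval_nat_numeral)
    also have "\<dots> \<le> X" by (rule X) auto
    finally show ?thesis .
  next
    case False
    then have rp: "r > 0" using r0 by simp
    have "growth_const L M * min (r\<^sup>2) r \<le> (L / 2 * r0) * r"
      unfolding g using L r r0 by (intro mult_mono mult_left_mono) auto
    also have "\<dots> \<le> (L - M * r0) * r0 * r"
      using r0 r by (intro mult_right_mono) auto
    also have "\<dots> = L * (r0 / r) * r\<^sup>2 - M * (r0 / r)\<^sup>2 * r ^ 3"
      using rp by (simp add: field_simps eval_nat_numeral)
    also have "\<dots> \<le> X" using False r0 rp by (intro X) auto
    finally show ?thesis .
  qed
qed

locale smooth_convex_dim = smooth_convex +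
  fixes d :: nat
  assumes d1: "1 \<le> d"
begin

abbreviation "v \<equiv> v_fun \<psi> d"
abbreviation "e1 \<equiv> first_unit d"

definition ys :: "(nat \<Rightarrow> real) \<Rightarrow> nat \<Rightarrow> real" where
  "ys x = (\<lambda>i. x i - first_unit d i)"

text \<open>The partial derivatives of v, as \<open>pd_v\<close> shows; the subtracted value at e1
  comes from the linear term of v and makes e1 a critical point.\<close>

definition Dv :: "nat \<Rightarrow> (nat \<Rightarrow> real) \<Rightarrow> real" where
  "Dv i x = gauss_avg d (p 1) (\<lambda>z. z i) x - gauss_avg d (p 1) (\<lambda>z. z i) e1"

lemma d0: "0 < d" using d1 by simp

lemma tame_pz:
  assumes "k \<le> 3" "tame d g" shows "tame d (\<lambda>z. p k (g z))"
proof -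
  have "k = 0 \<or> k = 1 \<or> k = 2 \<or> k = 3" using assms(1) by auto
  then have "tame1 (p k)" using tame1_p by blast
  then show ?thesis by (rule tame_compose[OF _ assms(2)])
qed

lemma dot_e1: "dot d z e1 = z 0"
  by (rule dot_first_unit[OF d1])

lemma dot_ys: "dot d z x = z 0 + dot d z (ys x)"
proof -
  have "dot d z (ys x) = dot d z x - dot d z e1"
    by (simp add: dot_def ys_def right_diff_distrib sum_subtractf)
  then show ?thesis by (simp add: dot_e1)
qed

lemma integral_std: "f \<in> borel_measurable (leb d) \<Longrightarrow> (\<integral>z. f z \<partial>std_gaussian d) = EG d f"
  unfolding std_gaussian_gibbs by (rule integral_gibbs[OF coercive_gw])

lemma phi_PE: "phi \<psi> d = gauss_avg d (p 0) (\<lambda>_. 1)"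
proof
  fix x
  have "tame d (\<lambda>z. p 0 (dot d z x))" by (intro tame_pz tame_intros) auto
  then have "(\<integral>z. p 0 (dot d z x) \<partial>std_gaussian d) = gauss_avg d (p 0) (\<lambda>_. 1) x"
    unfolding gauss_avg_def mult_1_right by (simp only: integral_std[OF tame_measurable])
  then show "phi \<psi> d x = gauss_avg d (p 0) (\<lambda>_. 1) x"
    unfolding phi_def by (simp only: p_0)
qed

lemma pd_phi: "i < d \<Longrightarrow> pd i (gauss_avg d (p 0) (\<lambda>_. 1)) (gauss_avg d (p 1) (\<lambda>z. z i))"
  using pd_PE[of i d "p 0" "p 1" "\<lambda>_. 1"] tame1_p dif1_p0 lip1_p by (auto intro: tame_intros)

lemma v_eq: "v x = gauss_avg d (p 0) (\<lambda>_. 1) x - (\<Sum>i<d. gauss_avg d (p 1) (\<lambda>z. z i) e1 * x i)"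
proof -
  have "gradient d (phi \<psi> d) e1 i = gauss_avg d (p 1) (\<lambda>z. z i) e1" if "i < d" for i
    using that by (simp add: gradient_def phi_PE pd_partial[OF pd_phi])
  then show ?thesis by (simp add: v_fun_def phi_PE dot_def)
qed

lemma v_EG: "v x = EG d (\<lambda>z. p 0 (dot d z x)) - EG d (\<lambda>z. p 1 (z 0) * dot d z x)"
proof -
  have "(\<Sum>i<d. gauss_avg d (p 1) (\<lambda>z. z i) e1 * x i) = (\<Sum>i<d. EG d (\<lambda>z. x i * (p 1 (z 0) * z i)))"
    by (simp add: gauss_avg_def dot_e1 G.E_cmult mult.commute)
  also have "\<dots> = EG d (\<lambda>z. \<Sum>i<d. x i * (p 1 (z 0) * z i))"
    by (subst G.E_sum) (auto intro!: tame_mult tame_const tame_pz tame_coord d0)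
  also have "(\<lambda>z. \<Sum>i<d. x i * (p 1 (z 0) * z i)) = (\<lambda>z. p 1 (z 0) * dot d z x)"
    by (simp add: dot_def sum_distrib_left mult_ac)
  finally show ?thesis by (simp add: v_eq gauss_avg_def)
qed

lemma v_integral:
  "v x = (\<integral>z. \<psi> (dot d z x) \<partial>std_gaussian d) - (\<integral>z. deriv \<psi> (dot d z e1) * dot d z x \<partial>std_gaussian d)"
proof -
  have "tame d (\<lambda>z. p 0 (dot d z x))" "tame d (\<lambda>z. p 1 (dot d z e1) * dot d z x)"
    by (intro tame_mult tame_pz tame_dot; simp)+
  then have "v x = (\<integral>z. p 0 (dot d z x) \<partial>std_gaussian d) - (\<integral>z. p 1 (dot d z e1) * dot d z x \<partial>std_gaussian d)"
    unfolding v_EG dot_e1 by (simp only: integral_std[OF tame_measurable])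
  then show ?thesis by (simp only: p_0 p_1)
qed

lemma pd_v: "i < d \<Longrightarrow> pd i v (Dv i)"
proof -
  assume i: "i < d"
  let ?c = "\<lambda>j. gauss_avg d (p 1) (\<lambda>z. z j) e1"
  have "pd i (\<lambda>x. gauss_avg d (p 0) (\<lambda>_. 1) x - (\<Sum>j<d. ?c j * x j))
    (\<lambda>x. gauss_avg d (p 1) (\<lambda>z. z i) x - (\<Sum>j<d. ?c j * (if j = i then 1 else 0)))"
    by (intro pd_diff pd_sum pd_cmult pd_coord pd_phi i)
  moreover have "(\<Sum>j<d. ?c j * (if j = i then 1 else 0)) = ?c i"
    using i by (simp add: mult_delta_right sum.delta)
  ultimately show ?thesis by (simp add: v_eq[abs_def] Dv_def[abs_def])
qed

lemma tame_v: "tame d v"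
  unfolding v_eq[abs_def] by (intro tame_diff tame_sum tame_mult tame_const tame_coord tame_PE tame1_p) auto

lemma tame_Dv: "i < d \<Longrightarrow> tame d (Dv i)"
  unfolding Dv_def[abs_def] by (intro tame_diff tame_const tame_coord tame_PE tame1_p) auto

text \<open>The linear term of v turns the difference into the Gaussian average of the Bregman
  divergence of \<psi> between Z . e1 and Z . x. It is nonnegative pointwise, and \<psi> can be
  expanded under the expectation.\<close>

lemma v_bregman:
  "v x - v e1 = EG d (\<lambda>z. p 0 (z 0 + dot d z (ys x)) - p 0 (z 0) - p 1 (z 0) * dot d z (ys x))"
proof -
  have t: "tame d (\<lambda>z. p 0 (z 0 + dot d z (ys x)))" "tame d (\<lambda>z. p 0 (z 0))"
    "tame d (\<lambda>z. p 1 (z 0) * dot d z (ys x))" "tame d (\<lambda>z. p 1 (z 0) * z 0)"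
    by (intro tame_mult tame_pz tame_dot tame_add tame_coord d0; simp)+
  have "EG d (\<lambda>z. p 1 (z 0) * dot d z x) = EG d (\<lambda>z. p 1 (z 0) * z 0) + EG d (\<lambda>z. p 1 (z 0) * dot d z (ys x))"
    unfolding dot_ys[of _ x] distrib_left by (rule G.E_add[OF t(4,3)])
  then show ?thesis
    unfolding G.E_diff[OF tame_diff[OF t(1,2)] t(3)] G.E_diff[OF t(1,2)] v_EG
    by (simp add: dot_e1 dot_ys[of _ x])
qed

lemma Dv_EG:
  assumes i: "i < d"
  shows "Dv i x = EG d (\<lambda>z. (p 1 (z 0 + dot d z (ys x)) - p 1 (z 0)) * z i)"
proof -
  have t: "tame d (\<lambda>z. p 1 (z 0 + dot d z (ys x)) * z i)" "tame d (\<lambda>z. p 1 (z 0) * z i)"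
    by (intro tame_mult tame_pz tame_dot tame_add tame_coord d0 i; simp)+
  show ?thesis
    unfolding Dv_def gauss_avg_def left_diff_distrib G.E_diff[OF t] dot_e1 dot_ys[of _ x] ..
qed

lemma sum_Dv_EG:
  assumes J: "J \<subseteq> {..<d}"
  shows "(\<Sum>i\<in>J. Dv i x * y i) = EG d (\<lambda>z. (p 1 (z 0 + dot d z (ys x)) - p 1 (z 0)) * (\<Sum>i\<in>J. y i * z i))"
proof -
  let ?q = "\<lambda>z. p 1 (z 0 + dot d z (ys x)) - p 1 (z 0)"
  have "(\<Sum>i\<in>J. Dv i x * y i) = (\<Sum>i\<in>J. EG d (\<lambda>z. y i * (?q z * z i)))"
    using J by (intro sum.cong refl) (auto simp: Dv_EG G.E_cmult mult.commute)
  also have "\<dots> = EG d (\<lambda>z. \<Sum>i\<in>J. y i * (?q z * z i))"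
    using J by (subst G.E_sum) (auto intro!: tame_mult tame_diff tame_const tame_pz tame_coord tame_add tame_dot d0)
  also have "(\<lambda>z. \<Sum>i\<in>J. y i * (?q z * z i)) = (\<lambda>z. ?q z * (\<Sum>i\<in>J. y i * z i))"
    by (simp only: sum_distrib_left mult.left_commute)
  finally show ?thesis .
qed

abbreviation "rr x \<equiv> sqrt (nrm2 d (ys x))"

lemma rr_sq: "(rr x)\<^sup>2 = nrm2 d (ys x)"
  by simp

lemma rr_pow4: "(rr x) ^ 4 = (nrm2 d (ys x))\<^sup>2"
proof -
  have "(rr x) ^ 4 = ((rr x)\<^sup>2)\<^sup>2" by (simp only: power_mult[symmetric]) simp
  then show ?thesis by (simp only: rr_sq)
qed

lemmas tame_rules = tame_mult tame_diff tame_add tame_const tame_pz tame_coord tame_dot tame_perp tame_abs tame_power d0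
  tame_divide

text \<open>The pointwise remainder B/24 t^4 averages to B/8 |y|^4 because E t^4 = 3 |y|^4; no
  factor depending on d arises.\<close>

lemma v_taylor:
  "\<bar>v x - v e1 - (a * (ys x 0)\<^sup>2 + b * rho2 d (ys x)) / 2 - (al * (ys x 0) ^ 3 + 3 * be * ys x 0 * rho2 d (ys x)) / 6\<bar>
    \<le> B / 8 * (nrm2 d (ys x))\<^sup>2"
proof -
  let ?t = "\<lambda>z. dot d z (ys x)"
  have A: "\<bar>EG d (\<lambda>z. p 0 (z 0 + ?t z) - p 0 (z 0) - p 1 (z 0) * ?t z)
      - EG d (\<lambda>z. (1/2) * (p 2 (z 0) * (?t z)\<^sup>2) + (1/6) * (p 3 (z 0) * (?t z) ^ 3))\<bar>
    \<le> EG d (\<lambda>z. B / 24 * (?t z) ^ 4)"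
  proof (rule G.E_close)
    fix z
    show "\<bar>p 0 (z 0 + ?t z) - p 0 (z 0) - p 1 (z 0) * ?t z - ((1/2) * (p 2 (z 0) * (?t z)\<^sup>2) + (1/6) * (p 3 (z 0) * (?t z) ^ 3))\<bar>
      \<le> B / 24 * (?t z) ^ 4"
      using taylor_04[of "z 0" "?t z"] by (simp add: algebra_simps)
  qed (intro tame_rules; simp)+
  have Z: "EG d (\<lambda>z. B / 24 * (?t z) ^ 4) = B / 8 * (nrm2 d (ys x))\<^sup>2"
    unfolding G.E_cmult EG_dot_moments by simp
  have Y: "EG d (\<lambda>z. (1/2) * (p 2 (z 0) * (?t z)\<^sup>2) + (1/6) * (p 3 (z 0) * (?t z) ^ 3))
     = (1/2) * EG d (\<lambda>z. p 2 (z 0) * (?t z)\<^sup>2) + EG d (\<lambda>z. (1/6) * (p 3 (z 0) * (?t z) ^ 3))"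
    by (rule G.E_lin2; intro tame_rules; simp)
  have e: "V - (a * q + b * h) / 2 - (al * c + 3 * be * w * h) / 6
      = V - ((1/2) * (q * a + h * b) + (1/6) * (c * al + 3 * w * h * be))" for V q h c w :: real
    by (simp add: field_simps)
  have Y': "EG d (\<lambda>z. (1/2) * (p 2 (z 0) * (?t z)\<^sup>2) + (1/6) * (p 3 (z 0) * (?t z) ^ 3))
     = (1/2) * ((ys x 0)\<^sup>2 * a + rho2 d (ys x) * b) + (1/6) * ((ys x 0) ^ 3 * al + 3 * ys x 0 * rho2 d (ys x) * be)"
    unfolding Y G.E_cmult EG_dot[OF d1 tame1_p2] EG_dot[OF d1 tame1_p3] a_def b_def al_def be_def ..
  show ?thesis
    using A unfolding v_bregman Y' Z e .
qed

lemma E1_shift: "E1 (\<lambda>t. f t * t ^ j * t ^ k) = E1 (\<lambda>t. f t * t ^ (j + k))"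
  by (simp add: power_add mult.assoc)

text \<open>Linearisation of the first partial derivative, used as the assumption \<open>lin\<close>
  of \<open>laplace_model\<close>.\<close>

lemma Dv0_taylor1: "\<bar>Dv 0 x - a * ys x 0\<bar> \<le> 2 * B * nrm2 d (ys x)"
proof -
  let ?t = "\<lambda>z. dot d z (ys x)"
  have "\<bar>EG d (\<lambda>z. (p 1 (z 0 + ?t z) - p 1 (z 0)) * z 0) - EG d (\<lambda>z. (p 2 (z 0) * z 0 ^ 1) * ?t z)\<bar>
    \<le> EG d (\<lambda>z. B / 2 * (\<bar>z 0\<bar> * (?t z)\<^sup>2))"
  proof (rule G.E_close)
    fix z :: "nat \<Rightarrow> real"
    have "\<bar>p 1 (z 0 + ?t z) - (p 1 (z 0) + p 2 (z 0) * ?t z)\<bar> * \<bar>z 0\<bar> \<le> (B / 2 * (?t z)\<^sup>2) * \<bar>z 0\<bar>"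
      by (intro mult_right_mono taylor_12) auto
    then show "\<bar>(p 1 (z 0 + ?t z) - p 1 (z 0)) * z 0 - (p 2 (z 0) * z 0 ^ 1) * ?t z\<bar> \<le> B / 2 * (\<bar>z 0\<bar> * (?t z)\<^sup>2)"
      unfolding abs_mult[symmetric] by (simp add: algebra_simps)
  qed (intro tame_rules; simp)+
  moreover have "EG d (\<lambda>z. B / 2 * (\<bar>z 0\<bar> * (?t z)\<^sup>2)) \<le> B / 2 * (4 * (rr x)\<^sup>2)"
    unfolding G.E_cmult using B_nonneg EG_abs_moments(2)[OF d1, of "ys x"] by (intro mult_left_mono) auto
  ultimately show ?thesis
    unfolding Dv_EG[OF d0] EG_dot[OF d1 tame1_mult_power[OF tame1_p2]] E1_shift one_add_one a_def[symmetric]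
    by (simp add: mult.commute)
qed

text \<open>The quadratic part is the y_0-derivative of the cubic term in \<open>v_taylor\<close>;
  averaged under \<pi> it determines the mean.\<close>

lemma Dv0_taylor2:
  "\<bar>Dv 0 x - a * ys x 0 - (al * (ys x 0)\<^sup>2 + be * rho2 d (ys x)) / 2\<bar> \<le> B * (rr x) ^ 3"
proof -
  let ?t = "\<lambda>z. dot d z (ys x)"
  have "\<bar>EG d (\<lambda>z. (p 1 (z 0 + ?t z) - p 1 (z 0)) * z 0)
      - EG d (\<lambda>z. (1/2) * ((p 3 (z 0) * z 0 ^ 1) * (?t z)\<^sup>2) + (p 2 (z 0) * z 0 ^ 1) * ?t z)\<bar>
    \<le> EG d (\<lambda>z. B / 6 * (\<bar>z 0\<bar> * \<bar>?t z\<bar> ^ 3))"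
  proof (rule G.E_close)
    fix z :: "nat \<Rightarrow> real"
    have "\<bar>p 1 (z 0 + ?t z) - (p 1 (z 0) + p 2 (z 0) * ?t z + p 3 (z 0) * (?t z)\<^sup>2 / 2)\<bar> * \<bar>z 0\<bar> \<le> (B / 6 * \<bar>?t z\<bar> ^ 3) * \<bar>z 0\<bar>"
      by (intro mult_right_mono taylor_13) auto
    moreover have "(p 1 (z 0 + ?t z) - p 1 (z 0)) * z 0 - ((1/2) * ((p 3 (z 0) * z 0 ^ 1) * (?t z)\<^sup>2) + (p 2 (z 0) * z 0 ^ 1) * ?t z)
      = (p 1 (z 0 + ?t z) - (p 1 (z 0) + p 2 (z 0) * ?t z + p 3 (z 0) * (?t z)\<^sup>2 / 2)) * z 0"
      by (simp add: algebra_simps)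
    ultimately show "\<bar>(p 1 (z 0 + ?t z) - p 1 (z 0)) * z 0 - ((1/2) * ((p 3 (z 0) * z 0 ^ 1) * (?t z)\<^sup>2) + (p 2 (z 0) * z 0 ^ 1) * ?t z)\<bar>
      \<le> B / 6 * (\<bar>z 0\<bar> * \<bar>?t z\<bar> ^ 3)"
      by (simp only: abs_mult mult_ac)
  qed (intro tame_rules; simp)+
  moreover have "EG d (\<lambda>z. B / 6 * (\<bar>z 0\<bar> * \<bar>?t z\<bar> ^ 3)) \<le> B / 6 * (6 * (rr x) ^ 3)"
    unfolding G.E_cmult using B_nonneg EG_abs_moments(3)[OF d1, of "ys x"] by (intro mult_left_mono) auto
  moreover have "EG d (\<lambda>z. (1/2) * ((p 3 (z 0) * z 0 ^ 1) * (?t z)\<^sup>2) + (p 2 (z 0) * z 0 ^ 1) * ?t z)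
    = (1/2) * EG d (\<lambda>z. (p 3 (z 0) * z 0 ^ 1) * (?t z)\<^sup>2) + EG d (\<lambda>z. (p 2 (z 0) * z 0 ^ 1) * ?t z)"
    by (rule G.E_lin2; intro tame_rules; simp)
  moreover have "\<dots> = a * ys x 0 + (al * (ys x 0)\<^sup>2 + be * rho2 d (ys x)) / 2"
    unfolding EG_dot[OF d1 tame1_mult_power[OF tame1_p2]] EG_dot[OF d1 tame1_mult_power[OF tame1_p3]] E1_shift
    by (simp add: a_def al_def be_def one_add_one algebra_simps eval_nat_numeral)
  ultimately show ?thesis
    unfolding Dv_EG[OF d0] by (simp add: algebra_simps)
qed

text \<open>The pairing of the gradient with y over all coordinates but the first is a single
  Gaussian expectation with weight perp. Expanding it at once keeps the error at B |y|^4, whereas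
  errors of d - 1 separate expansions would add up.\<close>

lemma Dperp_taylor:
  "\<bar>(\<Sum>i\<in>{1..<d}. Dv i x * ys x i) - b * rho2 d (ys x) - be * ys x 0 * rho2 d (ys x)\<bar> \<le> B * (nrm2 d (ys x))\<^sup>2"
proof -
  let ?t = "\<lambda>z. dot d z (ys x)" and ?w = "\<lambda>z. perp d z (ys x)"
  have "\<bar>EG d (\<lambda>z. (p 1 (z 0 + ?t z) - p 1 (z 0)) * ?w z)
      - EG d (\<lambda>z. (1/2) * (p 3 (z 0) * ((?t z)\<^sup>2 * ?w z)) + p 2 (z 0) * (?t z * ?w z))\<bar>
    \<le> EG d (\<lambda>z. B / 6 * (\<bar>?w z\<bar> * \<bar>?t z\<bar> ^ 3))"
  proof (rule G.E_close)
    fix z :: "nat \<Rightarrow> real"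
    have "\<bar>p 1 (z 0 + ?t z) - (p 1 (z 0) + p 2 (z 0) * ?t z + p 3 (z 0) * (?t z)\<^sup>2 / 2)\<bar> * \<bar>?w z\<bar> \<le> (B / 6 * \<bar>?t z\<bar> ^ 3) * \<bar>?w z\<bar>"
      by (intro mult_right_mono taylor_13) auto
    moreover have "(p 1 (z 0 + ?t z) - p 1 (z 0)) * ?w z - ((1/2) * (p 3 (z 0) * ((?t z)\<^sup>2 * ?w z)) + p 2 (z 0) * (?t z * ?w z))
      = (p 1 (z 0 + ?t z) - (p 1 (z 0) + p 2 (z 0) * ?t z + p 3 (z 0) * (?t z)\<^sup>2 / 2)) * ?w z"
      by (simp add: algebra_simps)
    ultimately show "\<bar>(p 1 (z 0 + ?t z) - p 1 (z 0)) * ?w z - ((1/2) * (p 3 (z 0) * ((?t z)\<^sup>2 * ?w z)) + p 2 (z 0) * (?t z * ?w z))\<bar>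
      \<le> B / 6 * (\<bar>?w z\<bar> * \<bar>?t z\<bar> ^ 3)"
      by (simp only: abs_mult mult_ac)
  qed (intro tame_rules; simp)+
  moreover have "EG d (\<lambda>z. B / 6 * (\<bar>?w z\<bar> * \<bar>?t z\<bar> ^ 3)) \<le> B / 6 * (6 * (rr x) ^ 4)"
    unfolding G.E_cmult using B_nonneg EG_abs_moments(4)[OF d1, of "ys x"] by (intro mult_left_mono) auto
  moreover have "EG d (\<lambda>z. (1/2) * (p 3 (z 0) * ((?t z)\<^sup>2 * ?w z)) + p 2 (z 0) * (?t z * ?w z))
    = (1/2) * EG d (\<lambda>z. p 3 (z 0) * ((?t z)\<^sup>2 * ?w z)) + EG d (\<lambda>z. p 2 (z 0) * (?t z * ?w z))"
    by (rule G.E_lin2; intro tame_rules; simp)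
  moreover have "\<dots> = b * rho2 d (ys x) + be * ys x 0 * rho2 d (ys x)"
    unfolding EG_dot[OF d1 tame1_p2] EG_dot[OF d1 tame1_p3]
    by (simp add: b_def be_def algebra_simps)
  moreover have "(\<Sum>i\<in>{1..<d}. Dv i x * ys x i) = EG d (\<lambda>z. (p 1 (z 0 + ?t z) - p 1 (z 0)) * ?w z)"
    unfolding perp_def by (rule sum_Dv_EG) auto
  ultimately show ?thesis
    by (simp add: algebra_simps rr_pow4)
qed

definition lam where "lam = min a b"

lemma lam_pos: "0 < lam"
  using a_pos b_pos by (simp add: lam_def)

lemma lam_le: "lam * nrm2 d y \<le> a * (y 0)\<^sup>2 + b * rho2 d y"
proof -
  have "lam * (y 0)\<^sup>2 \<le> a * (y 0)\<^sup>2" "lam * rho2 d y \<le> b * rho2 d y"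
    by (auto simp: lam_def intro!: mult_right_mono)
  then show ?thesis by (simp add: nrm2_split[OF d1] distrib_left)
qed

lemma EG_p2_dot2: "EG d (\<lambda>z. p 2 (z 0) * (dot d z y)\<^sup>2) = a * (y 0)\<^sup>2 + b * rho2 d y"
  by (simp add: EG_dot[OF d1 tame1_p2] a_def b_def algebra_simps)

text \<open>Monotonicity of \<psi>' bounds its increment over t from below, in direction t, by the
  increment over k t, which is expanded to first order. The error then carries k^2, and
  \<open>growth_bound\<close> chooses k. The constant 2 B is B/2 times the third absolute moment
  constant 4.\<close>

lemma Dv_growth:
  "growth_const lam (2 * B) * min (nrm2 d (ys x)) (rr x) \<le> (\<Sum>i<d. Dv i x * ys x i)"
proof -
  let ?t = "\<lambda>z. dot d z (ys x)"
  have eq: "(\<Sum>i<d. Dv i x * ys x i) = EG d (\<lambda>z. (p 1 (z 0 + ?t z) - p 1 (z 0)) * ?t z)"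
    by (subst sum_Dv_EG) (auto simp: dot_def mult.commute)
  have "growth_const lam (2 * B) * min ((rr x)\<^sup>2) (rr x) \<le> (\<Sum>i<d. Dv i x * ys x i)"
  proof (rule growth_bound)
    fix k :: real assume k: "0 < k" "k \<le> 1"
    have "EG d (\<lambda>z. k * (p 2 (z 0) * (?t z)\<^sup>2) + (- (B / 2 * k\<^sup>2)) * \<bar>?t z\<bar> ^ 3)
      \<le> EG d (\<lambda>z. (p 1 (z 0 + ?t z) - p 1 (z 0)) * ?t z)"
    proof (rule G.E_mono)
      fix z :: "nat \<Rightarrow> real"
      have "0 \<le> (p 1 (z 0 + ?t z) - p 1 (z 0 + k * ?t z)) * ?t z"
      proof (cases "k = 1")
        case False
        have "0 \<le> (p 1 ((z 0 + k * ?t z) + (1 - k) * ?t z) - p 1 (z 0 + k * ?t z)) * ((1 - k) * ?t z)"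
          by (rule mono_p1)
        also have "\<dots> = (1 - k) * ((p 1 (z 0 + ?t z) - p 1 (z 0 + k * ?t z)) * ?t z)"
          by (simp add: algebra_simps)
        finally show ?thesis using False k by (simp add: zero_le_mult_iff)
      qed simp
      moreover have "\<bar>p 1 (z 0 + k * ?t z) - (p 1 (z 0) + p 2 (z 0) * (k * ?t z))\<bar> * \<bar>?t z\<bar> \<le> (B / 2 * (k * ?t z)\<^sup>2) * \<bar>?t z\<bar>"
        by (intro mult_right_mono taylor_12) auto
      then have "\<bar>(p 1 (z 0 + k * ?t z) - (p 1 (z 0) + p 2 (z 0) * (k * ?t z))) * ?t z\<bar> \<le> B / 2 * k\<^sup>2 * \<bar>?t z\<bar> ^ 3"
        unfolding abs_mult by (simp add: power_mult_distrib power3_eq_cube power2_eq_square mult_ac)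
      then have "- (B / 2 * k\<^sup>2 * \<bar>?t z\<bar> ^ 3) \<le> (p 1 (z 0 + k * ?t z) - (p 1 (z 0) + p 2 (z 0) * (k * ?t z))) * ?t z"
        by linarith
      moreover have "(p 1 (z 0 + k * ?t z) - (p 1 (z 0) + p 2 (z 0) * (k * ?t z))) * ?t z
          = (p 1 (z 0 + k * ?t z) - p 1 (z 0)) * ?t z - k * (p 2 (z 0) * (?t z)\<^sup>2)"
        by (simp add: algebra_simps power2_eq_square)
      ultimately show "k * (p 2 (z 0) * (?t z)\<^sup>2) + (- (B / 2 * k\<^sup>2)) * \<bar>?t z\<bar> ^ 3 \<le> (p 1 (z 0 + ?t z) - p 1 (z 0)) * ?t z"
        unfolding left_diff_distrib by simp
    qed (intro tame_rules; simp)+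
    moreover have "EG d (\<lambda>z. k * (p 2 (z 0) * (?t z)\<^sup>2) + (- (B / 2 * k\<^sup>2)) * \<bar>?t z\<bar> ^ 3)
      = k * EG d (\<lambda>z. p 2 (z 0) * (?t z)\<^sup>2) + (- (B / 2 * k\<^sup>2)) * EG d (\<lambda>z. \<bar>?t z\<bar> ^ 3)"
      by (subst G.E_lin2) (intro tame_rules; simp; fail | simp only: G.E_cmult)+
    moreover have "B / 2 * k\<^sup>2 * EG d (\<lambda>z. \<bar>?t z\<bar> ^ 3) \<le> B / 2 * k\<^sup>2 * (4 * (rr x) ^ 3)"
      using B_nonneg EG_abs_moments(1)[OF d1, of "ys x"] by (intro mult_left_mono) auto
    moreover have "k * (lam * (rr x)\<^sup>2) \<le> k * EG d (\<lambda>z. p 2 (z 0) * (?t z)\<^sup>2)"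
      unfolding EG_p2_dot2 rr_sq using k lam_le by (intro mult_left_mono) auto
    ultimately show "lam * k * (rr x)\<^sup>2 - 2 * B * k\<^sup>2 * (rr x) ^ 3 \<le> (\<Sum>i<d. Dv i x * ys x i)"
      unfolding eq by (simp add: algebra_simps)
  qed (use lam_pos B_nonneg in auto)
  then show ?thesis by simp
qed

text \<open>The same device with convexity in place of monotonicity: the value at k t is compared
  with the chord and the inequality is divided by k, leaving B/6 times 4 = 2 B/3. This gives the
  strict minimum and the coercivity of V, while \<open>Dv_growth\<close> drives the moments.\<close>

lemma v_growth:
  "growth_const (lam / 2) (2 * B / 3) * min (nrm2 d (ys x)) (rr x) \<le> v x - v e1"
proof -
  let ?t = "\<lambda>z. dot d z (ys x)"
  have "growth_const (lam / 2) (2 * B / 3) * min ((rr x)\<^sup>2) (rr x) \<le> v x - v e1"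
  proof (rule growth_bound)
    fix k :: real assume k: "0 < k" "k \<le> 1"
    have "EG d (\<lambda>z. (k / 2) * (p 2 (z 0) * (?t z)\<^sup>2) + (- (B / 6 * k\<^sup>2)) * \<bar>?t z\<bar> ^ 3)
      \<le> EG d (\<lambda>z. p 0 (z 0 + ?t z) - p 0 (z 0) - p 1 (z 0) * ?t z)"
    proof (rule G.E_mono)
      fix z :: "nat \<Rightarrow> real"
      have "p 0 ((1 - k) *\<^sub>R z 0 + k *\<^sub>R (z 0 + ?t z)) \<le> (1 - k) * p 0 (z 0) + k * p 0 (z 0 + ?t z)"
        using k by (intro convex_onD[OF convex_p0]) auto
      then have c: "p 0 (z 0 + k * ?t z) - p 0 (z 0) \<le> k * (p 0 (z 0 + ?t z) - p 0 (z 0))"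
        by (simp add: algebra_simps)
      have "\<bar>p 0 (z 0 + k * ?t z) - (p 0 (z 0) + p 1 (z 0) * (k * ?t z) + p 2 (z 0) * (k * ?t z)\<^sup>2 / 2)\<bar> \<le> B / 6 * \<bar>k * ?t z\<bar> ^ 3"
        by (rule taylor_03)
      moreover have "B / 6 * \<bar>k * ?t z\<bar> ^ 3 = k * (B / 6 * k\<^sup>2 * \<bar>?t z\<bar> ^ 3)"
        using k by (simp add: abs_mult power_mult_distrib power3_eq_cube power2_eq_square)
      moreover have "p 1 (z 0) * (k * ?t z) + p 2 (z 0) * (k * ?t z)\<^sup>2 / 2 = k * (p 1 (z 0) * ?t z + (k / 2) * (p 2 (z 0) * (?t z)\<^sup>2))"
        by (simp add: algebra_simps power2_eq_square)
      ultimately have "k * (p 1 (z 0) * ?t z + (k / 2) * (p 2 (z 0) * (?t z)\<^sup>2)) - k * (B / 6 * k\<^sup>2 * \<bar>?t z\<bar> ^ 3)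
          \<le> k * (p 0 (z 0 + ?t z) - p 0 (z 0))"
        using c by linarith
      then have "k * (p 1 (z 0) * ?t z + (k / 2) * (p 2 (z 0) * (?t z)\<^sup>2) - (B / 6 * k\<^sup>2 * \<bar>?t z\<bar> ^ 3))
          \<le> k * (p 0 (z 0 + ?t z) - p 0 (z 0))" by (simp only: right_diff_distrib)
      then have "p 1 (z 0) * ?t z + (k / 2) * (p 2 (z 0) * (?t z)\<^sup>2) - (B / 6 * k\<^sup>2 * \<bar>?t z\<bar> ^ 3)
          \<le> p 0 (z 0 + ?t z) - p 0 (z 0)" using k by (simp only: mult_le_cancel_left_pos)
      then show "(k / 2) * (p 2 (z 0) * (?t z)\<^sup>2) + (- (B / 6 * k\<^sup>2)) * \<bar>?t z\<bar> ^ 3 \<le> p 0 (z 0 + ?t z) - p 0 (z 0) - p 1 (z 0) * ?t z"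
        by simp
    qed (intro tame_rules; simp)+
    moreover have "EG d (\<lambda>z. (k / 2) * (p 2 (z 0) * (?t z)\<^sup>2) + (- (B / 6 * k\<^sup>2)) * \<bar>?t z\<bar> ^ 3)
      = (k / 2) * EG d (\<lambda>z. p 2 (z 0) * (?t z)\<^sup>2) + (- (B / 6 * k\<^sup>2)) * EG d (\<lambda>z. \<bar>?t z\<bar> ^ 3)"
      by (subst G.E_lin2) (intro tame_rules; simp; fail | simp only: G.E_cmult)+
    moreover have "B / 6 * k\<^sup>2 * EG d (\<lambda>z. \<bar>?t z\<bar> ^ 3) \<le> B / 6 * k\<^sup>2 * (4 * (rr x) ^ 3)"
      using B_nonneg EG_abs_moments(1)[OF d1, of "ys x"] by (intro mult_left_mono) auto
    moreover have "(k / 2) * (lam * (rr x)\<^sup>2) \<le> (k / 2) * EG d (\<lambda>z. p 2 (z 0) * (?t z)\<^sup>2)"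
      unfolding EG_p2_dot2 rr_sq using k lam_le by (intro mult_left_mono) auto
    ultimately show "lam / 2 * k * (rr x)\<^sup>2 - 2 * B / 3 * k\<^sup>2 * (rr x) ^ 3 \<le> v x - v e1"
      unfolding v_bregman by (simp add: algebra_simps)
  qed (use lam_pos B_nonneg in auto)
  then show ?thesis by simp
qed

lemma v_strict_min:
  assumes "x \<in> Rd d" "x \<noteq> e1"
  shows "v e1 < v x"
proof -
  have "\<exists>i<d. x i \<noteq> e1 i"
  proof (rule ccontr)
    assume "\<not> (\<exists>i<d. x i \<noteq> e1 i)"
    then have "x = e1" using assms(1) by (auto simp: Rd_def first_unit_def PiE_def extensional_def)
    with assms(2) show False by simp
  qed
  then obtain i where i: "i < d" "ys x i \<noteq> 0" by (auto simp: ys_def)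
  then have "0 < (ys x i)\<^sup>2" by simp
  then have n: "0 < nrm2 d (ys x)" using coord_sq_le_nrm2[OF i(1), of "ys x"] by linarith
  then have "0 < growth_const (lam / 2) (2 * B / 3) * min (nrm2 d (ys x)) (rr x)"
    using growth_const_pos[of "lam / 2" "2 * B / 3"] lam_pos B_nonneg by simp
  then show ?thesis using v_growth[of x] by linarith
qed

end

section \<open>Derivatives at the minimizer\<close>

lemma EG_coord:
  assumes j: "j < d" and g: "tame d g" and ind: "\<And>x t. g (x(j := t)) = g x"
  shows "EG d (\<lambda>z. g z * z j) = 0" "EG d (\<lambda>z. g z * (z j)\<^sup>2) = EG d g" "EG d (\<lambda>z. g z * z j ^ 3) = 0"
proof -
  have m: "EG d (\<lambda>z. g z * z j ^ Suc k) = real k * EG d (\<lambda>z. g z * z j ^ (k - 1))" for k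
    using EG_linear_moment[of "{j}" d g "\<lambda>_. 1" k] j g ind by simp
  show 1: "EG d (\<lambda>z. g z * z j) = 0" using m[of 0] by simp
  show "EG d (\<lambda>z. g z * (z j)\<^sup>2) = EG d g" using m[of 1] by (simp add: numeral_2_eq_2)
  show "EG d (\<lambda>z. g z * z j ^ 3) = 0" using m[of 2] 1 by (simp add: eval_nat_numeral)
qed

lemma coercive_quadratic:
  assumes s0: "0 < s0" "\<And>i. i < d \<Longrightarrow> s0 \<le> s i"
  shows "coercive d (\<lambda>x. \<Sum>i<d. s i * (x i - m i)\<^sup>2 / 2)"
  unfolding coercive_def
proof
  have "tame d (\<lambda>x. \<Sum>i<d. s i * (x i - m i)\<^sup>2 / 2)"
    by (intro tame_intros) auto
  then show "(\<lambda>x. \<Sum>i<d. s i * (x i - m i)\<^sup>2 / 2) \<in> borel_measurable (leb d)" by (rule tame_measurable)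
  have "s0 * l1_norm d x - (\<Sum>i<d. s0 * (\<bar>m i\<bar> + 1)) \<le> (\<Sum>i<d. s i * (x i - m i)\<^sup>2 / 2)" for x
  proof -
    have "s0 * l1_norm d x - (\<Sum>i<d. s0 * (\<bar>m i\<bar> + 1)) = (\<Sum>i<d. s0 * (\<bar>x i\<bar> - \<bar>m i\<bar> - 1))"
      by (simp add: l1_norm_def sum_distrib_left algebra_simps flip: sum_subtractf sum.distrib)
    also have "\<dots> \<le> (\<Sum>i<d. s i * (x i - m i)\<^sup>2 / 2)"
    proof (rule sum_mono)
      fix i assume "i \<in> {..<d}"
      then have i: "s0 \<le> s i" using s0 by simp
      have "0 \<le> (\<bar>x i - m i\<bar> - 1)\<^sup>2" by simp
      then have "\<bar>x i - m i\<bar> - 1 \<le> (x i - m i)\<^sup>2 / 2" by (simp add: power2_diff)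
      moreover have "\<bar>x i\<bar> - \<bar>m i\<bar> \<le> \<bar>x i - m i\<bar>" by linarith
      ultimately have "\<bar>x i\<bar> - \<bar>m i\<bar> - 1 \<le> (x i - m i)\<^sup>2 / 2" by linarith
      then have "s0 * (\<bar>x i\<bar> - \<bar>m i\<bar> - 1) \<le> s0 * ((x i - m i)\<^sup>2 / 2)" using s0 by (intro mult_left_mono) auto
      also have "\<dots> \<le> s i * ((x i - m i)\<^sup>2 / 2)" using i by (intro mult_right_mono) auto
      finally show "s0 * (\<bar>x i\<bar> - \<bar>m i\<bar> - 1) \<le> s i * (x i - m i)\<^sup>2 / 2" by simp
    qed
    finally show ?thesis .
  qed
  then show "\<exists>\<kappa>>0. \<exists>K. \<forall>x. \<kappa> * l1_norm d x - K \<le> (\<Sum>i<d. s i * (x i - m i)\<^sup>2 / 2)"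
    using s0(1) by (intro exI[of _ s0] conjI exI[of _ "\<Sum>i<d. s0 * (\<bar>m i\<bar> + 1)"]) auto
qed

locale smooth_convex_laplace = smooth_convex_dim +
  fixes n :: nat
  assumes n1: "1 \<le> n"
begin

text \<open>Closed forms, identified below: \<open>hs\<close> is the diagonal of the Hessian of V at
  e1, \<open>Q\<close> the potential of the Gaussian approximation, and \<open>cub\<close> the
  third-derivative tensor applied to three copies of y.\<close>

definition V :: "(nat \<Rightarrow> real) \<Rightarrow> real" where "V x = real n * v x"
definition hs :: "nat \<Rightarrow> real" where "hs i = real n * (if i = 0 then a else b)"
definition Q :: "(nat \<Rightarrow> real) \<Rightarrow> real" where "Q x = (\<Sum>i<d. hs i * (ys x i)\<^sup>2 / 2)"
definition cub :: "(nat \<Rightarrow> real) \<Rightarrow> real" where "cub y = real n * (al * y 0 ^ 3 + 3 * be * y 0 * rho2 d y)"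

lemma n_pos: "0 < real n" using n1 by simp

lemma hs_pos: "0 < hs i"
  using n_pos a_pos b_pos by (simp add: hs_def)

lemma pd_V: "i < d \<Longrightarrow> pd i V (\<lambda>x. real n * Dv i x)"
  unfolding V_def[abs_def] by (intro pd_cmult pd_v)

lemma tame_V: "tame d V"
  unfolding V_def[abs_def] by (intro tame_mult tame_const tame_v)

lemma partial1: "k < d \<Longrightarrow> partial k V = (\<lambda>x. real n * Dv k x)"
  by (rule ext) (rule pd_partial[OF pd_V])

lemma pd_Dv:
  assumes "j < d" "k < d"
  shows "pd j (\<lambda>x. real n * Dv k x) (\<lambda>x. real n * gauss_avg d (p 2) (\<lambda>z. z j * z k) x)"
proof -
  have "pd j (gauss_avg d (p 1) (\<lambda>z. z k)) (gauss_avg d (p 2) (\<lambda>z. z j * z k))"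
    by (rule pd_PE) (use assms tame1_p dif1_p1 lip1_p in \<open>auto intro: tame_coord\<close>)
  from pd_cmult[OF pd_diff[OF this pd_const]] show ?thesis
    unfolding Dv_def[abs_def] by simp
qed

lemma partial2: "j < d \<Longrightarrow> k < d \<Longrightarrow> partial j (partial k V) = (\<lambda>x. real n * gauss_avg d (p 2) (\<lambda>z. z j * z k) x)"
  by (rule ext) (simp add: partial1 pd_partial[OF pd_Dv])

lemma partial3:
  assumes "i < d" "j < d" "k < d"
  shows "third_deriv V e1 i j k = real n * EG d (\<lambda>z. p 3 (z 0) * (z i * (z j * z k)))"
proof -
  have "pd i (gauss_avg d (p 2) (\<lambda>z. z j * z k)) (gauss_avg d (p 3) (\<lambda>z. z i * (z j * z k)))"
    by (rule pd_PE) (use assms tame1_p dif1_p2 lip1_p in \<open>auto intro: tame_coord tame_mult\<close>)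
  then have "pd i (\<lambda>x. real n * gauss_avg d (p 2) (\<lambda>z. z j * z k) x) (\<lambda>x. real n * gauss_avg d (p 3) (\<lambda>z. z i * (z j * z k)) x)"
    by (rule pd_cmult)
  from pd_partial[OF this, of e1] show ?thesis
    unfolding third_deriv_def partial2[OF assms(2,3)] by (simp add: gauss_avg_def dot_e1)
qed

text \<open>If the indices differ, one of them is not 0; its coordinate enters linearly and is
  independent of all other factors, so the average vanishes.\<close>

lemma EG_p2_pair:
  assumes "i < d" "j < d"
  shows "EG d (\<lambda>z. p 2 (z 0) * (z i * z j)) = (if i = j then if i = 0 then a else b else 0)"
proof -
  have tp: "tame d (\<lambda>z. p 2 (z 0) * z k)" if "k < d" for k
    by (intro tame_rules that) auto
  have off: "EG d (\<lambda>z. p 2 (z 0) * (z k * z l)) = 0" if "k < d" "l < d" "l \<noteq> 0" "k \<noteq> l" for k l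
    using EG_coord(1)[OF that(2) tp[OF that(1)]] that by (simp add: mult.assoc)
  consider "i = j" "i = 0" | "i = j" "i \<noteq> 0" | "i \<noteq> j" "j \<noteq> 0" | "i \<noteq> j" "i \<noteq> 0" by metis
  then show ?thesis
  proof cases
    case 1
    then show ?thesis
      using EG_marginal[OF d0 tame1_mult_power[OF tame1_p2], of 2] by (simp add: a_def power2_eq_square)
  next
    case 2
    have "EG d (\<lambda>z. p 2 (z 0) * (z j)\<^sup>2) = EG d (\<lambda>z. p 2 (z 0))"
      using 2 assms by (intro EG_coord(2) tame_rules) auto
    then show ?thesis
      using 2 EG_marginal[OF d0 tame1_p2] by (simp add: b_def power2_eq_square)
  next
    case 3
    then show ?thesis using off[of i j] assms by simp
  next
    case 4
    then show ?thesis using off[of j i] assms by (simp add: mult.commute[of "_ j"])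
  qed
qed

lemma hessian_V: "hessian d V e1 = diagonal_mat d hs"
proof (rule eq_matI)
  fix i j assume "i < dim_row (diagonal_mat d hs)" "j < dim_col (diagonal_mat d hs)"
  then have ij: "i < d" "j < d" by auto
  then show "hessian d V e1 $$ (i, j) = diagonal_mat d hs $$ (i, j)"
    by (simp add: hessian_def dg_index partial2 gauss_avg_def dot_e1 EG_p2_pair hs_def)
qed (simp_all add: hessian_def)

lemma inv_H: "inv_mat (hessian d V e1) = diagonal_mat d (\<lambda>i. 1 / hs i)"
  unfolding hessian_V using hs_pos by (intro inv_mat_dg) (simp add: less_imp_neq[symmetric])

lemma inv_sqrt_H: "inv_sqrt_mat (hessian d V e1) = diagonal_mat d (\<lambda>i. sqrt (1 / hs i))"
  unfolding inv_sqrt_mat_def inv_H using hs_pos by (intro sqrt_mat_dg) simp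

text \<open>Contracting \<psi>'''(z_0) z_i z_j z_k three times with w, inside the expectation, gives
  \<psi>'''(z_0) (z . w)^3, to which \<open>EG_dot\<close> applies.\<close>

lemma tensor_cube_V: "tensor_cube d (third_deriv V e1) w = cub w"
proof -
  have "tensor_cube d (third_deriv V e1) w
    = (\<Sum>i<d. \<Sum>j<d. \<Sum>k<d. real n * EG d (\<lambda>z. p 3 (z 0) * (z i * (z j * z k))) * (w i * w j * w k))"
    unfolding tensor_cube_def by (intro sum.cong refl) (simp add: partial3)
  also have "\<dots> = (\<Sum>i<d. \<Sum>j<d. \<Sum>k<d. EG d (\<lambda>z. (real n * (w i * w j * w k)) * (p 3 (z 0) * (z i * (z j * z k)))))"
    unfolding G.E_cmult by (simp add: mult_ac)
  also have "\<dots> = EG d (\<lambda>z. \<Sum>i<d. \<Sum>j<d. \<Sum>k<d. (real n * (w i * w j * w k)) * (p 3 (z 0) * (z i * (z j * z k))))"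
  proof -
    have t: "tame d (\<lambda>z. (real n * (w i * w j * w k)) * (p 3 (z 0) * (z i * (z j * z k))))"
      if "i < d" "j < d" "k < d" for i j k
      by (intro tame_rules that) auto
    have 1: "(\<Sum>k<d. EG d (\<lambda>z. (real n * (w i * w j * w k)) * (p 3 (z 0) * (z i * (z j * z k)))))
      = EG d (\<lambda>z. \<Sum>k<d. (real n * (w i * w j * w k)) * (p 3 (z 0) * (z i * (z j * z k))))"
      if "i < d" "j < d" for i j
      by (rule G.E_sum[symmetric]) (auto intro!: t that)
    have 2: "(\<Sum>j<d. EG d (\<lambda>z. \<Sum>k<d. (real n * (w i * w j * w k)) * (p 3 (z 0) * (z i * (z j * z k)))))
      = EG d (\<lambda>z. \<Sum>j<d. \<Sum>k<d. (real n * (w i * w j * w k)) * (p 3 (z 0) * (z i * (z j * z k))))"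
      if "i < d" for i
      by (rule G.E_sum[symmetric]) (auto intro!: tame_sum t that)
    have 3: "(\<Sum>i<d. EG d (\<lambda>z. \<Sum>j<d. \<Sum>k<d. (real n * (w i * w j * w k)) * (p 3 (z 0) * (z i * (z j * z k)))))
      = EG d (\<lambda>z. \<Sum>i<d. \<Sum>j<d. \<Sum>k<d. (real n * (w i * w j * w k)) * (p 3 (z 0) * (z i * (z j * z k))))"
      by (rule G.E_sum[symmetric]) (auto intro!: tame_sum t)
    show ?thesis
      unfolding 3[symmetric] by (intro sum.cong refl) (simp add: 1 flip: 2)
  qed
  also have "(\<lambda>z. \<Sum>i<d. \<Sum>j<d. \<Sum>k<d. (real n * (w i * w j * w k)) * (p 3 (z 0) * (z i * (z j * z k))))
    = (\<lambda>z. real n * (p 3 (z 0) * (dot d z w) ^ 3))"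
  proof
    fix z
    have "(dot d z w) ^ 3 = (\<Sum>i<d. \<Sum>j<d. \<Sum>k<d. (z i * w i) * ((z j * w j) * (z k * w k)))"
    proof -
      have S: "(\<Sum>i<d. \<Sum>j<d. \<Sum>k<d. c i * (c j * c k)) = (\<Sum>i<d. c i) * ((\<Sum>i<d. c i) * (\<Sum>i<d. c i))"
        for c :: "nat \<Rightarrow> real"
        by (simp only: sum_distrib_left[symmetric] sum_distrib_right[symmetric])
      have "(dot d z w) ^ 3 = dot d z w * (dot d z w * dot d z w)" by (simp only: power3_eq_cube mult.assoc)
      then show ?thesis unfolding S[of "\<lambda>i. z i * w i"] dot_def .
    qed
    then show "(\<Sum>i<d. \<Sum>j<d. \<Sum>k<d. (real n * (w i * w j * w k)) * (p 3 (z 0) * (z i * (z j * z k))))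
      = real n * (p 3 (z 0) * (dot d z w) ^ 3)"
      by (simp add: sum_distrib_left mult_ac)
  qed
  also have "EG d (\<lambda>z. real n * (p 3 (z 0) * (dot d z w) ^ 3)) = cub w"
    unfolding G.E_cmult EG_dot[OF d1 tame1_p3] cub_def al_def be_def by (simp add: mult_ac)
  finally show ?thesis .
qed

text \<open>Contraction with the diagonal inverse Hessian only meets entries whose last two indices
  agree; parity in z_i removes those with i nonzero.\<close>

lemma third_deriv_diag:
  assumes "i < d" "j < d"
  shows "third_deriv V e1 i j j = (if i = 0 then real n * (if j = 0 then al else be) else 0)"
proof -
  have T: "third_deriv V e1 i j j = real n * EG d (\<lambda>z. p 3 (z 0) * (z i * (z j * z j)))"
    by (rule partial3[OF assms assms(2)])
  consider "i = 0" "j = 0" | "i = 0" "j \<noteq> 0" | "i \<noteq> 0" "j \<noteq> i" | "i \<noteq> 0" "j = i" by blast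
  then show ?thesis
  proof cases
    case 1
    then show ?thesis
      unfolding T using EG_marginal[OF d0 tame1_mult_power[OF tame1_p3], of 3] by (simp add: al_def power3_eq_cube mult.assoc)
  next
    case 2
    have "EG d (\<lambda>z. p 3 (z 0) * z 0 ^ 1 * (z j)\<^sup>2) = EG d (\<lambda>z. p 3 (z 0) * z 0 ^ 1)"
      using 2 assms by (intro EG_coord(2) tame_rules) auto
    then show ?thesis
      unfolding T using 2 EG_marginal[OF d0 tame1_mult_power[OF tame1_p3], of 1]
      by (simp add: be_def power2_eq_square mult.assoc)
  next
    case 3
    have "EG d (\<lambda>z. p 3 (z 0) * (z j)\<^sup>2 * z i) = 0"
      using 3 assms by (intro EG_coord(1) tame_rules) auto
    then show ?thesis
      unfolding T using 3 by (simp add: power2_eq_square mult_ac)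
  next
    case 4
    have "EG d (\<lambda>z. p 3 (z 0) * z i ^ 3) = 0"
      using 4 assms by (intro EG_coord(3) tame_rules) auto
    then show ?thesis
      unfolding T using 4 by (simp add: power3_eq_cube mult_ac)
  qed
qed

text \<open>The first coordinate of \<open>delta_x\<close>, left unreduced: the two summands in the
  bracket are the contributions of the index 0 and of the d - 1 other indices to the contraction
  with the inverse Hessian.\<close>

definition dx0 :: real where
  "dx0 = - 1 / 2 * (1 / (real n * a) * (real n * al / (real n * a) + (real d - 1) * (real n * be) / (real n * b)))"

lemma delta_x_V: "i < d \<Longrightarrow> delta_x d V e1 i = (if i = 0 then dx0 else 0)"
proof -
  assume i: "i < d"
  let ?T = "third_deriv V e1"
  have tm: "tensor_mat d ?T (diagonal_mat d (\<lambda>i. 1 / hs i)) i = (if i = 0 then (real n * al / (real n * a) + (real d - 1) * (real n * be) / (real n * b)) else 0)"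
  proof -
    have "(\<Sum>k<d. ?T i j k * diagonal_mat d (\<lambda>i. 1 / hs i) $$ (j, k)) = ?T i j j / hs j" if j: "j < d" for j
    proof -
      have "(\<Sum>k<d. ?T i j k * diagonal_mat d (\<lambda>i. 1 / hs i) $$ (j, k)) = (\<Sum>k<d. if k = j then ?T i j j / hs j else 0)"
        using j by (intro sum.cong) (auto simp: dg_index)
      then show ?thesis using j by simp
    qed
    then have "tensor_mat d ?T (diagonal_mat d (\<lambda>i. 1 / hs i)) i = (\<Sum>j<d. ?T i j j / hs j)"
      using i by (simp add: tensor_mat_def)
    also have "\<dots> = ?T i 0 0 / hs 0 + (\<Sum>j\<in>{1..<d}. ?T i j j / hs j)"
      by (rule sum_split0[OF d1])
    also have "(\<Sum>j\<in>{1..<d}. ?T i j j / hs j) = (\<Sum>j\<in>{1..<d}. if i = 0 then real n * be / (real n * b) else 0)"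
      using i by (intro sum.cong refl) (auto simp: third_deriv_diag hs_def)
    finally show ?thesis
      using i d0 by (simp add: third_deriv_diag hs_def of_nat_diff)
  qed
  show ?thesis
    unfolding delta_x_def Let_def inv_H mat_app_dg
    using i tm by (simp add: dx0_def hs_def[of 0])
qed

lemma gaussian_Q: "gaussian d e1 (inv_mat (hessian d V e1)) = gibbs d Q"
proof -
  have "gaussian d e1 (inv_mat (hessian d V e1)) = gibbs d (\<lambda>x. \<Sum>i<d. (x i - e1 i)\<^sup>2 / (2 * (1 / hs i)))"
    unfolding inv_H using hs_pos by (intro gaussian_dg) simp
  also have "(\<lambda>x. \<Sum>i<d. (x i - e1 i)\<^sup>2 / (2 * (1 / hs i))) = Q"
    by (auto simp: Q_def ys_def mult.commute)
  finally show ?thesis .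
qed

lemma coercive_Q: "coercive d Q"
  unfolding Q_def[abs_def] ys_def
proof (rule coercive_quadratic)
  show "0 < real n * min a b" using n_pos a_pos b_pos by simp
  show "real n * min a b \<le> hs i" for i by (auto simp: hs_def intro!: mult_left_mono)
qed

text \<open>\<open>v_growth\<close> is combined with r - 1 \<le> min (r^2) r and |x|_1 \<le> d r +
  |e1|_1. The rate n c/d degrades with the dimension, which is harmless because coercivity only
  serves integrability.\<close>

lemma coercive_V: "coercive d V"
  unfolding coercive_def
proof
  show "V \<in> borel_measurable (leb d)" by (rule tame_measurable[OF tame_V])
  define c where "c = growth_const (lam / 2) (2 * B / 3)"
  have c: "c > 0" unfolding c_def using lam_pos B_nonneg by (intro growth_const_pos) auto
  have "(real n * c / real d) * l1_norm d x - (real n * c / real d * l1_norm d e1 + real n * c - real n * v e1) \<le> V x" for x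
  proof -
    have "\<bar>ys x i\<bar> \<le> rr x" if "i < d" for i
      using real_sqrt_le_mono[OF coord_sq_le_nrm2[OF that, of "ys x"]] by simp
    then have "l1_norm d (ys x) \<le> (\<Sum>i<d. rr x)" unfolding l1_norm_def by (intro sum_mono) auto
    moreover have "l1_norm d x \<le> l1_norm d (ys x) + l1_norm d e1"
      unfolding l1_norm_def sum.distrib[symmetric] by (intro sum_mono) (auto simp: ys_def)
    ultimately have l: "l1_norm d x \<le> real d * rr x + l1_norm d e1" by simp
    have m: "rr x - 1 \<le> min (nrm2 d (ys x)) (rr x)"
    proof -
      have "0 \<le> (rr x - 1)\<^sup>2" by simp
      then have "2 * rr x - 1 \<le> nrm2 d (ys x)" unfolding power2_diff rr_sq by simp
      then show ?thesis using real_sqrt_ge_zero[OF nrm2_nonneg[of d "ys x"]] by linarith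
    qed
    have "c * (rr x - 1) \<le> c * min (nrm2 d (ys x)) (rr x)" using m c by (intro mult_left_mono) auto
    also have "\<dots> \<le> v x - v e1" unfolding c_def by (rule v_growth)
    finally have "real n * (c * (rr x - 1)) \<le> real n * (v x - v e1)" by (intro mult_left_mono) auto
    moreover have "(real n * c / real d) * l1_norm d x \<le> (real n * c / real d) * (real d * rr x + l1_norm d e1)"
      using l c by (intro mult_left_mono) auto
    moreover have "(real n * c / real d) * (real d * rr x + l1_norm d e1) = real n * c * rr x + real n * c / real d * l1_norm d e1"
      using d0 by (simp add: field_simps)
    ultimately show ?thesis unfolding V_def right_diff_distrib by linarith
  qed
  moreover have "0 < real n * c / real d" using c n_pos d0 by simp
  ultimately show "\<exists>\<kappa>>0. \<exists>K. \<forall>x. \<kappa> * l1_norm d x - K \<le> V x" by blast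
qed

lemma tame_ys: "i < d \<Longrightarrow> tame d (\<lambda>x. ys x i)"
  unfolding ys_def by (intro tame_rules)

lemma tame_rho2: "tame d (\<lambda>x. rho2 d (ys x))"
  unfolding rho2_def by (intro tame_sum tame_power tame_ys) auto

lemma tame_nrm2: "tame d (\<lambda>x. nrm2 d (ys x))"
  unfolding nrm2_def by (intro tame_sum tame_power tame_ys) auto

lemma tame_cub: "tame d (\<lambda>x. cub (ys x))"
  unfolding cub_def by (intro tame_rules tame_ys tame_rho2)

text \<open>The substitution x = e1 + H^(-1/2) z turns Q into the standard Gaussian potential and
  the cubic form at y into the cubic form at H^(-1/2) z.\<close>

lemma L_TV_V: "L_TV d V e1 = 1 / 12 * expect d Q (\<lambda>x. \<bar>cub (ys x)\<bar>)"
proof -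
  define \<sigma> where "\<sigma> i = sqrt (1 / hs i)" for i
  have \<sigma>: "\<sigma> i \<noteq> 0" "hs i * (\<sigma> i)\<^sup>2 = 1" for i using hs_pos[of i] by (auto simp: \<sigma>_def)
  let ?T = "\<lambda>x::nat \<Rightarrow> real. \<lambda>i\<in>{..<d}. e1 i + \<sigma> i * x i"
  have ysT: "ys (?T z) i = \<sigma> i * z i" if "i < d" for z i using that by (simp add: ys_def)
  have cT: "cub (ys (?T z)) = cub (mat_app (diagonal_mat d \<sigma>) z)" for z
  proof -
    have "rho2 d (ys (?T z)) = rho2 d (mat_app (diagonal_mat d \<sigma>) z)"
      unfolding rho2_def by (intro sum.cong refl) (auto simp: ysT mat_app_dg)
    moreover have "ys (?T z) 0 = mat_app (diagonal_mat d \<sigma>) z 0" using d0 by (simp add: ysT mat_app_dg)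
    ultimately show ?thesis by (simp add: cub_def)
  qed
  have QT: "Q (?T z) = gauss_potential d z" for z
    unfolding Q_def gauss_potential_def sum_divide_distrib
    by (intro sum.cong refl) (auto simp: ysT power_mult_distrib \<sigma>(2) simp flip: mult.assoc)
  have "expect d Q (\<lambda>x. \<bar>cub (ys x)\<bar>) = expect d (\<lambda>x. Q (?T x)) (\<lambda>x. \<bar>cub (ys (?T x))\<bar>)"
    using coercive_Q by (intro expect_affine \<sigma>(1) tame_measurable[OF tame_abs[OF tame_cub]]) (simp add: coercive_def)
  also have "\<dots> = EG d (\<lambda>z. \<bar>cub (mat_app (diagonal_mat d \<sigma>) z)\<bar>)"
    unfolding QT cT ..
  also have "\<dots> = (\<integral>z. \<bar>cub (mat_app (diagonal_mat d \<sigma>) z)\<bar> \<partial>std_gaussian d)"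
  proof (rule integral_std[symmetric])
    have r: "rho2 d (mat_app (diagonal_mat d \<sigma>) z) = (\<Sum>i\<in>{1..<d}. (\<sigma> i * z i)\<^sup>2)" for z
      unfolding rho2_def by (intro sum.cong refl) (auto simp: mat_app_dg)
    have "tame d (\<lambda>z. \<bar>cub (mat_app (diagonal_mat d \<sigma>) z)\<bar>)"
      unfolding cub_def r using d0 by (simp add: mat_app_dg) (intro tame_intros; simp)
    then show "(\<lambda>z. \<bar>cub (mat_app (diagonal_mat d \<sigma>) z)\<bar>) \<in> borel_measurable (leb d)" by (rule tame_measurable)
  qed
  finally show ?thesis
    unfolding L_TV_def inv_sqrt_H tensor_cube_V \<sigma>_def[abs_def, symmetric] by simp
qed

lemma mean_V: "i < d \<Longrightarrow> mean d (gibbs d V) i = expect d V (\<lambda>x. x i)"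
  unfolding mean_def using integral_gibbs[OF coercive_V, of "\<lambda>x. x i"] by simp

text \<open>A reflection of x_j can be moved onto z inside the inner product; it preserves the
  standard Gaussian and fixes z_0. Hence v, and with it \<pi>, is symmetric in x_j.\<close>

lemma mean_V_reflect:
  assumes j: "j < d" "j \<noteq> 0"
  shows "expect d V (\<lambda>x. x j) = 0"
proof -
  define \<sigma> :: "nat \<Rightarrow> real" where "\<sigma> i = (if i = j then - 1 else 1)" for i
  let ?T = "\<lambda>x::nat \<Rightarrow> real. \<lambda>i\<in>{..<d}. 0 + \<sigma> i * x i"
  have \<sigma>: "\<sigma> i \<noteq> 0" "(\<sigma> i)\<^sup>2 = 1" for i by (auto simp: \<sigma>_def)
  have dT: "dot d (?T z) x = dot d z (?T x)" for z x
    unfolding dot_def by (intro sum.cong refl) auto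
  have zT: "?T z 0 = z 0" for z using j d0 by (simp add: \<sigma>_def)
  have gT: "gauss_potential d (?T z) = gauss_potential d z" for z
    unfolding gauss_potential_def by (simp add: power_mult_distrib \<sigma>(2))
  have EGT: "EG d f = EG d (\<lambda>z. f (?T z))" if "tame d f" for f
    using expect_affine[of d \<sigma> f "gauss_potential d" "\<lambda>_. 0", OF \<sigma>(1) tame_measurable[OF that] tame_measurable[OF tame_gw]]
    unfolding gT .
  have vT: "v (?T x) = v x" for x
  proof -
    have "tame d (\<lambda>z. p 0 (dot d z x))" "tame d (\<lambda>z. p 1 (z 0) * dot d z x)" by (intro tame_rules; simp)+
    from this[THEN EGT] show ?thesis unfolding v_EG dT zT by simp
  qed
  have "expect d V (\<lambda>x. x j) = expect d (\<lambda>x. V (?T x)) (\<lambda>x. ?T x j)"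
    using j by (intro expect_affine \<sigma> tame_measurable[OF tame_V]) simp
  also have "\<dots> = expect d V (\<lambda>x. - x j)"
    unfolding V_def vT using j by (simp add: \<sigma>_def)
  also have "\<dots> = - expect d V (\<lambda>x. x j)"
    by (rule coercive_potential.E_uminus) (rule coercive_potential.intro[OF coercive_V])
  finally show ?thesis by simp
qed

lemma norm_mean:
  "norm_mat (hessian d V e1) (\<lambda>i. mean d (gibbs d V) i - e1 i - delta_x d V e1 i)
    = sqrt (real n * a) * \<bar>expect d V (\<lambda>x. ys x 0) - dx0\<bar>"
proof -
  interpret VV: coercive_potential d V by (rule coercive_potential.intro[OF coercive_V])
  have "mean d (gibbs d V) i - e1 i - delta_x d V e1 i = 0" if "i \<in> {1..<d}" for i
  proof -
    have "e1 i = 0" using that by (simp add: first_unit_def)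
    then show ?thesis using that by (simp add: mean_V mean_V_reflect delta_x_V)
  qed
  moreover have "mean d (gibbs d V) 0 - e1 0 - delta_x d V e1 0 = expect d V (\<lambda>x. ys x 0) - dx0"
    using d0 unfolding ys_def by (subst VV.E_diff) (auto intro: tame_const tame_coord simp: mean_V delta_x_V)
  ultimately show ?thesis
    unfolding norm_mat_def hessian_V quad_form_dg sum_split0[OF d1]
    by (simp add: hs_def real_sqrt_mult)
qed

end

section \<open>Moments by integration by parts\<close>

text \<open>Axioms shared by V and by its quadratic model Q, so that each moment bound is proved
  once: n D is the gradient of W, \<open>growth\<close> the radial lower bound, \<open>lin\<close>
  the linearisation of the first component. The constants a, c, C are to be chosen free of d and
  n.\<close>

locale laplace_model =
  fixes d n :: nat and m :: "nat \<Rightarrow> real" and W :: "(nat \<Rightarrow> real) \<Rightarrow> real"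
    and D :: "nat \<Rightarrow> (nat \<Rightarrow> real) \<Rightarrow> real" and a c C :: real
  assumes d1: "1 \<le> d" and n1: "1 \<le> n" and coer: "coercive d W"
    and pdW: "\<And>i. i < d \<Longrightarrow> pd i W (\<lambda>x. real n * D i x)" and tD: "\<And>i. i < d \<Longrightarrow> tame d (D i)"
    and a: "0 < a" and c: "0 < c" and C: "0 \<le> C"
    and growth: "\<And>x. c * min (nrm2 d (\<lambda>i. x i - m i)) (sqrt (nrm2 d (\<lambda>i. x i - m i))) \<le> (\<Sum>i<d. D i x * (x i - m i))"
    and lin: "\<And>x. \<bar>D 0 x - a * (x 0 - m 0)\<bar> \<le> C * nrm2 d (\<lambda>i. x i - m i)"
begin

sublocale coercive_potential d W
  by (rule coercive_potential.intro[OF coer])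

abbreviation "E \<equiv> expect d W"
abbreviation "r2 x \<equiv> nrm2 d (\<lambda>i. x i - m i)"

definition S where "S x = (\<Sum>i<d. D i x * (x i - m i))"

lemma d_pos: "0 < d" "0 < real d" and n_pos: "0 < real n"
  using d1 n1 by auto

lemma tame_y: "i < d \<Longrightarrow> tame d (\<lambda>x. x i - m i)"
  by (intro tame_diff tame_coord tame_const)

lemma tame_r2: "tame d r2"
  unfolding nrm2_def by (intro tame_sum tame_power tame_y) auto

lemma tame_S: "tame d S"
  unfolding S_def[abs_def] by (intro tame_sum tame_mult tD tame_y) auto

lemma pd_y: "pd i (\<lambda>x. x i - m i) (\<lambda>_. 1)"
  using pd_diff[OF pd_coord[of i i] pd_const[of i "m i"]] by simp

lemma pd_r2: "i < d \<Longrightarrow> pd i r2 (\<lambda>x. 2 * (x i - m i))"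
proof -
  assume i: "i < d"
  have "pd i r2 (\<lambda>x. \<Sum>j<d. real 2 * (x j - m j) ^ (2 - 1) * ((if j = i then 1 else 0) - 0))"
    unfolding nrm2_def by (intro pd_sum pd_power pd_diff pd_coord pd_const)
  then show ?thesis using i by (simp add: mult_delta_right sum.delta)
qed

lemma ibp:
  assumes "i < d" "tame d f" "tame d f'" "pd i f f'"
  shows "E (\<lambda>x. f x * D i x) = E f' / real n"
proof -
  have "E f' = E (\<lambda>x. f x * (real n * D i x))"
    by (rule IBP[OF assms(1-3) tame_mult[OF tame_const tD[OF assms(1)]] assms(4) pdW[OF assms(1)]])
  also have "(\<lambda>x. f x * (real n * D i x)) = (\<lambda>x. real n * (f x * D i x))" by (simp add: mult_ac)
  finally have "E f' = real n * E (\<lambda>x. f x * D i x)" by (simp only: E_cmult)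
  then show ?thesis using n_pos by simp
qed

lemma E_D0: "E (D 0) = 0"
  using ibp[of 0 "\<lambda>_. 1" "\<lambda>_. 0"] d_pos by (simp add: tame_const pd_const)

lemma E_D_y: "i < d \<Longrightarrow> E (\<lambda>x. D i x * (x i - m i)) = 1 / real n"
  using ibp[of i "\<lambda>x. x i - m i" "\<lambda>_. 1"] by (simp add: tame_const tame_y pd_y mult.commute)

text \<open>Virial identity: integration by parts against the field y |y|^(2k), whose divergence is
  (d + 2k) |y|^(2k).\<close>

lemma E_S_power: "E (\<lambda>x. S x * r2 x ^ k) = (real d + 2 * real k) / real n * E (\<lambda>x. r2 x ^ k)"
proof -
  let ?y = "\<lambda>i x. x i - m i"
  have one: "E (\<lambda>x. ?y i x * r2 x ^ k * D i x) = E (\<lambda>x. r2 x ^ k + (2 * real k) * (r2 x ^ (k - 1) * (?y i x)\<^sup>2)) / real n"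
    if i: "i < d" for i
  proof (rule ibp[OF i])
    have "pd i (\<lambda>x. ?y i x * r2 x ^ k) (\<lambda>x. 1 * r2 x ^ k + real k * r2 x ^ (k - 1) * (2 * ?y i x) * ?y i x)"
      by (rule pd_mult[OF pd_y pd_power[OF pd_r2[OF i]]])
    then show "pd i (\<lambda>x. ?y i x * r2 x ^ k) (\<lambda>x. r2 x ^ k + (2 * real k) * (r2 x ^ (k - 1) * (?y i x)\<^sup>2))"
      by (rule pd_eq) (simp add: power2_eq_square mult_ac)
  qed (intro tame_mult tame_add tame_const tame_power tame_y tame_r2 i)+
  have "E (\<lambda>x. S x * r2 x ^ k) = E (\<lambda>x. \<Sum>i<d. ?y i x * r2 x ^ k * D i x)"
    unfolding S_def sum_distrib_right by (simp only: mult_ac)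
  also have "\<dots> = (\<Sum>i<d. E (\<lambda>x. ?y i x * r2 x ^ k * D i x))"
    by (rule E_sum) (auto intro!: tame_mult tame_power tame_y tame_r2 tD)
  also have "\<dots> = (\<Sum>i<d. E (\<lambda>x. r2 x ^ k + (2 * real k) * (r2 x ^ (k - 1) * (?y i x)\<^sup>2)) / real n)"
    by (intro sum.cong refl one) simp
  also have "\<dots> = (\<Sum>i<d. E (\<lambda>x. r2 x ^ k + (2 * real k) * (r2 x ^ (k - 1) * (?y i x)\<^sup>2))) / real n"
    by (simp only: sum_divide_distrib)
  also have "(\<Sum>i<d. E (\<lambda>x. r2 x ^ k + (2 * real k) * (r2 x ^ (k - 1) * (?y i x)\<^sup>2)))
      = E (\<lambda>x. \<Sum>i<d. r2 x ^ k + (2 * real k) * (r2 x ^ (k - 1) * (?y i x)\<^sup>2))"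
    by (rule E_sum[symmetric]) (auto intro!: tame_mult tame_add tame_const tame_power tame_y tame_r2)
  also have "(\<lambda>x. \<Sum>i<d. r2 x ^ k + (2 * real k) * (r2 x ^ (k - 1) * (?y i x)\<^sup>2)) = (\<lambda>x. (real d + 2 * real k) * r2 x ^ k)"
  proof
    fix x
    have "(\<Sum>i<d. r2 x ^ k + (2 * real k) * (r2 x ^ (k - 1) * (?y i x)\<^sup>2))
        = real d * r2 x ^ k + (2 * real k) * (r2 x ^ (k - 1) * r2 x)"
      by (simp add: sum.distrib nrm2_def flip: sum_distrib_left)
    \<comment> \<open>For k = 0 the truncated exponent k - 1 is masked by the factor k.\<close>
    also have "(2 * real k) * (r2 x ^ (k - 1) * r2 x) = (2 * real k) * r2 x ^ k"
      by (cases k) auto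
    finally show "(\<Sum>i<d. r2 x ^ k + (2 * real k) * (r2 x ^ (k - 1) * (?y i x)\<^sup>2)) = (real d + 2 * real k) * r2 x ^ k"
      by (simp add: distrib_right)
  qed
  finally show ?thesis by (simp add: E_cmult)
qed

lemma E_S: "E S = real d / real n"
  using E_S_power[of 0] by simp

lemma r2_le_S: "r2 x \<le> (1 + r2 x) * (S x / c)"
proof -
  let ?r = "r2 x"
  have r: "0 \<le> ?r" by simp
  have "?r \<le> (1 + ?r) * min ?r (sqrt ?r)"
  proof (cases "?r \<le> 1")
    case True
    then have "?r * ?r \<le> 1 * ?r" using r by (intro mult_right_mono) auto
    then have "?r \<le> sqrt ?r" using r by (intro real_le_rsqrt) (simp add: power2_eq_square)
    then show ?thesis using r by (simp add: distrib_right)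
  next
    case False
    then have "1 \<le> sqrt ?r" by simp
    then have "1 \<le> min ?r (sqrt ?r)" using False by simp
    then have "(1 + ?r) * 1 \<le> (1 + ?r) * min ?r (sqrt ?r)" using r by (intro mult_left_mono) auto
    then show ?thesis by simp
  qed
  also have "\<dots> \<le> (1 + ?r) * (S x / c)"
    using growth[of x] c r by (intro mult_left_mono) (auto simp: S_def field_simps)
  finally show ?thesis .
qed

text \<open>Since \<open>min r\<^sup>2 r \<ge> r\<^sup>2 / (1 + r\<^sup>2)\<close>, only even moments enter the recursion.\<close>

lemma moment_step:
  "E (\<lambda>x. r2 x ^ Suc k) \<le> ((real d + 2 * real k) * E (\<lambda>x. r2 x ^ k) + (real d + 2 * real (Suc k)) * E (\<lambda>x. r2 x ^ Suc k)) / (c * real n)"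
proof -
  have "E (\<lambda>x. r2 x ^ Suc k) \<le> E (\<lambda>x. (1 / c) * (S x * r2 x ^ k) + (1 / c) * (S x * r2 x ^ Suc k))"
  proof (rule E_mono)
    fix x
    have "r2 x * r2 x ^ k \<le> ((1 + r2 x) * (S x / c)) * r2 x ^ k"
      by (intro mult_right_mono r2_le_S) auto
    then show "r2 x ^ Suc k \<le> (1 / c) * (S x * r2 x ^ k) + (1 / c) * (S x * r2 x ^ Suc k)"
      by (simp add: algebra_simps add_divide_distrib)
  qed (intro tame_add tame_mult tame_const tame_power tame_S tame_r2)+
  also have "\<dots> = (1 / c) * E (\<lambda>x. S x * r2 x ^ k) + (1 / c) * E (\<lambda>x. S x * r2 x ^ Suc k)"
    by (subst E_lin2) (intro tame_mult tame_const tame_power tame_S tame_r2 | simp only: E_cmult)+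
  also have "\<dots> = ((real d + 2 * real k) * E (\<lambda>x. r2 x ^ k) + (real d + 2 * real (Suc k)) * E (\<lambda>x. r2 x ^ Suc k)) / (c * real n)"
    unfolding E_S_power using c n_pos by (simp add: field_simps)
  finally show ?thesis .
qed

text \<open>For a pairing that is quadratic everywhere, as for Q, no higher moment enters and
  nothing has to be absorbed, so the bound is available for all d and n.\<close>

lemma moment_quadratic_step:
  assumes l: "0 < l" "\<And>x. l * r2 x \<le> S x"
  shows "E (\<lambda>x. r2 x ^ Suc k) \<le> (real d + 2 * real k) / (l * real n) * E (\<lambda>x. r2 x ^ k)"
proof -
  have "E (\<lambda>x. r2 x ^ Suc k) \<le> E (\<lambda>x. (1 / l) * (S x * r2 x ^ k))"
  proof (rule E_mono)
    fix x
    have "(l * r2 x) * r2 x ^ k \<le> S x * r2 x ^ k"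
      by (intro mult_right_mono l) auto
    then show "r2 x ^ Suc k \<le> (1 / l) * (S x * r2 x ^ k)"
      using l(1) by (simp add: field_simps)
  qed (intro tame_mult tame_const tame_power tame_S tame_r2)+
  also have "\<dots> = (real d + 2 * real k) / (l * real n) * E (\<lambda>x. r2 x ^ k)"
    unfolding E_cmult E_S_power by simp
  finally show ?thesis .
qed

lemma E_r2_nonneg: "0 \<le> E (\<lambda>x. r2 x ^ k)"
  by (rule E_nonneg) simp

text \<open>For k \<le> 4 and d \<ge> 1 the factors d + 2k are at most 9 d, with 9 = 1 + 2 * 4. The
  smallness assumption makes 9 d at most c n/2, so the moment on the right of
  \<open>moment_step\<close> is absorbed at the price of doubling 9 to 18.\<close>

lemma moment_bound:
  assumes small: "18 * real d \<le> c * real n" and k: "k \<le> 4"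
  shows "E (\<lambda>x. r2 x ^ k) \<le> (18 / c * real d / real n) ^ k"
  using k
proof (induction k)
  case (Suc k)
  let ?M = "E (\<lambda>x. r2 x ^ k)" and ?M' = "E (\<lambda>x. r2 x ^ Suc k)"
  have cn: "0 < c * real n" using c n_pos by simp
  have k9: "real d + 2 * real k \<le> 9 * real d" "real d + 2 * real (Suc k) \<le> 9 * real d"
    using Suc.prems d_pos d1 by auto
  have "?M' * (c * real n) \<le> (real d + 2 * real k) * ?M + (real d + 2 * real (Suc k)) * ?M'"
    using moment_step[of k] cn by (simp only: pos_le_divide_eq)
  also have "\<dots> \<le> 9 * real d * ?M + 9 * real d * ?M'"
    by (intro add_mono mult_right_mono k9 E_r2_nonneg)
  finally have 1: "?M' * (c * real n) \<le> 9 * real d * ?M + 9 * real d * ?M'" .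
  have "9 * real d * ?M' \<le> (c * real n / 2) * ?M'"
    by (rule mult_right_mono) (use small E_r2_nonneg[of "Suc k"] in linarith)+
  moreover have "(c * real n / 2) * ?M' = (?M' * (c * real n)) / 2" by (simp only: mult.commute times_divide_eq_left)
  ultimately have "?M' * (c * real n) \<le> 18 * real d * ?M" using 1 by linarith
  then have "?M' \<le> 18 * real d * ?M / (c * real n)" using cn by (simp only: pos_le_divide_eq)
  also have "\<dots> = (18 / c * real d / real n) * ?M" using c n_pos by (simp add: field_simps)
  also have "\<dots> \<le> (18 / c * real d / real n) * (18 / c * real d / real n) ^ k"
    using Suc c n_pos by (intro mult_left_mono) auto
  finally show ?case by simp
qed simp

lemma E_abs_y0: "E (\<lambda>x. \<bar>x 0 - m 0\<bar>) \<le> 1 + real d / (c * real n)"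
proof -
  have "E (\<lambda>x. \<bar>x 0 - m 0\<bar>) \<le> E (\<lambda>x. (1 / c) * S x + 1)"
  proof (rule E_mono)
    fix x
    have "\<bar>x 0 - m 0\<bar> \<le> sqrt (r2 x)"
      using real_sqrt_le_mono[OF coord_sq_le_nrm2[of 0 d "\<lambda>i. x i - m i"]] d_pos by simp
    moreover have "sqrt (r2 x) \<le> min (r2 x) (sqrt (r2 x)) + 1"
    proof -
      have "0 \<le> (sqrt (r2 x) - 1)\<^sup>2" by simp
      then have "2 * sqrt (r2 x) - 1 \<le> r2 x" by (simp add: power2_diff)
      moreover have "0 \<le> sqrt (r2 x)" by simp
      ultimately show ?thesis by linarith
    qed
    moreover have "min (r2 x) (sqrt (r2 x)) \<le> (1 / c) * S x"
      using growth[of x] c by (simp add: S_def field_simps)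
    ultimately show "\<bar>x 0 - m 0\<bar> \<le> (1 / c) * S x + 1" by linarith
  qed (intro tame_abs tame_y d_pos tame_add tame_mult tame_const tame_S)+
  also have "\<dots> = (1 / c) * E S + 1"
    by (subst E_lin2) (auto intro: tame_S tame_const)
  finally show ?thesis by (simp add: E_S)
qed

text \<open>Testing with y_0 |y|^4 in direction 0 differentiates one coordinate instead of d, so
  y_0^2 gains 1/n rather than d/n. The linearisation error C |y|^2 |y_0| is split by Young: half of
  a y_0^2 is absorbed on the left, the rest leaves the eighth moment of |y|.\<close>

lemma mixed_moment:
  "E (\<lambda>x. (x 0 - m 0)\<^sup>2 * r2 x ^ 2) \<le> 10 / (a * real n) * E (\<lambda>x. r2 x ^ 2) + C\<^sup>2 / a\<^sup>2 * E (\<lambda>x. r2 x ^ 4)"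
proof -
  let ?y = "\<lambda>x. x 0 - m 0"
  let ?Y = "E (\<lambda>x. (?y x)\<^sup>2 * r2 x ^ 2)"
  have y_le: "(?y x)\<^sup>2 \<le> r2 x" for x
    using coord_sq_le_nrm2[of 0 d "\<lambda>i. x i - m i"] d_pos by simp
  have ib: "E (\<lambda>x. ?y x * r2 x ^ 2 * D 0 x) = E (\<lambda>x. r2 x ^ 2 + 4 * ((?y x)\<^sup>2 * r2 x)) / real n"
  proof (rule ibp[OF d_pos(1)])
    have "pd 0 (\<lambda>x. ?y x * r2 x ^ 2) (\<lambda>x. 1 * r2 x ^ 2 + real 2 * r2 x ^ (2 - 1) * (2 * ?y x) * ?y x)"
      by (rule pd_mult[OF pd_y pd_power[OF pd_r2[OF d_pos(1)]]])
    then show "pd 0 (\<lambda>x. ?y x * r2 x ^ 2) (\<lambda>x. r2 x ^ 2 + 4 * ((?y x)\<^sup>2 * r2 x))"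
      by (rule pd_eq) (simp add: power2_eq_square mult_ac)
  qed (intro tame_mult tame_add tame_const tame_power tame_y tame_r2 d_pos)+
  have up: "E (\<lambda>x. r2 x ^ 2 + 4 * ((?y x)\<^sup>2 * r2 x)) \<le> E (\<lambda>x. 5 * r2 x ^ 2)"
  proof (rule E_mono)
    show "r2 x ^ 2 + 4 * ((?y x)\<^sup>2 * r2 x) \<le> 5 * r2 x ^ 2" for x
      using mult_right_mono[OF y_le[of x], of "r2 x"] by (simp add: power2_eq_square)
  qed (intro tame_mult tame_add tame_const tame_power tame_y tame_r2 d_pos)+
  have "a / 2 * ?Y \<le> E (\<lambda>x. (C\<^sup>2 / (2 * a)) * r2 x ^ 4 + ?y x * r2 x ^ 2 * D 0 x)"
    unfolding E_cmult[symmetric]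
  proof (rule E_mono)
    fix x
    have "\<bar>D 0 x * ?y x - a * (?y x)\<^sup>2\<bar> \<le> C * r2 x * \<bar>?y x\<bar>"
    proof -
      have "\<bar>D 0 x - a * ?y x\<bar> * \<bar>?y x\<bar> \<le> C * r2 x * \<bar>?y x\<bar>" by (intro mult_right_mono lin) auto
      then show ?thesis unfolding abs_mult[symmetric] by (simp add: algebra_simps power2_eq_square)
    qed
    moreover have "C * r2 x * \<bar>?y x\<bar> \<le> a / 2 * (?y x)\<^sup>2 + C\<^sup>2 / (2 * a) * r2 x ^ 2"
    proof -
      have "0 \<le> (a * \<bar>?y x\<bar> - C * r2 x)\<^sup>2 / (2 * a)" using a by simp
      also have "\<dots> = a / 2 * (?y x)\<^sup>2 + C\<^sup>2 / (2 * a) * r2 x ^ 2 - C * r2 x * \<bar>?y x\<bar>"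
        using a by (simp add: power2_diff power_mult_distrib field_simps power2_eq_square)
      finally show ?thesis by simp
    qed
    ultimately have "a / 2 * (?y x)\<^sup>2 \<le> C\<^sup>2 / (2 * a) * r2 x ^ 2 + D 0 x * ?y x" by linarith
    then have "a / 2 * (?y x)\<^sup>2 * r2 x ^ 2 \<le> (C\<^sup>2 / (2 * a) * r2 x ^ 2 + D 0 x * ?y x) * r2 x ^ 2"
      by (rule mult_right_mono) simp
    also have "\<dots> = (C\<^sup>2 / (2 * a)) * r2 x ^ 4 + ?y x * r2 x ^ 2 * D 0 x"
      by (simp add: algebra_simps eval_nat_numeral)
    finally show "a / 2 * ((?y x)\<^sup>2 * r2 x ^ 2) \<le> (C\<^sup>2 / (2 * a)) * r2 x ^ 4 + ?y x * r2 x ^ 2 * D 0 x"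
      by (simp only: mult.assoc)
  qed (intro tame_mult tame_add tame_const tame_power tame_y tame_r2 tD d_pos)+
  also have "\<dots> = (C\<^sup>2 / (2 * a)) * E (\<lambda>x. r2 x ^ 4) + E (\<lambda>x. ?y x * r2 x ^ 2 * D 0 x)"
    by (rule E_lin2) (intro tame_mult tame_power tame_y tame_r2 tD d_pos)+
  also have "\<dots> \<le> (C\<^sup>2 / (2 * a)) * E (\<lambda>x. r2 x ^ 4) + 5 * E (\<lambda>x. r2 x ^ 2) / real n"
    unfolding ib using up n_pos by (intro add_left_mono divide_right_mono) (auto simp: E_cmult)
  finally have "2 / a * (a / 2 * ?Y) \<le> 2 / a * ((C\<^sup>2 / (2 * a)) * E (\<lambda>x. r2 x ^ 4) + 5 * E (\<lambda>x. r2 x ^ 2) / real n)"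
    using a by (intro mult_left_mono) auto
  then show ?thesis using a n_pos by (simp add: field_simps power2_eq_square)
qed

text \<open>The condition d^2 \<le> n turns d^4/n^4 into d^2/n^3, so the eighth moment and the
  weighted moment of y_0^2 |y|^4 share one order, which becomes \<epsilon>^2 after multiplication by
  n^2.\<close>

lemma moments_small:
  assumes small: "18 * real d \<le> c * real n" and dn: "(real d)\<^sup>2 \<le> real n"
  defines "\<kappa> \<equiv> 18 / c"
  shows "E r2 \<le> \<kappa> * (real d / real n)"
    and "E (\<lambda>x. r2 x ^ 2) \<le> \<kappa> ^ 2 * ((real d)\<^sup>2 / (real n)\<^sup>2)"
    and "E (\<lambda>x. r2 x ^ 4) \<le> \<kappa> ^ 4 * ((real d)\<^sup>2 / (real n) ^ 3)"
    and "E (\<lambda>x. (x 0 - m 0)\<^sup>2 * r2 x ^ 2) \<le> (10 / a * \<kappa> ^ 2 + C\<^sup>2 / a\<^sup>2 * \<kappa> ^ 4) * ((real d)\<^sup>2 / (real n) ^ 3)"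
proof -
  have \<kappa>: "0 < \<kappa>" using c by (simp add: \<kappa>_def)
  have M: "E (\<lambda>x. r2 x ^ k) \<le> \<kappa> ^ k * ((real d) ^ k / (real n) ^ k)" if "k \<le> 4" for k
    using moment_bound[OF small that] by (simp add: \<kappa>_def power_mult_distrib power_divide)
  show "E r2 \<le> \<kappa> * (real d / real n)" using M[of 1] by simp
  show 2: "E (\<lambda>x. r2 x ^ 2) \<le> \<kappa> ^ 2 * ((real d)\<^sup>2 / (real n)\<^sup>2)" using M[of 2] by simp
  have "(real d) ^ 4 / (real n) ^ 4 \<le> (real d)\<^sup>2 / (real n) ^ 3"
  proof -
    have "(real d) ^ 4 / (real n) ^ 4 = (real d)\<^sup>2 / (real n) ^ 3 * ((real d)\<^sup>2 / real n)"
      using n_pos by (simp add: field_simps eval_nat_numeral)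
    also have "\<dots> \<le> (real d)\<^sup>2 / (real n) ^ 3 * 1"
      using dn n_pos by (intro mult_left_mono) auto
    finally show ?thesis by simp
  qed
  then have "\<kappa> ^ 4 * ((real d) ^ 4 / (real n) ^ 4) \<le> \<kappa> ^ 4 * ((real d)\<^sup>2 / (real n) ^ 3)"
    using \<kappa> by (intro mult_left_mono) auto
  then show 4: "E (\<lambda>x. r2 x ^ 4) \<le> \<kappa> ^ 4 * ((real d)\<^sup>2 / (real n) ^ 3)" using M[of 4] by linarith
  have "E (\<lambda>x. (x 0 - m 0)\<^sup>2 * r2 x ^ 2) \<le> 10 / (a * real n) * E (\<lambda>x. r2 x ^ 2) + C\<^sup>2 / a\<^sup>2 * E (\<lambda>x. r2 x ^ 4)"
    by (rule mixed_moment)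
  also have "\<dots> \<le> 10 / (a * real n) * (\<kappa> ^ 2 * ((real d)\<^sup>2 / (real n)\<^sup>2)) + C\<^sup>2 / a\<^sup>2 * (\<kappa> ^ 4 * ((real d)\<^sup>2 / (real n) ^ 3))"
    using 2 4 a n_pos by (intro add_mono mult_left_mono) auto
  also have "\<dots> = (10 / a * \<kappa> ^ 2 + C\<^sup>2 / a\<^sup>2 * \<kappa> ^ 4) * ((real d)\<^sup>2 / (real n) ^ 3)"
    using a n_pos by (simp add: field_simps eval_nat_numeral)
  finally show "E (\<lambda>x. (x 0 - m 0)\<^sup>2 * r2 x ^ 2) \<le> (10 / a * \<kappa> ^ 2 + C\<^sup>2 / a\<^sup>2 * \<kappa> ^ 4) * ((real d)\<^sup>2 / (real n) ^ 3)" .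
qed

end

section \<open>Expansion of the total variation distance\<close>

context coercive_potential
begin

text \<open>Factors e^(-R) leave the polynomially bounded class, so for them integrability against
  the weight is carried along explicitly.\<close>

definition adm :: "((nat \<Rightarrow> real) \<Rightarrow> real) \<Rightarrow> bool" where
  "adm f \<longleftrightarrow> integrable (leb d) (\<lambda>x. f x * exp (- W x))"

lemma adm_tame: "tame d f \<Longrightarrow> adm f"
  unfolding adm_def by (rule int_tame)

lemma adm_add: "adm f \<Longrightarrow> adm g \<Longrightarrow> adm (\<lambda>x. f x + g x)"
  unfolding adm_def distrib_right by (rule Bochner_Integration.integrable_add)

lemma adm_diff: "adm f \<Longrightarrow> adm g \<Longrightarrow> adm (\<lambda>x. f x - g x)"
  unfolding adm_def left_diff_distrib by (rule Bochner_Integration.integrable_diff)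

lemma adm_cmult: "adm f \<Longrightarrow> adm (\<lambda>x. c * f x)"
  unfolding adm_def mult.assoc by (rule integrable_mult_right)

lemma adm_abs: "adm f \<Longrightarrow> adm (\<lambda>x. \<bar>f x\<bar>)"
  using integrable_abs[of "leb d" "\<lambda>x. f x * exp (- W x)"] unfolding adm_def by (simp add: abs_mult)

lemma E_add_adm: "adm f \<Longrightarrow> adm g \<Longrightarrow> expect d W (\<lambda>x. f x + g x) = expect d W f + expect d W g"
  unfolding adm_def expect_def by (simp add: distrib_right add_divide_distrib)

lemma E_diff_adm: "adm f \<Longrightarrow> adm g \<Longrightarrow> expect d W (\<lambda>x. f x - g x) = expect d W f - expect d W g"
  unfolding adm_def expect_def by (simp add: left_diff_distrib diff_divide_distrib)

lemma E_mono_adm: "adm f \<Longrightarrow> adm g \<Longrightarrow> (\<And>x. f x \<le> g x) \<Longrightarrow> expect d W f \<le> expect d W g"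
  unfolding expect_def adm_def using Z_pos by (intro divide_right_mono integral_mono mult_right_mono) auto

end

text \<open>Second-order Taylor expansion with an intermediate point t between 0 and -u, where e^t
  is at most the larger of 1 and e^(-u), hence at most their sum.\<close>

lemma exp_minus_quadratic:
  fixes u :: real
  shows "\<bar>exp (- u) - 1 + u\<bar> \<le> u\<^sup>2 / 2 * (1 + exp (- u))"
proof (cases "u = 0")
  case False
  have "\<exists>t. (if - u < 0 then - u < t \<and> t < 0 else 0 < t \<and> t < - u) \<and>
    exp (- u) = (\<Sum>m<2. exp 0 / fact m * (- u - 0) ^ m) + exp t / fact 2 * (- u - 0) ^ 2"
    using False by (intro Taylor[of 2 "\<lambda>_. exp" exp "min 0 (- u)" "max 0 (- u)" 0 "- u"]) auto
  then obtain t where t: "t \<le> max 0 (- u)" "exp (- u) = 1 - u + exp t / 2 * u\<^sup>2"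
    by (auto simp: eval_nat_numeral lessThan_Suc split: if_splits)
  have "exp t \<le> 1 + exp (- u)"
  proof (cases "0 \<le> - u")
    case True
    then have "exp t \<le> exp (- u)" using t(1) by simp
    then show ?thesis by linarith
  next
    case False
    then have "exp t \<le> exp 0" using t(1) by (simp only: exp_le_cancel_iff)
    then show ?thesis using exp_gt_zero[of "- u"] unfolding exp_zero by linarith
  qed
  then have "exp t * (u\<^sup>2 / 2) \<le> (1 + exp (- u)) * (u\<^sup>2 / 2)" by (intro mult_right_mono) auto
  moreover have "\<bar>exp (- u) - 1 + u\<bar> = exp t * (u\<^sup>2 / 2)" unfolding t(2) by simp
  ultimately show ?thesis by (simp only: mult.commute)
qed simp

text \<open>
  With \<open>p/q = e\<^bsup>-R\<^esup>/Z\<close> for the densities, \<open>e\<^bsup>-R\<^esup> - 1 + R\<close> is at most \<open>R\<^sup>2/2 (1 + e\<^bsup>-R\<^esup>)\<close>; the term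
  \<open>R\<^sup>2 e\<^bsup>-R\<^esup>\<close> is integrated against \<open>q\<close> by passing back to \<open>p\<close>, so only second moments of \<open>R\<close> under
  both measures are needed and no exponential moment.
\<close>

lemma TV_expansion:
  assumes cV: "coercive d V" and cQ: "coercive d Q"
    and tR: "tame d R" and tP: "tame d P" and R: "\<And>x. R x = V x - Q x"
    and h: "0 \<le> h" "h \<le> 1/8"
    and RQ: "expect d Q (\<lambda>x. (R x)\<^sup>2) \<le> h" and RV: "expect d V (\<lambda>x. (R x)\<^sup>2) \<le> h"
    and PQ: "expect d Q (\<lambda>x. (P x)\<^sup>2) \<le> h" and RP: "expect d Q (\<lambda>x. \<bar>R x - P x\<bar>) \<le> h"
    and P0: "expect d Q P = 0"
  shows "\<bar>TV (gibbs d V) (gibbs d Q) - 1 / 2 * expect d Q (\<lambda>x. \<bar>P x\<bar>)\<bar> \<le> 12 * h"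
proof -
  interpret Q: coercive_potential d Q by (rule coercive_potential.intro) fact
  let ?e = "\<lambda>x. exp (- R x)"
  have e: "exp (Q x - V x) = ?e x" for x by (simp add: R)
  define Z where "Z = expect d Q ?e"
  note TV = TV_gibbs[OF cV cQ, unfolded e, folded Z_def]
  have adm_e: "Q.adm (\<lambda>x. f x * ?e x)" if "tame d f" for f
  proof -
    have E: "f x * ?e x * exp (- Q x) = f x * exp (- V x)" for x
      by (simp add: R mult.assoc flip: exp_add)
    show ?thesis unfolding Q.adm_def E by (rule integrable_tame[OF that cV])
  qed
  have adm_e1: "Q.adm ?e" using adm_e[OF tame_const[of d 1]] by simp
  note t = Q.adm_tame[OF tame_power[OF tR, of 2]] Q.adm_tame[OF tR] Q.adm_tame[OF tP]
    Q.adm_tame[OF tame_const] Q.adm_tame[OF tame_abs[OF tame_diff[OF tR tP]]]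
    Q.adm_tame[OF tame_abs[OF tP]] adm_e[OF tame_power[OF tR, of 2]] adm_e1
  let ?H = "\<lambda>x. (1/2) * (R x)\<^sup>2 + (1/2) * ((R x)\<^sup>2 * ?e x)"
  have aH: "Q.adm ?H" by (intro Q.adm_add Q.adm_cmult t)
  have Hb: "\<bar>?e x - 1 + R x\<bar> \<le> ?H x" for x
    using exp_minus_quadratic[of "R x"] by (simp add: algebra_simps)
  have EH: "expect d Q ?H \<le> h / 2 * (1 + Z)"
  proof -
    have "expect d Q ?H = (1/2) * expect d Q (\<lambda>x. (R x)\<^sup>2) + (1/2) * (Z * expect d V (\<lambda>x. (R x)\<^sup>2))"
      using TV(3)[of "\<lambda>x. (R x)\<^sup>2"] by (subst Q.E_add_adm) (auto intro!: Q.adm_cmult t simp only: Q.E_cmult)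
    also have "\<dots> \<le> (1/2) * h + (1/2) * (Z * h)"
      using RQ RV TV(2) by (intro add_mono mult_left_mono) auto
    finally show ?thesis by (simp add: algebra_simps)
  qed
  have ER: "\<bar>expect d Q R\<bar> \<le> h"
  proof -
    have "\<bar>expect d Q R - expect d Q P\<bar> \<le> expect d Q (\<lambda>x. \<bar>R x - P x\<bar>)"
      by (rule Q.E_close) (intro tR tP tame_abs tame_diff | simp)+
    then show ?thesis using RP P0 by simp
  qed
  have "Z - 1 + expect d Q R = expect d Q (\<lambda>x. ?e x - 1 + R x)"
    unfolding Q.E_add_adm[OF Q.adm_diff[OF adm_e1 t(4)] t(2)] Q.E_diff_adm[OF adm_e1 t(4)] Z_def by simp
  moreover have "expect d Q (\<lambda>x. ?e x - 1 + R x) \<le> expect d Q ?H"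
    using Hb by (intro Q.E_mono_adm Q.adm_add Q.adm_diff t aH) (auto simp: abs_le_iff)
  moreover have "0 \<le> expect d Q (\<lambda>x. ?e x - 1 + R x)"
  proof (rule Q.E_nonneg)
    show "0 \<le> ?e x - 1 + R x" for x using exp_ge_add_one_self[of "- R x"] by simp
  qed
  ultimately have Z1: "\<bar>Z - 1\<bar> \<le> h + h / 2 * (1 + Z)"
    using EH ER h TV(2) mult_nonneg_nonneg[of h "1 + Z"] by (auto simp: abs_le_iff)
  \<comment> \<open>Bootstrap: h \<le> 1/8 first gives the crude bound Z \<le> 2, which is fed back
    to obtain |Z - 1| \<le> 3 h and then Z \<ge> 1/2.\<close>
  have hZ: "h / 2 * (1 + Z) \<le> 1/16 * (1 + Z)" using h TV(2) by (intro mult_right_mono) auto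
  have Z2: "Z \<le> 2" using Z1 hZ h by (auto simp: abs_le_iff)
  have hZ3: "h / 2 * (1 + Z) \<le> h / 2 * 3" using h Z2 by (intro mult_left_mono) auto
  have Z3: "\<bar>Z - 1\<bar> \<le> 3 * h" using Z1 hZ3 h by linarith
  have Zh: "1/2 \<le> Z" using Z3 h by linarith
  have EP: "expect d Q (\<lambda>x. \<bar>P x\<bar>) \<le> 2"
  proof -
    have "expect d Q (\<lambda>x. \<bar>P x\<bar>) \<le> expect d Q (\<lambda>x. 1 + (P x)\<^sup>2)"
    proof (rule Q.E_mono)
      fix x
      have "0 \<le> (\<bar>P x\<bar> - 1)\<^sup>2" by simp
      then have "2 * \<bar>P x\<bar> \<le> 1 + (P x)\<^sup>2" by (simp add: power2_diff)
      then show "\<bar>P x\<bar> \<le> 1 + (P x)\<^sup>2" by linarith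
    qed (intro tame_abs tame_add tame_const tame_power tP)+
    also have "\<dots> = 1 + expect d Q (\<lambda>x. (P x)\<^sup>2)" by (subst Q.E_add) (auto intro: tame_const tame_power tP)
    finally show ?thesis using PQ h by linarith
  qed
  let ?G = "\<lambda>x. (1/Z) * (?H x + (3 * h + (\<bar>R x - P x\<bar> + (3 * h) * \<bar>P x\<bar>)))"
  have aG: "Q.adm ?G" by (intro Q.adm_cmult Q.adm_add aH t)
  have close: "\<bar>\<bar>?e x / Z - 1\<bar> - \<bar>P x\<bar>\<bar> \<le> ?G x" for x
  proof -
    \<comment> \<open>Four errors are separated: the quadratic remainder of the exponential, the
      normalisation Z, the difference of R and its leading part P, and the effect of Z on P.\<close>
    have "?e x / Z - 1 + P x = (1/Z) * ((?e x - 1 + R x) + ((1 - Z) + (- (R x - P x) + (Z - 1) * P x)))"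
      using Zh by (simp add: field_simps)
    then have "\<bar>?e x / Z - 1 + P x\<bar> = (1/Z) * \<bar>(?e x - 1 + R x) + ((1 - Z) + (- (R x - P x) + (Z - 1) * P x))\<bar>"
      using Zh by (simp add: abs_mult)
    also have "\<dots> \<le> (1/Z) * (?H x + (3 * h + (\<bar>R x - P x\<bar> + (3 * h) * \<bar>P x\<bar>)))"
    proof (intro mult_left_mono)
      have "\<bar>Z - 1\<bar> * \<bar>P x\<bar> \<le> (3 * h) * \<bar>P x\<bar>" by (intro mult_right_mono Z3) auto
      then have "\<bar>(Z - 1) * P x\<bar> \<le> (3 * h) * \<bar>P x\<bar>" by (simp only: abs_mult)
      then show "\<bar>(?e x - 1 + R x) + ((1 - Z) + (- (R x - P x) + (Z - 1) * P x))\<bar>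
          \<le> ?H x + (3 * h + (\<bar>R x - P x\<bar> + (3 * h) * \<bar>P x\<bar>))"
        using Hb[of x] Z3 by linarith
      show "0 \<le> 1 / Z" using Zh by simp
    qed
    finally show ?thesis by linarith
  qed
  have EG_le: "expect d Q ?G \<le> 24 * h"
  proof -
    have "expect d Q ?G = (1/Z) * (expect d Q ?H + (3 * h + (expect d Q (\<lambda>x. \<bar>R x - P x\<bar>) + (3 * h) * expect d Q (\<lambda>x. \<bar>P x\<bar>))))"
      unfolding Q.E_cmult
      by (subst Q.E_add_adm, rule aH, (intro Q.adm_add Q.adm_cmult t)[1],
          subst Q.E_add_adm, rule t(4), (intro Q.adm_add Q.adm_cmult t)[1],
          subst Q.E_add_adm, rule t(5), (intro Q.adm_cmult t)[1]) (simp only: Q.E_cmult Q.E_const)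
    \<comment> \<open>The leading 2 bounds 1/Z and the total is 23 h, rounded up to 24 h; the factor
      1/2 in the total variation formula turns this into the 12 h of the claim.\<close>
    also have "\<dots> \<le> 2 * (h / 2 * 3 + (3 * h + (h + (3 * h) * 2)))"
    proof (rule mult_mono)
      show "1 / Z \<le> 2" using Zh by (simp add: field_simps)
      have "(3 * h) * expect d Q (\<lambda>x. \<bar>P x\<bar>) \<le> (3 * h) * 2" using EP h by (intro mult_left_mono) auto
      then show "expect d Q ?H + (3 * h + (expect d Q (\<lambda>x. \<bar>R x - P x\<bar>) + (3 * h) * expect d Q (\<lambda>x. \<bar>P x\<bar>)))
        \<le> h / 2 * 3 + (3 * h + (h + (3 * h) * 2))"
        using EH hZ3 RP by linarith
      show "0 \<le> expect d Q ?H + (3 * h + (expect d Q (\<lambda>x. \<bar>R x - P x\<bar>) + (3 * h) * expect d Q (\<lambda>x. \<bar>P x\<bar>)))"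
        using h by (intro add_nonneg_nonneg mult_nonneg_nonneg Q.E_nonneg) auto
    qed simp
    also have "\<dots> \<le> 24 * h" using h by simp
    finally show ?thesis .
  qed
  have aE: "Q.adm (\<lambda>x. \<bar>?e x / Z - 1\<bar>)"
  proof -
    have "Q.adm (\<lambda>x. \<bar>(1 / Z) * ?e x - 1\<bar>)" by (intro Q.adm_abs Q.adm_diff Q.adm_cmult t)
    then show ?thesis by simp
  qed
  have up: "expect d Q (\<lambda>x. \<bar>?e x / Z - 1\<bar>) \<le> expect d Q (\<lambda>x. \<bar>P x\<bar> + ?G x)"
    using close by (intro Q.E_mono_adm Q.adm_add aE aG t) (simp add: abs_le_iff diff_le_eq add.commute)
  have lo: "expect d Q (\<lambda>x. \<bar>P x\<bar>) \<le> expect d Q (\<lambda>x. \<bar>?e x / Z - 1\<bar> + ?G x)"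
    using close by (intro Q.E_mono_adm Q.adm_add aE aG t) (simp add: abs_le_iff algebra_simps)
  have "\<bar>expect d Q (\<lambda>x. \<bar>?e x / Z - 1\<bar>) - expect d Q (\<lambda>x. \<bar>P x\<bar>)\<bar> \<le> 24 * h"
    using up lo EG_le unfolding Q.E_add_adm[OF aE aG] Q.E_add_adm[OF t(6) aG] by (simp add: abs_le_iff)
  then show ?thesis unfolding TV(1) by (simp add: abs_le_iff)
qed

section \<open>Constants and conclusion\<close>

lemma divide_le_self: "0 \<le> x \<Longrightarrow> 1 \<le> k \<Longrightarrow> x / k \<le> x" for x k :: real
  using mult_left_mono[of 1 k x] by (simp add: divide_le_eq)

lemma young_scaled:
  fixes u s :: real
  assumes "0 < s" "0 \<le> u"
  shows "u \<le> (1 / s) * u\<^sup>2 + s"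
proof -
  have "0 \<le> (u - s)\<^sup>2" by simp
  then have "2 * (u * s) \<le> u\<^sup>2 + s\<^sup>2" by (simp add: power2_diff)
  moreover have "0 \<le> u * s" using assms by simp
  ultimately have "u * s \<le> u\<^sup>2 + s * s" by (simp add: power2_eq_square)
  then have "u \<le> (u\<^sup>2 + s * s) / s" using assms by (simp only: pos_le_divide_eq)
  then show ?thesis using assms by (simp add: add_divide_distrib)
qed

lemma rescale: "0 < w \<Longrightarrow> (1 / w) * X * (1 + w\<^sup>2 * X) = (1 / w) * X + w * X\<^sup>2" for w X :: real
  by (simp add: field_simps power2_eq_square)

lemma abs_combine: "X = M - U / 2 - w / 2 \<Longrightarrow> \<bar>U\<bar> \<le> u \<Longrightarrow> \<bar>w\<bar> \<le> u' \<Longrightarrow> \<bar>M\<bar> \<le> m \<Longrightarrow> \<bar>X\<bar> \<le> m + u + u'"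
  for X M U w u u' m :: real
  by linarith

lemma young_const: "0 < s \<Longrightarrow> (1 / s) * (K * (s * s)) + s = (1 + K) * s" for s K :: real
  by (simp add: distrib_right)

context smooth_convex
begin

text \<open>All constants depend on \<psi> only, through a, b, al, be and B. \<open>kap\<close> is
  the factor per power of d/n in the moment bounds, \<open>KY\<close> belongs to the mixed moment,
  \<open>Kab\<close> to the cubic form, and \<open>Kh\<close> collects the four hypotheses of
  \<open>TV_expansion\<close>. \<open>Kq\<close>, \<open>Kr\<close>, \<open>Km\<close> enter the
  mean for small \<epsilon>, \<open>KL\<close> and \<open>Kd\<close> the crude bounds for large
  \<epsilon>; \<open>KT\<close> and \<open>KM\<close> are the final constants.\<close>

definition c0 :: real where "c0 = growth_const (min a b) (2 * B)"
definition kap :: real where "kap = 18 / c0"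
definition Kab :: real where "Kab = \<bar>al\<bar> + \<bar>be\<bar> * 3"
definition KY :: real where "KY = 10 / a * kap ^ 2 + (2 * B)\<^sup>2 / a\<^sup>2 * kap ^ 4"
definition Kh :: real where "Kh = Kab\<^sup>2 * KY + B\<^sup>2 * kap ^ 4 + B * kap\<^sup>2 + 1"
text \<open>For \<open>\<epsilon>\<^sup>2 \<le> eta\<close> the expansions apply; above this threshold \<open>1\<close> and \<open>\<epsilon>\<close> are at most \<open>\<epsilon>\<^sup>2 / eta\<close>.\<close>

definition eta :: real where "eta = min 1 (min (c0 / 18) (1 / (8 * Kh)))"
definition KL :: real where "KL = 1 + Kab\<^sup>2 * (30 / (a * (min a b)\<^sup>2))"
definition KT :: real where "KT = 12 * Kh + (1 + KL) / eta"
definition Kq :: real where "Kq = 2 * B * (1 + KY) / a"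
definition Kr :: real where "Kr = (\<bar>be\<bar> * (1 + KY) + B * kap\<^sup>2) / b"
definition Km :: real where "Km = B * (kap + kap\<^sup>2) + \<bar>al\<bar> * Kq + \<bar>be\<bar> * Kr"
definition Kd :: real where "Kd = (\<bar>al\<bar> / a + \<bar>be\<bar> / b) / a + 2 * B * kap / a + (kap + 1 / c0)"
definition KM :: real where "KM = sqrt a * (Km / a + Kd / eta)"

lemma c0_pos: "0 < c0"
  unfolding c0_def using a_pos b_pos B_nonneg by (intro growth_const_pos) auto

lemma kap_pos: "0 < kap"
  using c0_pos by (simp add: kap_def)

lemma KY_nonneg: "0 \<le> KY"
  unfolding KY_def using a_pos kap_pos by (intro add_nonneg_nonneg mult_nonneg_nonneg) auto

lemma Kh_ge: "1 \<le> Kh" "Kab\<^sup>2 * KY + B\<^sup>2 * kap ^ 4 \<le> Kh" "B * kap\<^sup>2 \<le> Kh" "Kab\<^sup>2 * KY \<le> Kh"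
proof -
  have "0 \<le> Kab\<^sup>2 * KY" "0 \<le> B\<^sup>2 * kap ^ 4" "0 \<le> B * kap\<^sup>2"
    using KY_nonneg B_nonneg by (auto intro!: mult_nonneg_nonneg)
  then show "1 \<le> Kh" "Kab\<^sup>2 * KY + B\<^sup>2 * kap ^ 4 \<le> Kh" "B * kap\<^sup>2 \<le> Kh" "Kab\<^sup>2 * KY \<le> Kh"
    unfolding Kh_def by linarith+
qed

lemma eta_pos: "0 < eta" "eta \<le> 1" "eta \<le> c0 / 18" "Kh * eta \<le> 1/8"
proof -
  have k: "0 < Kh" using Kh_ge(1) by linarith
  show "0 < eta" "eta \<le> 1" "eta \<le> c0 / 18" using c0_pos k by (auto simp: eta_def)
  have "Kh * eta \<le> Kh * (1 / (8 * Kh))" using k by (intro mult_left_mono) (auto simp: eta_def)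
  then show "Kh * eta \<le> 1/8" using k by simp
qed

lemma KL_ge: "1 \<le> KL"
  unfolding KL_def using a_pos by simp

lemma Kq_nonneg: "0 \<le> Kq" and Kr_nonneg: "0 \<le> Kr"
  unfolding Kq_def Kr_def using a_pos b_pos B_nonneg KY_nonneg by (auto intro!: divide_nonneg_pos add_nonneg_nonneg)

lemma Km_nonneg: "0 \<le> Km"
  unfolding Km_def using B_nonneg kap_pos Kq_nonneg Kr_nonneg by (auto intro!: add_nonneg_nonneg mult_nonneg_nonneg)

lemma Kd_ge: "0 \<le> Kd" "(\<bar>al\<bar> / a + \<bar>be\<bar> / b) / a + 2 * B * kap / a \<le> Kd"
  "(\<bar>al\<bar> / a + \<bar>be\<bar> / b) / a + (kap + 1 / c0) \<le> Kd"
proof -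
  have "0 \<le> (\<bar>al\<bar> / a + \<bar>be\<bar> / b) / a" "0 \<le> 2 * B * kap / a" "0 \<le> kap + 1 / c0"
    using a_pos b_pos B_nonneg kap_pos c0_pos by auto
  then show "0 \<le> Kd" "(\<bar>al\<bar> / a + \<bar>be\<bar> / b) / a + 2 * B * kap / a \<le> Kd"
    "(\<bar>al\<bar> / a + \<bar>be\<bar> / b) / a + (kap + 1 / c0) \<le> Kd"
    unfolding Kd_def by linarith+
qed

end

context smooth_convex_laplace
begin

section \<open>The target and its Gaussian approximation as instances of the model\<close>

abbreviation "y0 x \<equiv> ys x 0"
abbreviation "s2 x \<equiv> nrm2 d (ys x)"

definition hq :: "nat \<Rightarrow> real" where "hq i = (if i = 0 then a else b)"

lemma sum_hq: "(\<Sum>i<d. hq i * y i * y i) = a * (y 0)\<^sup>2 + b * rho2 d y"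
proof -
  have "(\<Sum>i\<in>{1..<d}. hq i * y i * y i) = b * rho2 d y"
    unfolding rho2_def sum_distrib_left by (intro sum.cong) (auto simp: hq_def power2_eq_square)
  then show ?thesis unfolding sum_split0[OF d1] by (simp add: hq_def power2_eq_square)
qed

text \<open>Since c0 \<le> lam, the quadratic model satisfies the growth condition with the same
  constant as V.\<close>

lemma growth_min: "c0 * min (nrm2 d y) (sqrt (nrm2 d y)) \<le> lam * nrm2 d y"
proof -
  have "growth_const lam (2 * B) \<le> lam / 2 * 1"
    unfolding growth_const_def using lam_pos by (intro mult_left_mono) auto
  then have "c0 \<le> lam" using lam_pos unfolding c0_def lam_def[symmetric] by linarith
  then show ?thesis using lam_pos by (intro mult_mono) auto
qed

lemma pd_Q: "i < d \<Longrightarrow> pd i Q (\<lambda>x. real n * (hq i * ys x i))"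
proof -
  assume i: "i < d"
  have e: "Q = (\<lambda>x. \<Sum>j<d. (hs j / 2) * (x j - e1 j) ^ 2)"
    by (auto simp: Q_def ys_def)
  have "pd i Q (\<lambda>x. \<Sum>j<d. (hs j / 2) * (real 2 * (x j - e1 j) ^ (2 - 1) * ((if j = i then 1 else 0) - 0)))"
    unfolding e by (intro pd_sum pd_cmult pd_power pd_diff pd_coord pd_const)
  then show ?thesis
  proof (rule pd_eq)
    fix x
    have "(\<Sum>j<d. (hs j / 2) * (real 2 * (x j - e1 j) ^ (2 - 1) * ((if j = i then 1 else 0) - 0)))
      = (\<Sum>j<d. if j = i then hs i * (x i - e1 i) else 0)"
      by (intro sum.cong) auto
    also have "\<dots> = hs i * (x i - e1 i)" using i by simp
    also have "\<dots> = real n * (hq i * ys x i)" by (simp add: hs_def hq_def ys_def)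
    finally show "(\<Sum>j<d. (hs j / 2) * (real 2 * (x j - e1 j) ^ (2 - 1) * ((if j = i then 1 else 0) - 0)))
      = real n * (hq i * ys x i)" .
  qed
qed

text \<open>Both instances share c0, hence also \<open>kap\<close>; for Q the linearisation of the
  gradient is exact and C = 0.\<close>

sublocale MV: laplace_model d n e1 V Dv a c0 "2 * B"
proof
  show "c0 * min (nrm2 d (\<lambda>i. x i - e1 i)) (sqrt (nrm2 d (\<lambda>i. x i - e1 i))) \<le> (\<Sum>i<d. Dv i x * (x i - e1 i))" for x
    using Dv_growth[of x] unfolding c0_def lam_def ys_def .
  show "\<bar>Dv 0 x - a * (x 0 - e1 0)\<bar> \<le> 2 * B * nrm2 d (\<lambda>i. x i - e1 i)" for x
    using Dv0_taylor1[of x] unfolding ys_def .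
qed (use d1 n1 coercive_V pd_V tame_Dv a_pos c0_pos B_nonneg in auto)

sublocale MQ: laplace_model d n e1 Q "\<lambda>i x. hq i * ys x i" a c0 0
proof
  show "c0 * min (nrm2 d (\<lambda>i. x i - e1 i)) (sqrt (nrm2 d (\<lambda>i. x i - e1 i))) \<le> (\<Sum>i<d. hq i * ys x i * (x i - e1 i))" for x
  proof -
    have "(\<Sum>i<d. hq i * ys x i * (x i - e1 i)) = a * (y0 x)\<^sup>2 + b * rho2 d (ys x)"
      using sum_hq[of "ys x"] by (simp add: ys_def)
    then show ?thesis using growth_min[of "ys x"] lam_le[of "ys x"] by (simp add: ys_def)
  qed
  show "tame d (\<lambda>x. hq i * ys x i)" if "i < d" for i
    by (intro tame_mult tame_const tame_ys that)
  show "\<bar>hq 0 * ys x 0 - a * (x 0 - e1 0)\<bar> \<le> 0 * nrm2 d (\<lambda>i. x i - e1 i)" for x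
    by (simp add: hq_def ys_def)
qed (use d1 n1 coercive_Q pd_Q a_pos c0_pos in auto)

text \<open>R is the negative logarithm of the density ratio up to normalisation; the shift by V e1
  makes it vanish at e1 and does not change the Gaussian measure (\<open>gibbs_shift\<close>). P is
  its leading, cubic part.\<close>

definition P :: "(nat \<Rightarrow> real) \<Rightarrow> real" where "P x = cub (ys x) / 6"
definition R :: "(nat \<Rightarrow> real) \<Rightarrow> real" where "R x = V x - (Q x + V e1)"

lemma tame_P: "tame d P"
  unfolding P_def[abs_def] by (intro tame_divide tame_cub)

lemma tame_Q: "tame d Q"
  unfolding Q_def[abs_def] by (intro tame_sum tame_divide tame_mult tame_const tame_power tame_ys) auto

lemma tame_R: "tame d R"
  unfolding R_def[abs_def] by (intro tame_diff tame_add tame_const tame_V tame_Q)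

lemma y0_sq_le: "(y0 x)\<^sup>2 \<le> s2 x"
  by (rule coord_sq_le_nrm2[OF d0])

text \<open>One factor y_0 is split off from each monomial, and the remaining two factors are at
  most |y|^2.\<close>

lemma P_bound: "\<bar>P x\<bar> \<le> real n * Kab / 6 * (\<bar>y0 x\<bar> * s2 x)"
proof -
  have 1: "\<bar>y0 x\<bar> ^ 3 \<le> \<bar>y0 x\<bar> * s2 x"
    using mult_left_mono[OF y0_sq_le[of x], of "\<bar>y0 x\<bar>"] by (simp add: power3_eq_cube power2_eq_square)
  have 2: "\<bar>y0 x\<bar> * rho2 d (ys x) \<le> \<bar>y0 x\<bar> * s2 x"
    by (intro mult_left_mono rho2_le_nrm2 d1) auto
  have "\<bar>al * y0 x ^ 3 + 3 * be * y0 x * rho2 d (ys x)\<bar> \<le> \<bar>al * y0 x ^ 3\<bar> + \<bar>3 * be * y0 x * rho2 d (ys x)\<bar>"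
    by (rule abs_triangle_ineq)
  also have "\<dots> = \<bar>al\<bar> * \<bar>y0 x\<bar> ^ 3 + 3 * \<bar>be\<bar> * (\<bar>y0 x\<bar> * rho2 d (ys x))"
    by (simp add: abs_mult power_abs)
  also have "\<dots> \<le> \<bar>al\<bar> * (\<bar>y0 x\<bar> * s2 x) + 3 * \<bar>be\<bar> * (\<bar>y0 x\<bar> * s2 x)"
    by (intro add_mono mult_left_mono[OF 1] mult_left_mono[OF 2]) auto
  also have "\<dots> = Kab * (\<bar>y0 x\<bar> * s2 x)" by (simp add: Kab_def algebra_simps)
  finally have "real n * \<bar>al * y0 x ^ 3 + 3 * be * y0 x * rho2 d (ys x)\<bar> \<le> real n * (Kab * (\<bar>y0 x\<bar> * s2 x))"
    by (rule mult_left_mono) simp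
  then show ?thesis by (simp add: P_def cub_def abs_mult)
qed

lemma R_P_bound: "\<bar>R x - P x\<bar> \<le> real n * B / 8 * (s2 x)\<^sup>2"
proof -
  have q: "Q x = real n * ((a * (y0 x)\<^sup>2 + b * rho2 d (ys x)) / 2)"
  proof -
    have "Q x = real n / 2 * (\<Sum>i<d. hq i * ys x i * ys x i)"
      unfolding Q_def sum_distrib_left by (intro sum.cong) (auto simp: hs_def hq_def power2_eq_square)
    then show ?thesis unfolding sum_hq by simp
  qed
  have "R x - P x = real n * (v x - v e1 - (a * (y0 x)\<^sup>2 + b * rho2 d (ys x)) / 2 - (al * (y0 x) ^ 3 + 3 * be * y0 x * rho2 d (ys x)) / 6)"
    unfolding R_def P_def q cub_def V_def by (simp add: right_diff_distrib)
  then have "\<bar>R x - P x\<bar> = real n * \<bar>v x - v e1 - (a * (y0 x)\<^sup>2 + b * rho2 d (ys x)) / 2 - (al * (y0 x) ^ 3 + 3 * be * y0 x * rho2 d (ys x)) / 6\<bar>"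
    by (simp add: abs_mult)
  also have "\<dots> \<le> real n * (B / 8 * (s2 x)\<^sup>2)" by (intro mult_left_mono v_taylor) auto
  finally show ?thesis by simp
qed

lemma P_sq_bound: "(P x)\<^sup>2 \<le> (real n)\<^sup>2 * Kab\<^sup>2 / 36 * ((y0 x)\<^sup>2 * (s2 x)\<^sup>2)"
proof -
  have "(P x)\<^sup>2 \<le> (real n * Kab / 6 * (\<bar>y0 x\<bar> * s2 x))\<^sup>2"
    using P_bound[of x] abs_ge_zero[of "P x"] by (subst power2_abs[symmetric], intro power_mono) auto
  also have "\<dots> = (real n)\<^sup>2 * Kab\<^sup>2 / 36 * ((y0 x)\<^sup>2 * (s2 x)\<^sup>2)"
    by (simp add: power_mult_distrib power_divide)
  finally show ?thesis .
qed

lemma R_sq_bound: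
  "(R x)\<^sup>2 \<le> (real n)\<^sup>2 * Kab\<^sup>2 * ((y0 x)\<^sup>2 * (s2 x)\<^sup>2) + (real n)\<^sup>2 * B\<^sup>2 * (s2 x) ^ 4"
proof -
  have a1: "(R x - P x)\<^sup>2 \<le> (real n * B / 8 * (s2 x)\<^sup>2)\<^sup>2"
    using R_P_bound[of x] abs_ge_zero[of "R x - P x"] by (subst power2_abs[symmetric], intro power_mono) auto
  have a2: "(real n * B / 8 * (s2 x)\<^sup>2)\<^sup>2 = (real n)\<^sup>2 * B\<^sup>2 * (s2 x) ^ 4 / 64"
    by (simp add: power_mult_distrib power_divide flip: power_mult)
  have a3: "(R x)\<^sup>2 \<le> 2 * (P x)\<^sup>2 + 2 * (R x - P x)\<^sup>2"
  proof -
    have "0 \<le> (2 * P x - R x)\<^sup>2" by simp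
    then show ?thesis by (simp add: power2_eq_square algebra_simps)
  qed
  have p1: "0 \<le> (real n)\<^sup>2 * Kab\<^sup>2 * ((y0 x)\<^sup>2 * (s2 x)\<^sup>2)" "0 \<le> (real n)\<^sup>2 * B\<^sup>2 * (s2 x) ^ 4" by auto
  have "(P x)\<^sup>2 \<le> (real n)\<^sup>2 * Kab\<^sup>2 * ((y0 x)\<^sup>2 * (s2 x)\<^sup>2) / 36" using P_sq_bound[of x] by simp
  then show ?thesis using a1 a3 p1 unfolding a2 by linarith
qed

lemma tame_s2: "tame d s2"
  by (rule tame_nrm2)

lemmas tame_rules_ys = tame_mult tame_const tame_power tame_ys tame_s2 tame_rho2 tame_abs tame_add tame_diff d0

lemma tame_small_bound:
  assumes f: "tame d f" "\<And>x. f x \<le> k1 * ((y0 x)\<^sup>2 * (s2 x)\<^sup>2) + k2 * (s2 x) ^ 4"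
    and k: "0 \<le> k1" "0 \<le> k2"
    and W: "coercive d W" and Y: "expect d W (\<lambda>x. (y0 x)\<^sup>2 * (s2 x)\<^sup>2) \<le> e1'" and M: "expect d W (\<lambda>x. (s2 x) ^ 4) \<le> e2'"
  shows "expect d W f \<le> k1 * e1' + k2 * e2'"
proof -
  interpret W: coercive_potential d W by (rule coercive_potential.intro) fact
  have "expect d W f \<le> expect d W (\<lambda>x. k1 * ((y0 x)\<^sup>2 * (s2 x)\<^sup>2) + k2 * (s2 x) ^ 4)"
    by (intro W.E_mono f) (intro tame_rules_ys)
  also have "\<dots> = k1 * expect d W (\<lambda>x. (y0 x)\<^sup>2 * (s2 x)\<^sup>2) + k2 * expect d W (\<lambda>x. (s2 x) ^ 4)"
    by (subst W.E_lin2) (intro tame_rules_ys | simp only: W.E_cmult)+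
  also have "\<dots> \<le> k1 * e1' + k2 * e2'" using k Y M by (intro add_mono mult_left_mono) auto
  finally show ?thesis .
qed

abbreviation "\<epsilon>2 \<equiv> (real d)\<^sup>2 / real n"

lemma scale3: "(real n)\<^sup>2 * ((real d)\<^sup>2 / (real n) ^ 3) = \<epsilon>2"
  using n_pos by (simp add: field_simps eval_nat_numeral)

lemma MQ_KY: "(10 / a * kap ^ 2 + 0\<^sup>2 / a\<^sup>2 * kap ^ 4) \<le> KY"
  unfolding KY_def using a_pos by simp

section \<open>Moments of the remainder for small d/n\<close>

context
  assumes small: "18 * real d \<le> c0 * real n" "(real d)\<^sup>2 \<le> real n"
begin

lemma small_V:
  "expect d V s2 \<le> kap * (real d / real n)"
  "expect d V (\<lambda>x. (s2 x)\<^sup>2) \<le> kap\<^sup>2 * ((real d)\<^sup>2 / (real n)\<^sup>2)"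
  "expect d V (\<lambda>x. (s2 x) ^ 4) \<le> kap ^ 4 * ((real d)\<^sup>2 / (real n) ^ 3)"
  "expect d V (\<lambda>x. (y0 x)\<^sup>2 * (s2 x)\<^sup>2) \<le> KY * ((real d)\<^sup>2 / (real n) ^ 3)"
  using MV.moments_small[OF small] unfolding kap_def KY_def ys_def by auto

lemma small_Q:
  "expect d Q (\<lambda>x. (s2 x)\<^sup>2) \<le> kap\<^sup>2 * ((real d)\<^sup>2 / (real n)\<^sup>2)"
  "expect d Q (\<lambda>x. (s2 x) ^ 4) \<le> kap ^ 4 * ((real d)\<^sup>2 / (real n) ^ 3)"
  "expect d Q (\<lambda>x. (y0 x)\<^sup>2 * (s2 x)\<^sup>2) \<le> KY * ((real d)\<^sup>2 / (real n) ^ 3)"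
proof -
  show "expect d Q (\<lambda>x. (s2 x)\<^sup>2) \<le> kap\<^sup>2 * ((real d)\<^sup>2 / (real n)\<^sup>2)"
    "expect d Q (\<lambda>x. (s2 x) ^ 4) \<le> kap ^ 4 * ((real d)\<^sup>2 / (real n) ^ 3)"
    using MQ.moments_small[OF small] unfolding kap_def ys_def by auto
  have "expect d Q (\<lambda>x. (y0 x)\<^sup>2 * (s2 x)\<^sup>2) \<le> (10 / a * kap ^ 2 + 0\<^sup>2 / a\<^sup>2 * kap ^ 4) * ((real d)\<^sup>2 / (real n) ^ 3)"
    using MQ.moments_small(4)[OF small] unfolding kap_def ys_def .
  also have "\<dots> \<le> KY * ((real d)\<^sup>2 / (real n) ^ 3)" by (intro mult_right_mono MQ_KY) auto
  finally show "expect d Q (\<lambda>x. (y0 x)\<^sup>2 * (s2 x)\<^sup>2) \<le> KY * ((real d)\<^sup>2 / (real n) ^ 3)" .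
qed

text \<open>The measure is left general because \<open>TV_expansion\<close> asks for the second
  moment of R under both V and Q.\<close>

lemma E_R_sq:
  assumes "coercive d W" "expect d W (\<lambda>x. (s2 x) ^ 4) \<le> kap ^ 4 * ((real d)\<^sup>2 / (real n) ^ 3)"
    "expect d W (\<lambda>x. (y0 x)\<^sup>2 * (s2 x)\<^sup>2) \<le> KY * ((real d)\<^sup>2 / (real n) ^ 3)"
  shows "expect d W (\<lambda>x. (R x)\<^sup>2) \<le> Kh * \<epsilon>2"
proof -
  have "expect d W (\<lambda>x. (R x)\<^sup>2) \<le> (real n)\<^sup>2 * Kab\<^sup>2 * (KY * ((real d)\<^sup>2 / (real n) ^ 3))
      + (real n)\<^sup>2 * B\<^sup>2 * (kap ^ 4 * ((real d)\<^sup>2 / (real n) ^ 3))"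
    by (rule tame_small_bound[OF tame_power[OF tame_R] R_sq_bound]) (use assms in auto)
  also have "\<dots> = (Kab\<^sup>2 * KY + B\<^sup>2 * kap ^ 4) * ((real n)\<^sup>2 * ((real d)\<^sup>2 / (real n) ^ 3))"
    by (simp add: algebra_simps)
  also have "\<dots> \<le> Kh * \<epsilon>2" unfolding scale3 by (intro mult_right_mono Kh_ge) auto
  finally show ?thesis .
qed

lemma E_P_sq: "expect d Q (\<lambda>x. (P x)\<^sup>2) \<le> Kh * \<epsilon>2"
proof -
  have "expect d Q (\<lambda>x. (P x)\<^sup>2) \<le> (real n)\<^sup>2 * Kab\<^sup>2 / 36 * (KY * ((real d)\<^sup>2 / (real n) ^ 3)) + 0 * (kap ^ 4 * ((real d)\<^sup>2 / (real n) ^ 3))"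
    by (rule tame_small_bound[OF tame_power[OF tame_P]]) (use P_sq_bound small_Q coercive_Q in auto)
  also have "\<dots> = Kab\<^sup>2 * KY * ((real n)\<^sup>2 * ((real d)\<^sup>2 / (real n) ^ 3)) / 36"
    by (simp add: algebra_simps)
  also have "\<dots> \<le> Kab\<^sup>2 * KY * \<epsilon>2"
    unfolding scale3 using KY_nonneg by (intro divide_le_self) auto
  also have "\<dots> \<le> Kh * \<epsilon>2" by (intro mult_right_mono Kh_ge) auto
  finally show ?thesis .
qed

lemma E_R_P: "expect d Q (\<lambda>x. \<bar>R x - P x\<bar>) \<le> Kh * \<epsilon>2"
proof -
  have "expect d Q (\<lambda>x. \<bar>R x - P x\<bar>) \<le> expect d Q (\<lambda>x. real n * B / 8 * (s2 x)\<^sup>2)"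
    by (intro MQ.E_mono R_P_bound) (intro tame_rules_ys tame_R tame_P)+
  also have "\<dots> \<le> real n * B / 8 * (kap\<^sup>2 * ((real d)\<^sup>2 / (real n)\<^sup>2))"
    unfolding MQ.E_cmult using B_nonneg by (intro mult_left_mono small_Q) auto
  also have "\<dots> = B * kap\<^sup>2 * \<epsilon>2 / 8" using n_pos by (simp add: field_simps power2_eq_square)
  also have "\<dots> \<le> B * kap\<^sup>2 * \<epsilon>2"
    using B_nonneg by (intro divide_le_self) auto
  also have "\<dots> \<le> Kh * \<epsilon>2" by (intro mult_right_mono Kh_ge) auto
  finally show ?thesis .
qed

end

text \<open>Every monomial is odd in y_0. The vanishing is read off from integration by parts, where
  E f y_0 is the mean of the y_0-derivative of f divided by n a, with f = 1, y_0^2 and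
  rho^2.\<close>

lemma E_Q_P: "expect d Q P = 0"
proof -
  have ib: "expect d Q (\<lambda>x. f x * y0 x) = expect d Q f' / (real n * a)"
    if "tame d f" "tame d f'" "pd 0 f f'" for f f'
  proof -
    have "expect d Q (\<lambda>x. f x * (hq 0 * ys x 0)) = expect d Q f' / real n"
      by (rule MQ.ibp[OF d0 that])
    moreover have "expect d Q (\<lambda>x. f x * (hq 0 * ys x 0)) = a * expect d Q (\<lambda>x. f x * y0 x)"
      unfolding MQ.E_cmult[symmetric] by (simp add: hq_def mult_ac)
    ultimately show ?thesis using a_pos n_pos by (simp add: field_simps)
  qed
  have pdy: "pd 0 y0 (\<lambda>_. 1)" using MQ.pd_y[of 0] unfolding ys_def .
  have "expect d Q (\<lambda>x. 1 * y0 x) = expect d Q (\<lambda>_. 0) / (real n * a)"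
    by (rule ib) (intro tame_const pd_const)+
  then have 1: "expect d Q y0 = 0" by simp
  have "pd 0 (\<lambda>x. y0 x ^ 2) (\<lambda>x. real 2 * y0 x ^ (2 - 1) * 1)" by (intro pd_power pdy)
  then have "expect d Q (\<lambda>x. y0 x ^ 2 * y0 x) = expect d Q (\<lambda>x. real 2 * y0 x ^ (2 - 1) * 1) / (real n * a)"
    by (intro ib) (intro tame_rules_ys)+
  then have 3: "expect d Q (\<lambda>x. y0 x ^ 3) = 0"
    using 1 by (simp add: MQ.E_cmult eval_nat_numeral mult.assoc)
  have "expect d Q (\<lambda>x. rho2 d (ys x) * y0 x) = expect d Q (\<lambda>_. 0) / (real n * a)"
  proof (rule ib)
    show "pd 0 (\<lambda>x. rho2 d (ys x)) (\<lambda>_. 0)"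
      by (rule pd_indep) (auto simp: rho2_def ys_def intro!: sum.cong)
  qed (intro tame_rules_ys)+
  then have r: "expect d Q (\<lambda>x. rho2 d (ys x) * y0 x) = 0" by simp
  have "P = (\<lambda>x. (real n * al / 6) * y0 x ^ 3 + (real n * be / 2) * (rho2 d (ys x) * y0 x))"
    by (auto simp: P_def cub_def field_simps)
  then have "expect d Q P = (real n * al / 6) * expect d Q (\<lambda>x. y0 x ^ 3) + expect d Q (\<lambda>x. (real n * be / 2) * (rho2 d (ys x) * y0 x))"
    by (simp only:) (rule MQ.E_lin2; intro tame_rules_ys)
  then show ?thesis unfolding MQ.E_cmult 3 r by simp
qed

lemma L_TV_P: "L_TV d V e1 = 1 / 2 * expect d Q (\<lambda>x. \<bar>P x\<bar>)"
  unfolding L_TV_V P_def by (simp add: MQ.E_divide)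

lemma TV_Q_shift: "TV (gibbs d V) (gibbs d (\<lambda>x. Q x + V e1)) = TV (gibbs d V) (gibbs d Q)"
  by (simp add: gibbs_shift)

lemma TV_small:
  assumes e: "\<epsilon>2 \<le> eta" and small: "18 * real d \<le> c0 * real n" "(real d)\<^sup>2 \<le> real n"
  shows "\<bar>TV (gibbs d V) (gibbs d Q) - L_TV d V e1\<bar> \<le> 12 * (Kh * \<epsilon>2)"
proof -
  have Kp: "0 \<le> Kh" using Kh_ge(1) by linarith
  have h: "0 \<le> Kh * \<epsilon>2" "Kh * \<epsilon>2 \<le> 1/8"
    using Kp order_trans[OF mult_left_mono[OF e Kp] eta_pos(4)] by simp_all
  have "\<bar>TV (gibbs d V) (gibbs d (\<lambda>x. Q x + V e1)) - 1 / 2 * expect d (\<lambda>x. Q x + V e1) (\<lambda>x. \<bar>P x\<bar>)\<bar> \<le> 12 * (Kh * \<epsilon>2)"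
  proof (rule TV_expansion[OF coercive_V coercive_shift[OF coercive_Q] tame_R tame_P R_def h])
    show "expect d (\<lambda>x. Q x + V e1) (\<lambda>x. (R x)\<^sup>2) \<le> Kh * \<epsilon>2"
      unfolding expect_shift by (rule E_R_sq[OF small coercive_Q small_Q(2,3)[OF small]])
    show "expect d V (\<lambda>x. (R x)\<^sup>2) \<le> Kh * \<epsilon>2"
      by (rule E_R_sq[OF small coercive_V small_V(3,4)[OF small]])
    show "expect d (\<lambda>x. Q x + V e1) (\<lambda>x. (P x)\<^sup>2) \<le> Kh * \<epsilon>2"
      unfolding expect_shift by (rule E_P_sq[OF small])
    show "expect d (\<lambda>x. Q x + V e1) (\<lambda>x. \<bar>R x - P x\<bar>) \<le> Kh * \<epsilon>2"
      unfolding expect_shift by (rule E_R_P[OF small])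
    show "expect d (\<lambda>x. Q x + V e1) P = 0" unfolding expect_shift by (rule E_Q_P)
  qed
  then show ?thesis unfolding TV_Q_shift expect_shift L_TV_P .
qed

lemma small_of_eta:
  assumes "\<epsilon>2 \<le> eta"
  shows "18 * real d \<le> c0 * real n" "(real d)\<^sup>2 \<le> real n"
proof -
  have 1: "(real d)\<^sup>2 \<le> eta * real n" using assms n_pos by (simp add: field_simps)
  have "eta * real n \<le> 1 * real n" "eta * real n \<le> c0 / 18 * real n"
    using eta_pos n_pos by (auto intro!: mult_right_mono)
  moreover have "real d * 1 \<le> real d * real d" using d1 by (intro mult_left_mono) auto
  ultimately show "18 * real d \<le> c0 * real n" "(real d)\<^sup>2 \<le> real n"
    using 1 by (auto simp: power2_eq_square)
qed

abbreviation "\<epsilon> \<equiv> real d / sqrt (real n)"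

lemma eps_sq: "\<epsilon>\<^sup>2 = \<epsilon>2"
  by (simp add: power_divide)

lemma eps_pos: "0 < \<epsilon>"
  using d0 n_pos by simp

text \<open>This must hold for every \<epsilon>, so the Gaussian moments come from
  \<open>moment_quadratic_step\<close>, which requires no smallness. Young at scale \<epsilon>, |P|
  \<le> P^2/\<epsilon> + \<epsilon>, converts the second moment into the first; 30 is 10 from
  \<open>mixed_moment\<close> times 3 from d + 2 \<le> 3 d.\<close>

lemma L_bound: "L_TV d V e1 \<le> KL * \<epsilon>"
proof -
  let ?M = "\<lambda>k. expect d Q (\<lambda>x. s2 x ^ k)"
  let ?l = "min a b"
  have l: "0 < ?l" using a_pos b_pos by simp
  have S: "?l * nrm2 d (\<lambda>i. x i - e1 i) \<le> MQ.S x" for x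
  proof -
    have "MQ.S x = (\<Sum>i<d. hq i * ys x i * ys x i)"
      unfolding MQ.S_def by (simp add: ys_def)
    then show ?thesis using lam_le[of "ys x"] unfolding sum_hq lam_def by (simp add: ys_def)
  qed
  have st: "?M (Suc k) \<le> (real d + 2 * real k) / (?l * real n) * ?M k" for k
    using MQ.moment_quadratic_step[OF l S, of k] unfolding ys_def .
  have ln: "0 < ?l * real n" using l n_pos by simp
  have M1: "?M 1 \<le> real d / (?l * real n)" using st[of 0] by simp
  have "?M 2 \<le> (real d + 2 * real 1) / (?l * real n) * ?M 1" using st[of 1] by (simp add: numeral_2_eq_2)
  also have "\<dots> \<le> (3 * real d / (?l * real n)) * (real d / (?l * real n))"
    using M1 d1 ln by (intro mult_mono divide_right_mono) (auto intro: MQ.E_nonneg)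
  also have "\<dots> = 3 * (real d)\<^sup>2 / (?l\<^sup>2 * (real n)\<^sup>2)" by (simp add: power2_eq_square mult_ac)
  finally have M2: "?M 2 \<le> 3 * (real d)\<^sup>2 / (?l\<^sup>2 * (real n)\<^sup>2)" .
  have "expect d Q (\<lambda>x. (y0 x)\<^sup>2 * (s2 x)\<^sup>2) \<le> 10 / (a * real n) * ?M 2"
    using MQ.mixed_moment unfolding ys_def by simp
  also have "\<dots> \<le> 10 / (a * real n) * (3 * (real d)\<^sup>2 / (?l\<^sup>2 * (real n)\<^sup>2))"
    using M2 a_pos n_pos by (intro mult_left_mono) auto
  also have "\<dots> = 30 / (a * ?l\<^sup>2) * ((real d)\<^sup>2 / (real n) ^ 3)"
    by (simp add: power2_eq_square power3_eq_cube)
  finally have Y: "expect d Q (\<lambda>x. (y0 x)\<^sup>2 * (s2 x)\<^sup>2) \<le> 30 / (a * ?l\<^sup>2) * ((real d)\<^sup>2 / (real n) ^ 3)" .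
  have "expect d Q (\<lambda>x. (P x)\<^sup>2) \<le> (real n)\<^sup>2 * Kab\<^sup>2 / 36 * (30 / (a * ?l\<^sup>2) * ((real d)\<^sup>2 / (real n) ^ 3)) + 0 * ?M 4"
    by (rule tame_small_bound[OF tame_power[OF tame_P]]) (use P_sq_bound Y coercive_Q in auto)
  also have "\<dots> = Kab\<^sup>2 * (30 / (a * ?l\<^sup>2)) * ((real n)\<^sup>2 * ((real d)\<^sup>2 / (real n) ^ 3)) / 36"
    by simp
  also have "\<dots> \<le> Kab\<^sup>2 * (30 / (a * ?l\<^sup>2)) * \<epsilon>\<^sup>2"
    unfolding scale3 eps_sq using a_pos by (intro divide_le_self) auto
  finally have EP: "expect d Q (\<lambda>x. (P x)\<^sup>2) \<le> Kab\<^sup>2 * (30 / (a * ?l\<^sup>2)) * \<epsilon>\<^sup>2" .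
  have "expect d Q (\<lambda>x. \<bar>P x\<bar>) \<le> expect d Q (\<lambda>x. (1 / \<epsilon>) * (P x)\<^sup>2 + \<epsilon>)"
  proof (rule MQ.E_mono)
    fix x
    show "\<bar>P x\<bar> \<le> (1 / \<epsilon>) * (P x)\<^sup>2 + \<epsilon>"
      using young_scaled[OF eps_pos, of "\<bar>P x\<bar>"] by (simp only: power2_abs abs_ge_zero)
  qed (intro tame_rules_ys tame_P)+
  also have "\<dots> = (1 / \<epsilon>) * expect d Q (\<lambda>x. (P x)\<^sup>2) + \<epsilon>"
    by (subst MQ.E_lin2) (intro tame_rules_ys tame_P | simp only: MQ.E_const)+
  also have "\<dots> \<le> (1 / \<epsilon>) * (Kab\<^sup>2 * (30 / (a * ?l\<^sup>2)) * \<epsilon>\<^sup>2) + \<epsilon>"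
    using EP eps_pos by (intro add_right_mono mult_left_mono) auto
  also have "\<dots> = KL * \<epsilon>"
    unfolding KL_def power2_eq_square[of \<epsilon>] by (rule young_const[OF eps_pos])
  finally have "expect d Q (\<lambda>x. \<bar>P x\<bar>) \<le> KL * \<epsilon>" .
  moreover have "0 \<le> expect d Q (\<lambda>x. \<bar>P x\<bar>)" by (rule MQ.E_nonneg) simp
  ultimately show ?thesis unfolding L_TV_P by linarith
qed

lemma eps_large:
  assumes "eta < \<epsilon>2"
  shows "1 \<le> \<epsilon>2 / eta" "\<epsilon> \<le> \<epsilon>2 / eta"
proof -
  show "1 \<le> \<epsilon>2 / eta" using assms eta_pos(1) by (simp only: pos_le_divide_eq)
  have "eta \<le> \<epsilon>"
  proof (rule ccontr)
    assume "\<not> eta \<le> \<epsilon>"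
    then have "\<epsilon>\<^sup>2 \<le> eta * eta" unfolding power2_eq_square using eps_pos by (intro mult_mono) auto
    also have "\<dots> \<le> 1 * eta" using eta_pos by (intro mult_right_mono) auto
    finally show False using assms unfolding eps_sq by simp
  qed
  then have "\<epsilon> * eta \<le> \<epsilon> * \<epsilon>" using eps_pos by (intro mult_left_mono) auto
  then have "\<epsilon> * eta \<le> \<epsilon>\<^sup>2" unfolding power2_eq_square[of \<epsilon>] .
  then have "\<epsilon> * eta \<le> \<epsilon>2" unfolding eps_sq .
  then show "\<epsilon> \<le> \<epsilon>2 / eta" using eta_pos(1) by (simp only: pos_le_divide_eq)
qed

text \<open>Below the threshold the expansion applies with h = Kh \<epsilon>^2. Above it the
  distance is at most 1 and L_TV at most KL \<epsilon>, both of which are multiples of \<epsilon>^2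
  by \<open>eps_large\<close>.\<close>

theorem TV_bound: "\<bar>TV (gibbs d V) (gibbs d Q) - L_TV d V e1\<bar> \<le> KT * \<epsilon>2"
proof (cases "\<epsilon>2 \<le> eta")
  case True
  have "\<bar>TV (gibbs d V) (gibbs d Q) - L_TV d V e1\<bar> \<le> 12 * Kh * \<epsilon>2"
    using TV_small[OF True small_of_eta[OF True]] by simp
  also have "\<dots> \<le> KT * \<epsilon>2"
    unfolding KT_def using KL_ge eta_pos(1) by (intro mult_right_mono) auto
  finally show ?thesis .
next
  case False
  then have e: "1 \<le> \<epsilon>2 / eta" "\<epsilon> \<le> \<epsilon>2 / eta" using eps_large by auto
  have f: "1 * (x / t) + KL * (x / t) = (1 + KL) / t * x" for x t :: real
    by (simp add: add_divide_distrib distrib_right)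
  have "0 \<le> L_TV d V e1" unfolding L_TV_P using MQ.E_nonneg[of "\<lambda>x. \<bar>P x\<bar>"] by simp
  then have "\<bar>TV (gibbs d V) (gibbs d Q) - L_TV d V e1\<bar> \<le> 1 + L_TV d V e1"
    using TV_nonneg_le_1[OF coercive_V coercive_Q] by linarith
  also have "\<dots> \<le> 1 * (\<epsilon>2 / eta) + KL * (\<epsilon>2 / eta)"
  proof (intro add_mono)
    show "L_TV d V e1 \<le> KL * (\<epsilon>2 / eta)"
      by (rule order_trans[OF L_bound]) (use e KL_ge in \<open>intro mult_left_mono; simp\<close>)
  qed (use e in simp)
  also have "1 * (\<epsilon>2 / eta) + KL * (\<epsilon>2 / eta) = (1 + KL) / eta * \<epsilon>2" by (rule f)
  also have "\<dots> \<le> KT * \<epsilon>2"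
    unfolding KT_def using Kh_ge(1) by (intro mult_right_mono) auto
  finally show ?thesis .
qed

text \<open>The scale \<epsilon>^2/sqrt n: the norm given by H multiplies the first coordinate by
  sqrt (n a), so the error of the mean has to be controlled at this size.\<close>

definition sg :: real where "sg = (real d)\<^sup>2 / (real n * sqrt (real n))"

lemma sqrt_n: "1 \<le> sqrt (real n)" "sqrt (real n) \<le> real n" "sqrt (real n) * sqrt (real n) = real n"
  "0 < sqrt (real n)"
proof -
  show 1: "1 \<le> sqrt (real n)" using n1 by simp
  show 3: "sqrt (real n) * sqrt (real n) = real n" by simp
  show "0 < sqrt (real n)" using n_pos by simp
  have "sqrt (real n) * 1 \<le> sqrt (real n) * sqrt (real n)" using 1 by (intro mult_left_mono) auto
  then show "sqrt (real n) \<le> real n" using 3 by simp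
qed

lemma sg_ge:
  "real d / (real n * sqrt (real n)) \<le> sg" "(real d)\<^sup>2 / (real n)\<^sup>2 \<le> sg" "sqrt (real n) * sg = \<epsilon>2"
  "sqrt (real n) * ((real d)\<^sup>2 / (real n)\<^sup>2) = sg"
proof -
  have "real d * 1 \<le> real d * real d" using d1 by (intro mult_left_mono) auto
  then show "real d / (real n * sqrt (real n)) \<le> sg"
    unfolding sg_def power2_eq_square using n_pos by (intro divide_right_mono) auto
  show "(real d)\<^sup>2 / (real n)\<^sup>2 \<le> sg"
    unfolding sg_def power2_eq_square[of "real n"] using sqrt_n n_pos
    by (intro divide_left_mono mult_left_mono mult_pos_pos) auto
  show "sqrt (real n) * sg = \<epsilon>2" unfolding sg_def using sqrt_n(4) by simp
  have "real n = sqrt (real n) * sqrt (real n)" by simp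
  then have "sqrt (real n) / (real n * real n) = 1 / (real n * sqrt (real n))"
    using n_pos sqrt_n(4) by (simp add: field_simps)
  then have "(real d)\<^sup>2 * (sqrt (real n) / (real n * real n)) = (real d)\<^sup>2 * (1 / (real n * sqrt (real n)))"
    by (simp only:)
  then show "sqrt (real n) * ((real d)\<^sup>2 / (real n)\<^sup>2) = sg"
    unfolding sg_def power2_eq_square[of "real n"] by (simp add: mult.commute)
qed

text \<open>The right-hand side is -(al E y_0^2 + be E rho^2)/2 with the leading values 1/(n a) and
  (d - 1)/(n b) inserted, so dx0 solves the averaged stationarity equation to leading order.\<close>

lemma E_y0_decomp: "a * dx0 = - (al * (1 / (real n * a)) + be * ((real d - 1) / (real n * b))) / 2"
  unfolding dx0_def using a_pos b_pos n_pos by (simp add: field_simps)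

text \<open>Averaging the expansion of Dv_0, whose mean under \<pi> is zero, expresses a E y_0
  through two second moments; these are found by two further integrations by parts, each with an
  error of order sg.\<close>

lemma mean_small:
  assumes small: "18 * real d \<le> c0 * real n" "(real d)\<^sup>2 \<le> real n"
  shows "a * \<bar>expect d V y0 - dx0\<bar> \<le> Km * sg"
proof -
  let ?N = "expect d V (\<lambda>x. \<bar>y0 x\<bar> * s2 x)" and ?q = "expect d V (\<lambda>x. (y0 x)\<^sup>2)" and ?r = "expect d V (\<lambda>x. rho2 d (ys x))"
  let ?s = "real d / (real n * sqrt (real n))"
  have s: "0 < ?s" using d0 n_pos by simp
  note sm = small_V[OF small]
  have M2: "expect d V (\<lambda>x. (s2 x)\<^sup>2) \<le> kap\<^sup>2 * sg"
    using sm(2) mult_left_mono[OF sg_ge(2), of "kap\<^sup>2"] by simp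
  have s3: "(real d)\<^sup>2 / (real n) ^ 3 = ?s * ?s"
  proof -
    have "?s * ?s = (real d)\<^sup>2 / (real n * real n * (sqrt (real n) * sqrt (real n)))"
      by (simp add: power2_eq_square)
    then show ?thesis unfolding sqrt_n(3) by (simp add: power3_eq_cube)
  qed
  \<comment> \<open>Young at scale s = d/n^(3/2): the second moment of |y_0| |y|^2 is at most KY
    s^2, so its mean is of order s, which is at most sg.\<close>
  have N: "?N \<le> (1 + KY) * sg"
  proof -
    have "?N \<le> expect d V (\<lambda>x. (1 / ?s) * ((y0 x)\<^sup>2 * (s2 x)\<^sup>2) + ?s)"
    proof (rule MV.E_mono)
      fix x
      show "\<bar>y0 x\<bar> * s2 x \<le> (1 / ?s) * ((y0 x)\<^sup>2 * (s2 x)\<^sup>2) + ?s"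
        using young_scaled[OF s, of "\<bar>y0 x\<bar> * s2 x"] by (simp only: power_mult_distrib power2_abs) simp
    qed (intro tame_rules_ys)+
    also have "\<dots> = (1 / ?s) * expect d V (\<lambda>x. (y0 x)\<^sup>2 * (s2 x)\<^sup>2) + ?s"
      by (subst MV.E_lin2) (intro tame_rules_ys | simp only: MV.E_const)+
    also have "\<dots> \<le> (1 / ?s) * (KY * (?s * ?s)) + ?s"
      using sm(4) s unfolding s3 by (intro add_right_mono mult_left_mono) auto
    also have "(1 / ?s) * (KY * (?s * ?s)) + ?s = (1 + KY) * ?s" by (rule young_const[OF s])
    also have "\<dots> \<le> (1 + KY) * sg" using KY_nonneg by (intro mult_left_mono sg_ge) auto
    finally show ?thesis .
  qed
  \<comment> \<open>Test function y_0: the mean of Dv_0 y_0 is 1/n, and Dv_0 equals a y_0 up to 2 B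
    |y|^2.\<close>
  have q: "\<bar>?q - 1 / (real n * a)\<bar> \<le> Kq * sg"
  proof -
    have "\<bar>expect d V (\<lambda>x. Dv 0 x * y0 x) - expect d V (\<lambda>x. a * (y0 x)\<^sup>2)\<bar> \<le> expect d V (\<lambda>x. (2 * B) * (\<bar>y0 x\<bar> * s2 x))"
    proof (rule MV.E_close)
      fix x
      have "\<bar>Dv 0 x - a * y0 x\<bar> * \<bar>y0 x\<bar> \<le> 2 * B * s2 x * \<bar>y0 x\<bar>"
        by (intro mult_right_mono Dv0_taylor1) auto
      then show "\<bar>Dv 0 x * y0 x - a * (y0 x)\<^sup>2\<bar> \<le> (2 * B) * (\<bar>y0 x\<bar> * s2 x)"
        unfolding abs_mult[symmetric] by (simp add: algebra_simps power2_eq_square)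
    qed (intro tame_rules_ys tame_Dv)+
    moreover have "expect d V (\<lambda>x. Dv 0 x * y0 x) = 1 / real n"
      using MV.E_D_y[OF d0] unfolding ys_def .
    moreover have "2 * B * ?N \<le> 2 * B * ((1 + KY) * sg)" using N B_nonneg by (intro mult_left_mono) auto
    ultimately have "\<bar>1 / real n - a * ?q\<bar> \<le> 2 * B * ((1 + KY) * sg)" unfolding MV.E_cmult by linarith
    then have "\<bar>1 / real n - a * ?q\<bar> / a \<le> 2 * B * ((1 + KY) * sg) / a" using a_pos by (intro divide_right_mono) auto
    moreover have "?q - 1 / (real n * a) = - ((1 / real n - a * ?q) / a)" using a_pos n_pos by (simp add: field_simps)
    then have "\<bar>?q - 1 / (real n * a)\<bar> = \<bar>1 / real n - a * ?q\<bar> / a" using a_pos by (simp add: abs_divide)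
    ultimately show ?thesis unfolding Kq_def by (simp add: mult.assoc)
  qed
  \<comment> \<open>Test functions y_i for i \<ge> 1, taken together: the pairing has mean (d - 1)/n
    and leading part b rho^2.\<close>
  have r: "\<bar>?r - (real d - 1) / (real n * b)\<bar> \<le> Kr * sg"
  proof -
    have "\<bar>expect d V (\<lambda>x. \<Sum>i\<in>{1..<d}. Dv i x * ys x i) - expect d V (\<lambda>x. b * rho2 d (ys x))\<bar>
      \<le> expect d V (\<lambda>x. \<bar>be\<bar> * (\<bar>y0 x\<bar> * s2 x) + B * (s2 x)\<^sup>2)"
    proof (rule MV.E_close)
      fix x
      have "\<bar>y0 x\<bar> * rho2 d (ys x) \<le> \<bar>y0 x\<bar> * s2 x" by (intro mult_left_mono rho2_le_nrm2 d1) auto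
      then have "\<bar>be\<bar> * (\<bar>y0 x\<bar> * rho2 d (ys x)) \<le> \<bar>be\<bar> * (\<bar>y0 x\<bar> * s2 x)" by (rule mult_left_mono) simp
      then have "\<bar>be * y0 x * rho2 d (ys x)\<bar> \<le> \<bar>be\<bar> * (\<bar>y0 x\<bar> * s2 x)" by (simp add: abs_mult mult.assoc)
      then show "\<bar>(\<Sum>i\<in>{1..<d}. Dv i x * ys x i) - b * rho2 d (ys x)\<bar> \<le> \<bar>be\<bar> * (\<bar>y0 x\<bar> * s2 x) + B * (s2 x)\<^sup>2"
        using Dperp_taylor[of x] by linarith
    next
      show "tame d (\<lambda>x. \<Sum>i\<in>{1..<d}. Dv i x * ys x i)"
        by (intro tame_sum tame_mult tame_Dv tame_ys) auto
    qed (intro tame_rules_ys)+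
    moreover have "expect d V (\<lambda>x. \<Sum>i\<in>{1..<d}. Dv i x * ys x i) = (real d - 1) / real n"
    proof -
      have "expect d V (\<lambda>x. Dv i x * ys x i) = 1 / real n" if "i < d" for i
        using MV.E_D_y[OF that] unfolding ys_def .
      then have "(\<Sum>i\<in>{1..<d}. expect d V (\<lambda>x. Dv i x * ys x i)) = (real d - 1) / real n"
        using d1 by (simp add: of_nat_diff)
      then show ?thesis by (subst MV.E_sum) (auto intro: tame_mult tame_Dv tame_ys)
    qed
    moreover have "expect d V (\<lambda>x. \<bar>be\<bar> * (\<bar>y0 x\<bar> * s2 x) + B * (s2 x)\<^sup>2) \<le> \<bar>be\<bar> * ((1 + KY) * sg) + B * (kap\<^sup>2 * sg)"
    proof -
      have "expect d V (\<lambda>x. \<bar>be\<bar> * (\<bar>y0 x\<bar> * s2 x) + B * (s2 x)\<^sup>2) = \<bar>be\<bar> * ?N + B * expect d V (\<lambda>x. (s2 x)\<^sup>2)"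
        by (subst MV.E_lin2) (intro tame_rules_ys | simp only: MV.E_cmult)+
      then show ?thesis using N M2 B_nonneg by (simp only:) (intro add_mono mult_left_mono; simp)
    qed
    ultimately have "\<bar>(real d - 1) / real n - b * ?r\<bar> \<le> (\<bar>be\<bar> * (1 + KY) + B * kap\<^sup>2) * sg"
      unfolding MV.E_cmult distrib_right mult.assoc by linarith
    then have "\<bar>(real d - 1) / real n - b * ?r\<bar> / b \<le> (\<bar>be\<bar> * (1 + KY) + B * kap\<^sup>2) * sg / b" using b_pos by (intro divide_right_mono) auto
    moreover have "?r - (real d - 1) / (real n * b) = - (((real d - 1) / real n - b * ?r) / b)" using b_pos n_pos by (simp add: field_simps)
    then have "\<bar>?r - (real d - 1) / (real n * b)\<bar> = \<bar>(real d - 1) / real n - b * ?r\<bar> / b" using b_pos by (simp add: abs_divide)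
    ultimately show ?thesis unfolding Kr_def by simp
  qed
  have main: "\<bar>a * expect d V y0 + (al * ?q + be * ?r) / 2\<bar> \<le> B * (kap + kap\<^sup>2) * sg"
  proof -
    let ?k = "1 / sqrt (real n)"
    have "\<bar>expect d V (Dv 0) - expect d V (\<lambda>x. a * y0 x + ((al / 2) * (y0 x)\<^sup>2 + (be / 2) * rho2 d (ys x)))\<bar>
      \<le> expect d V (\<lambda>x. (B * ?k) * s2 x + (B * sqrt (real n)) * (s2 x)\<^sup>2)"
    proof (rule MV.E_close)
      fix x
      \<comment> \<open>The odd power is replaced by even ones, weighted by 1/sqrt n and sqrt n so
        that the averages of both terms are at most of order sg.\<close>
      have "(rr x) ^ 3 \<le> ?k * s2 x + sqrt (real n) * (s2 x)\<^sup>2"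
      proof -
        have w: "0 \<le> rr x" by simp
        have "0 \<le> (1 - sqrt (real n) * rr x)\<^sup>2" by simp
        then have "2 * (sqrt (real n) * rr x) \<le> 1 + (sqrt (real n))\<^sup>2 * (rr x)\<^sup>2"
          by (simp only: power2_diff power_mult_distrib) simp
        moreover have "0 \<le> sqrt (real n) * rr x" using w by simp
        ultimately have "sqrt (real n) * rr x \<le> 1 + (sqrt (real n))\<^sup>2 * s2 x" unfolding rr_sq by linarith
        then have "?k * s2 x * (sqrt (real n) * rr x) \<le> ?k * s2 x * (1 + (sqrt (real n))\<^sup>2 * s2 x)"
          by (intro mult_left_mono) auto
        moreover have "?k * s2 x * (sqrt (real n) * rr x) = s2 x * rr x" using sqrt_n(4) by simp
        moreover have "?k * s2 x * (1 + (sqrt (real n))\<^sup>2 * s2 x) = ?k * s2 x + sqrt (real n) * (s2 x)\<^sup>2"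
          by (rule rescale[OF sqrt_n(4)])
        moreover have "(rr x) ^ 3 = (rr x)\<^sup>2 * rr x" by (simp only: power3_eq_cube power2_eq_square)
        then have "(rr x) ^ 3 = s2 x * rr x" unfolding rr_sq .
        ultimately show ?thesis by simp
      qed
      then have "B * (rr x) ^ 3 \<le> B * (?k * s2 x + sqrt (real n) * (s2 x)\<^sup>2)" using B_nonneg by (intro mult_left_mono) auto
      moreover have "Dv 0 x - (a * y0 x + ((al / 2) * (y0 x)\<^sup>2 + (be / 2) * rho2 d (ys x)))
        = Dv 0 x - a * y0 x - (al * (y0 x)\<^sup>2 + be * rho2 d (ys x)) / 2" by (simp add: field_simps)
      ultimately show "\<bar>Dv 0 x - (a * y0 x + ((al / 2) * (y0 x)\<^sup>2 + (be / 2) * rho2 d (ys x)))\<bar>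
        \<le> (B * ?k) * s2 x + (B * sqrt (real n)) * (s2 x)\<^sup>2"
        using Dv0_taylor2[of x] unfolding distrib_left mult.assoc by linarith
    qed (intro tame_rules_ys tame_Dv)+
    moreover have "expect d V (\<lambda>x. a * y0 x + ((al / 2) * (y0 x)\<^sup>2 + (be / 2) * rho2 d (ys x))) = a * expect d V y0 + (al * ?q + be * ?r) / 2"
    proof -
      have "expect d V (\<lambda>x. a * y0 x + ((al / 2) * (y0 x)\<^sup>2 + (be / 2) * rho2 d (ys x)))
        = a * expect d V y0 + ((al / 2) * ?q + expect d V (\<lambda>x. (be / 2) * rho2 d (ys x)))"
        by (rule MV.E_lin3) (intro tame_rules_ys)+
      then show ?thesis unfolding MV.E_cmult by (simp add: add_divide_distrib)
    qed
    moreover have "expect d V (\<lambda>x. (B * ?k) * s2 x + (B * sqrt (real n)) * (s2 x)\<^sup>2) \<le> B * (kap + kap\<^sup>2) * sg"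
    proof -
      have "expect d V (\<lambda>x. (B * ?k) * s2 x + (B * sqrt (real n)) * (s2 x)\<^sup>2) = (B * ?k) * expect d V s2 + (B * sqrt (real n)) * expect d V (\<lambda>x. (s2 x)\<^sup>2)"
        by (subst MV.E_lin2) (intro tame_rules_ys | simp only: MV.E_cmult)+
      also have "\<dots> \<le> (B * ?k) * (kap * (real d / real n)) + (B * sqrt (real n)) * (kap\<^sup>2 * ((real d)\<^sup>2 / (real n)\<^sup>2))"
        using B_nonneg sqrt_n(4) by (intro add_mono mult_left_mono sm(1,2)) auto
      also have "\<dots> = B * kap * ?s + B * kap\<^sup>2 * (sqrt (real n) * ((real d)\<^sup>2 / (real n)\<^sup>2))"
        by (simp add: mult_ac)
      also have "\<dots> \<le> B * kap * sg + B * kap\<^sup>2 * sg"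
        unfolding sg_ge(4) using B_nonneg kap_pos sg_ge(1) by (intro add_mono mult_left_mono) auto
      finally show ?thesis by (simp add: algebra_simps)
    qed
    ultimately show ?thesis unfolding MV.E_D0 by linarith
  qed
  have "a * (expect d V y0 - dx0) = (a * expect d V y0 + (al * ?q + be * ?r) / 2)
      - (al * (?q - 1 / (real n * a))) / 2 - (be * (?r - (real d - 1) / (real n * b))) / 2"
    unfolding right_diff_distrib E_y0_decomp by (simp add: field_simps)
  moreover have "\<bar>al * (?q - 1 / (real n * a))\<bar> \<le> \<bar>al\<bar> * (Kq * sg)"
    unfolding abs_mult by (intro mult_left_mono q) auto
  moreover have "\<bar>be * (?r - (real d - 1) / (real n * b))\<bar> \<le> \<bar>be\<bar> * (Kr * sg)"
    unfolding abs_mult by (intro mult_left_mono r) auto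
  ultimately have "\<bar>a * (expect d V y0 - dx0)\<bar> \<le> B * (kap + kap\<^sup>2) * sg + \<bar>al\<bar> * (Kq * sg) + \<bar>be\<bar> * (Kr * sg)"
    using main by (rule abs_combine)
  also have "\<dots> = Km * sg" by (simp add: Km_def algebra_simps)
  finally show ?thesis using a_pos by (simp add: abs_mult)
qed

text \<open>A bound valid for all d and n, used above the threshold. The case split concerns d/n
  rather than \<epsilon>: for small d/n the linearisation and the second moment suffice, otherwise 1
  itself is at most kap d/n.\<close>

lemma mean_rough: "\<bar>expect d V y0 - dx0\<bar> \<le> Kd * (real d / real n)"
proof -
  let ?t = "real d / real n"
  have t: "0 < ?t" using d0 n_pos by simp
  have f: "(A * w + A' * w) / (2 * a) = ((A + A') / a * w) / 2" for A A' w :: real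
    using a_pos by (simp add: field_simps)
  have dx: "\<bar>dx0\<bar> \<le> (\<bar>al\<bar> / a + \<bar>be\<bar> / b) / a * ?t"
  proof -
    have "dx0 = - (al / a / real n + be / b * ((real d - 1) / real n)) / (2 * a)"
      unfolding dx0_def using a_pos b_pos n_pos by (simp add: field_simps)
    then have "\<bar>dx0\<bar> = \<bar>al / a / real n + be / b * ((real d - 1) / real n)\<bar> / (2 * a)"
      using a_pos by (simp add: abs_divide)
    also have "\<dots> \<le> (\<bar>al\<bar> / a * ?t + \<bar>be\<bar> / b * ?t) / (2 * a)"
    proof (intro divide_right_mono order_trans[OF abs_triangle_ineq] add_mono)
      have "\<bar>al / a / real n\<bar> = \<bar>al\<bar> / a * (1 / real n)" using a_pos by (simp add: abs_divide)
      also have "\<dots> \<le> \<bar>al\<bar> / a * ?t" using a_pos d1 n_pos by (intro mult_left_mono divide_right_mono) auto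
      finally show "\<bar>al / a / real n\<bar> \<le> \<bar>al\<bar> / a * ?t" .
      have "\<bar>be / b * ((real d - 1) / real n)\<bar> = \<bar>be\<bar> / b * ((real d - 1) / real n)"
        using b_pos d1 by (simp add: abs_mult abs_divide)
      also have "\<dots> \<le> \<bar>be\<bar> / b * ?t" using b_pos n_pos by (intro mult_left_mono divide_right_mono) auto
      finally show "\<bar>be / b * ((real d - 1) / real n)\<bar> \<le> \<bar>be\<bar> / b * ?t" .
    qed (use a_pos in auto)
    also have "\<dots> = ((\<bar>al\<bar> / a + \<bar>be\<bar> / b) / a * ?t) / 2" by (rule f)
    also have "\<dots> \<le> (\<bar>al\<bar> / a + \<bar>be\<bar> / b) / a * ?t"
      using a_pos b_pos t by (intro divide_le_self mult_nonneg_nonneg divide_nonneg_nonneg add_nonneg_nonneg) auto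
    finally show ?thesis .
  qed
  show ?thesis
  proof (cases "18 * real d \<le> c0 * real n")
    case True
    have "\<bar>expect d V (Dv 0) - expect d V (\<lambda>x. a * y0 x)\<bar> \<le> expect d V (\<lambda>x. (2 * B) * s2 x)"
      by (rule MV.E_close) (intro tame_rules_ys tame_Dv Dv0_taylor1)+
    then have "a * \<bar>expect d V y0\<bar> \<le> 2 * B * expect d V s2"
      unfolding MV.E_D0 MV.E_cmult using a_pos by (simp add: abs_mult)
    also have "\<dots> \<le> 2 * B * (kap * ?t)"
    proof (intro mult_left_mono)
      show "expect d V s2 \<le> kap * ?t"
        using MV.moment_bound[OF True, of 1] unfolding ys_def kap_def by simp
    qed (use B_nonneg in auto)
    finally have "a * \<bar>expect d V y0\<bar> / a \<le> 2 * B * (kap * ?t) / a" using a_pos by (intro divide_right_mono) auto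
    then have "\<bar>expect d V y0\<bar> \<le> 2 * B * kap / a * ?t" using a_pos by (simp add: mult_ac)
    then have "\<bar>expect d V y0 - dx0\<bar> \<le> ((\<bar>al\<bar> / a + \<bar>be\<bar> / b) / a + 2 * B * kap / a) * ?t"
      using dx unfolding distrib_right by linarith
    also have "\<dots> \<le> Kd * ?t" using t by (intro mult_right_mono Kd_ge) auto
    finally show ?thesis .
  next
    case False
    have "\<bar>expect d V y0\<bar> \<le> expect d V (\<lambda>x. \<bar>y0 x\<bar>)" by (rule MV.E_abs) (intro tame_rules_ys)
    also have "\<dots> \<le> 1 + real d / (c0 * real n)" using MV.E_abs_y0 unfolding ys_def .
    finally have "\<bar>expect d V y0\<bar> \<le> 1 + real d / (c0 * real n)" .
    moreover have "1 \<le> kap * ?t" using False c0_pos n_pos unfolding kap_def by (simp add: field_simps)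
    moreover have "real d / (c0 * real n) = 1 / c0 * ?t" by simp
    ultimately have "\<bar>expect d V y0\<bar> \<le> (kap + 1 / c0) * ?t" unfolding distrib_right by linarith
    then have "\<bar>expect d V y0 - dx0\<bar> \<le> ((\<bar>al\<bar> / a + \<bar>be\<bar> / b) / a + (kap + 1 / c0)) * ?t"
      using dx unfolding distrib_right[of _ "kap + 1 / c0" ?t] by linarith
    also have "\<dots> \<le> Kd * ?t" using t by (intro mult_right_mono Kd_ge) auto
    finally show ?thesis .
  qed
qed

text \<open>By \<open>norm_mean\<close> the norm is sqrt (n a) times the error of the first
  coordinate. For large \<epsilon> the rough bound gives sqrt n * d/n = \<epsilon>, which is then at
  most \<epsilon>^2/eta.\<close>

theorem mean_bound:
  "norm_mat (hessian d V e1) (\<lambda>i. mean d (gibbs d V) i - e1 i - delta_x d V e1 i) \<le> KM * \<epsilon>2"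
proof -
  have "sqrt (real n) * \<bar>expect d V y0 - dx0\<bar> \<le> (Km / a + Kd / eta) * \<epsilon>2"
  proof (cases "\<epsilon>2 \<le> eta")
    case True
    have "\<bar>expect d V y0 - dx0\<bar> \<le> Km / a * sg"
      using mean_small[OF small_of_eta[OF True]] a_pos by (simp add: field_simps)
    then have "sqrt (real n) * \<bar>expect d V y0 - dx0\<bar> \<le> sqrt (real n) * (Km / a * sg)" by (intro mult_left_mono) auto
    also have "\<dots> = Km / a * (sqrt (real n) * sg)" by simp
    also have "\<dots> = Km / a * \<epsilon>2" unfolding sg_ge(3) ..
    also have "\<dots> \<le> (Km / a + Kd / eta) * \<epsilon>2"
      using Kd_ge(1) eta_pos(1) by (intro mult_right_mono) auto
    finally show ?thesis .
  next
    case False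
    have "sqrt (real n) * \<bar>expect d V y0 - dx0\<bar> \<le> sqrt (real n) * (Kd * (real d / real n))"
      by (intro mult_left_mono mean_rough) auto
    also have "\<dots> = Kd * \<epsilon>"
    proof -
      have "sqrt (real n) * (real d / real n) = \<epsilon>"
        using n_pos sqrt_n(3,4) by (simp add: field_simps)
      then show ?thesis by (metis mult.left_commute)
    qed
    also have "\<dots> \<le> Kd * (\<epsilon>2 / eta)" using False Kd_ge(1) by (intro mult_left_mono eps_large) auto
    also have "\<dots> = Kd / eta * \<epsilon>2" by simp
    also have "\<dots> \<le> (Km / a + Kd / eta) * \<epsilon>2"
      using Km_nonneg a_pos by (intro mult_right_mono) auto
    finally show ?thesis .
  qed
  then have "sqrt a * (sqrt (real n) * \<bar>expect d V y0 - dx0\<bar>) \<le> sqrt a * ((Km / a + Kd / eta) * \<epsilon>2)"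
    using a_pos by (intro mult_left_mono) auto
  then show ?thesis
    unfolding norm_mean KM_def real_sqrt_mult by (simp only: mult_ac)
qed

end

theorem lemma2p27:
  fixes \<psi> :: "real \<Rightarrow> real"
  assumes "C4 \<psi>"
    and "strictly_convex \<psi>"
    and "bounded (range ((deriv ^^ 3) \<psi>))"
    and "bounded (range ((deriv ^^ 4) \<psi>))"
  shows "(\<forall>d\<ge>1.
            (\<forall>x\<in>Rd d. v_fun \<psi> d x =
               (\<integral>z. \<psi> (dot d z x) \<partial>std_gaussian d)
               - (\<integral>z. deriv \<psi> (dot d z (first_unit d)) * dot d z x \<partial>std_gaussian d)) \<and>
            (\<forall>x\<in>Rd d. x \<noteq> first_unit d \<longrightarrow> v_fun \<psi> d (first_unit d) < v_fun \<psi> d x)) \<and>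
         (\<exists>C'>0. \<exists>C>0. \<forall>d n :: nat. d \<ge> 1 \<longrightarrow> n \<ge> 1 \<longrightarrow>
            (let V = (\<lambda>x. real n * v_fun \<psi> d x);
                 xh = first_unit d;
                 H = hessian d V xh;
                 \<pi> = gibbs d V;
                 \<gamma> = gaussian d xh (inv_mat H);
                 xbar = mean d \<pi>;
                 \<epsilon> = real d / sqrt (real n);
                 \<tau> = real d * exp (- C * real n powr (1 / 4) * sqrt (real d))
             in \<bar>TV \<pi> \<gamma> - L_TV d V xh\<bar> \<le> C' * (\<epsilon>\<^sup>2 + \<tau>) \<and>
                norm_mat H (\<lambda>i. xbar i - xh i - delta_x d V xh i) \<le> C' * (\<epsilon>\<^sup>2 + \<tau>)))"
proof -
  obtain b3 where b3: "\<And>t. \<bar>(deriv ^^ 3) \<psi> t\<bar> \<le> b3" using assms(3) by (auto simp: bounded_iff)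
  obtain b4 where b4: "\<And>t. \<bar>(deriv ^^ 4) \<psi> t\<bar> \<le> b4" using assms(4) by (auto simp: bounded_iff)
  \<comment> \<open>One constant B is to bound both the third and the fourth derivative.\<close>
  have "smooth_convex \<psi> (max b3 b4)"
    by standard (use assms(1,2) b3 b4 in \<open>auto simp: le_max_iff_disj\<close>)
  then interpret smooth_convex \<psi> "max b3 b4" .
  have dim: "smooth_convex_dim \<psi> (max b3 b4) d" if "1 \<le> d" for d
    by standard (rule that)
  \<comment> \<open>Both \<open>KT\<close> and \<open>KM\<close> are fixed before d and n are
    introduced, so C' is uniform; the summand 1 makes it positive.\<close>
  define C' where "C' = 1 + \<bar>KT\<bar> + \<bar>KM\<bar>"
  have C': "C' > 0" by (simp add: C'_def)
  have main: "\<bar>TV (gibbs d (\<lambda>x. real n * v_fun \<psi> d x)) (gaussian d (first_unit d) (inv_mat (hessian d (\<lambda>x. real n * v_fun \<psi> d x) (first_unit d))))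
        - L_TV d (\<lambda>x. real n * v_fun \<psi> d x) (first_unit d)\<bar> \<le> C' * ((real d / sqrt (real n))\<^sup>2 + t)
     \<and> norm_mat (hessian d (\<lambda>x. real n * v_fun \<psi> d x) (first_unit d))
       (\<lambda>i. mean d (gibbs d (\<lambda>x. real n * v_fun \<psi> d x)) i - first_unit d i - delta_x d (\<lambda>x. real n * v_fun \<psi> d x) (first_unit d) i)
       \<le> C' * ((real d / sqrt (real n))\<^sup>2 + t)"
    if dn: "1 \<le> d" "1 \<le> n" and t: "0 \<le> t" for d n :: nat and t :: real
  proof -
    interpret dimd: smooth_convex_dim \<psi> "max b3 b4" d by (rule dim[OF dn(1)])
    interpret L: smooth_convex_laplace \<psi> "max b3 b4" d n by standard (rule dn(2))
    have V: "(\<lambda>x. real n * v_fun \<psi> d x) = L.V" by (simp add: L.V_def[abs_def])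
    have e: "(real d / sqrt (real n))\<^sup>2 = (real d)\<^sup>2 / real n" by (rule L.eps_sq)
    have up: "K * ((real d)\<^sup>2 / real n) \<le> C' * ((real d)\<^sup>2 / real n + t)" if "K \<le> C'" for K
    proof -
      have "K * ((real d)\<^sup>2 / real n) \<le> C' * ((real d)\<^sup>2 / real n)" using that by (intro mult_right_mono) auto
      also have "\<dots> \<le> C' * ((real d)\<^sup>2 / real n + t)" using C' t by (intro mult_left_mono) auto
      finally show ?thesis .
    qed
    have K: "KT \<le> C'" "KM \<le> C'" by (auto simp: C'_def)
    show ?thesis
      unfolding V e L.gaussian_Q
      using order_trans[OF L.TV_bound up[OF K(1)]] order_trans[OF L.mean_bound up[OF K(2)]] by blast
  qed
  show ?thesis
  proof (intro conjI allI impI ballI)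
    fix d :: nat and x assume d: "1 \<le> d" and "x \<in> Rd d"
    interpret dimd: smooth_convex_dim \<psi> "max b3 b4" d by (rule dim[OF d])
    show "v_fun \<psi> d x = (\<integral>z. \<psi> (dot d z x) \<partial>std_gaussian d)
               - (\<integral>z. deriv \<psi> (dot d z (first_unit d)) * dot d z x \<partial>std_gaussian d)"
      by (rule dimd.v_integral)
  next
    fix d :: nat and x assume d: "1 \<le> d" and x: "x \<in> Rd d" "x \<noteq> first_unit d"
    interpret dimd: smooth_convex_dim \<psi> "max b3 b4" d by (rule dim[OF d])
    show "v_fun \<psi> d (first_unit d) < v_fun \<psi> d x" by (rule dimd.v_strict_min[OF x])
  next
    show "\<exists>C'>0. \<exists>C>0. \<forall>d n :: nat. d \<ge> 1 \<longrightarrow> n \<ge> 1 \<longrightarrow>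
            (let V = (\<lambda>x. real n * v_fun \<psi> d x);
                 xh = first_unit d;
                 H = hessian d V xh;
                 \<pi> = gibbs d V;
                 \<gamma> = gaussian d xh (inv_mat H);
                 xbar = mean d \<pi>;
                 \<epsilon> = real d / sqrt (real n);
                 \<tau> = real d * exp (- C * real n powr (1 / 4) * sqrt (real d))
             in \<bar>TV \<pi> \<gamma> - L_TV d V xh\<bar> \<le> C' * (\<epsilon>\<^sup>2 + \<tau>) \<and>
                norm_mat H (\<lambda>i. xbar i - xh i - delta_x d V xh i) \<le> C' * (\<epsilon>\<^sup>2 + \<tau>))"
      unfolding Let_def
    \<comment> \<open>\<open>main\<close> holds for every nonnegative \<open>t\<close>; it is
      applied to the value of \<tau> at C = 1.\<close>
    proof (rule exI[of _ C'], rule conjI[OF C'], rule exI[of _ "1::real"], intro conjI allI impI)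
      fix d n :: nat assume dn: "1 \<le> d" "1 \<le> n"
      have t: "0 \<le> real d * exp (- 1 * real n powr (1 / 4) * sqrt (real d))" by simp
      note main[OF dn t]
      then show "\<bar>TV (gibbs d (\<lambda>x. real n * v_fun \<psi> d x)) (gaussian d (first_unit d) (inv_mat (hessian d (\<lambda>x. real n * v_fun \<psi> d x) (first_unit d))))
        - L_TV d (\<lambda>x. real n * v_fun \<psi> d x) (first_unit d)\<bar> \<le> C' * ((real d / sqrt (real n))\<^sup>2 + real d * exp (- 1 * real n powr (1 / 4) * sqrt (real d)))"
       "norm_mat (hessian d (\<lambda>x. real n * v_fun \<psi> d x) (first_unit d))
       (\<lambda>i. mean d (gibbs d (\<lambda>x. real n * v_fun \<psi> d x)) i - first_unit d i - delta_x d (\<lambda>x. real n * v_fun \<psi> d x) (first_unit d) i)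
       \<le> C' * ((real d / sqrt (real n))\<^sup>2 + real d * exp (- 1 * real n powr (1 / 4) * sqrt (real d)))"
        by blast+
    qed simp
  qed
qed

end
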